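(* Let $\Phi\subset N_{\mathbb R}$ be a compact convex domain (with non-empty interior), with final time $t_\Phi$ and caustic $\mathcal K_\Phi$. Then the limit values $\operatorname{l}(\mathcal K_\Phi)<\infty$ and $\operatorname{l}(\partial\Phi)<\infty$ exist, and $$\operatorname{l}(\mathcal K_\Phi)+\operatorname{l}(\partial\Phi)=12\,t_\Phi+4\operatorname{l}(\Phi(t_\Phi)).$$
   Context: $N\cong\mathbb Z^2$ is a rank two lattice, $N_{\mathbb R}=N\otimes\mathbb R$, $M=\operatorname{Hom}(N,\mathbb Z)$. A half-plane with rational slope is $H=\{p\in N_{\mathbb R}:\lambda(p)\ge c\}$ with $c\in\mathbb R$, $\lambda\in M$ primitive; $H(t)=\{p:\lambda(p)\ge c+t\}$. For closed convex $\Phi$, $\mathcal H_\Phi$ is the set of rational-slope half-planes $H$ with $H\supset\Phi$, $\partial H\cap\partial\Phi\neq\emptyset$, and $\Phi(t)=\bigcap_{H\in\mathcal H_\Phi}H(t)$ for $t\ge0$. The final time $t_\Phi$ is the minimal $t$ such that $\Phi(t)$ has empty interior; it is finite and positive for compact $\Phi$ with non-empty interior. For $0<t<t_\Phi$, $\Phi(t)$ is a finite polygon with rational slope sides. The set $\Phi(t_\Phi)$ is a point or an interval of rational slope. The caustic $\mathcal K_\Phi$ (in the interior of $\Phi$) is the locus of all vertices of the polygons $\Phi(t)$ for all $t\in(0,t_\Phi)$, together with $\Phi(t_\Phi)$. Its points carry weights: a vertex of $\Phi(t)$, $0<t<t_\Phi$, at which the two adjacent sides are parallel to primitive vectors $v,w\in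 N$, has weight $|v\wedge w|$ (the absolute value of the determinant of $v,w$ in a basis of $N$); the points of $\Phi(t_\Phi)$ have weight 2 (if $\Phi(t_\Phi)$ is a point, it is irrelevant for the length). $\mathcal K_\Phi$ is a locally finite weighted graph with straight edges of rational slope, the weight being constant along each edge. The tropical length of an interval of rational slope is its Euclidean length divided by the Euclidean length of the primitive vector of $N$ parallel to it. If $\Phi$ is a polygon with rational slopes, then $\mathcal K_\Phi$ is a finite graph; $\operatorname{l}(\mathcal K_\Phi)$ is the sum over its edges of (weight)$\times$(tropical length), and $\operatorname{l}(\partial\Phi)$ is the sum of the tropical lengths of the sides of $\Phi$. For general compact convex $\Phi$, these are defined as the limits $\operatorname{l}(\mathcal K_\Phi)=\lim_{t\to0^+}\operatorname{l}(\mathcal K_{\Phi(t)})$ and $\operatorname{l}(\partial\Phi)=\lim_{t\to0^+}\operatorname{l}(\partial\Phi(t))$ (where $\Phi(t)$, $t>0$, is a rational slope polygon). Finally $\operatorname{l}(\Phi(t_\Phi))$ is the tropical length of the interval $\Phi(t_\Phi)$ (not multiplied by the weight), and $0$ if $\Phi(t_\Phi)$ is a point. *)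

theory Defs
  imports "HOL-Analysis.Analysis"
begin

text \<open>The lattice \<open>N\<close> is identified with the integer vectors of \<open>N\<^sub>\<real> = real^2\<close> by choosing a
  basis, and \<open>M = Hom(N, \<int>)\<close> with integer vectors as well, acting by the inner product.\<close>

definition lattice_vecs :: "(real^2) set" where
  "lattice_vecs = {v. \<forall>i. v $ i \<in> \<int>}"

definition primitive_vec :: "real^2 \<Rightarrow> bool" where
  "primitive_vec v \<longleftrightarrow> v \<in> lattice_vecs \<and> v \<noteq> 0 \<and>
     (\<forall>w\<in>lattice_vecs. \<forall>k::int. v = of_int k *\<^sub>R w \<longrightarrow> \<bar>k\<bar> = 1)"

definition wedge :: "real^2 \<Rightarrow> real^2 \<Rightarrow> real" where
  "wedge v w = v $ 1 * w $ 2 - v $ 2 * w $ 1"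

definition parallel_to :: "(real^2) set \<Rightarrow> real^2 \<Rightarrow> bool" where
  "parallel_to I v \<longleftrightarrow> (\<forall>x\<in>I. \<forall>y\<in>I. x - y \<in> span {v})"

text \<open>A primitive vector parallel to a segment of rational slope is unique up to sign, and both
  \<open>norm\<close> and \<open>\<bar>wedge _ _\<bar>\<close> ignore the sign. For a single point the vector is arbitrary, but the
  diameter vanishes, so the tropical length is 0.\<close>

definition primitive_dir :: "(real^2) set \<Rightarrow> real^2" where
  "primitive_dir I = (SOME v. primitive_vec v \<and> parallel_to I v)"

definition tropical_length :: "(real^2) set \<Rightarrow> real" where
  "tropical_length I = diameter I / norm (primitive_dir I)"

definition half_plane :: "real^2 \<Rightarrow> real \<Rightarrow> (real^2) set" where
  "half_plane l c = {p. l \<bullet> p \<ge> c}"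

text \<open>A half-plane of rational slope is represented by the pair \<open>(l, c)\<close> with \<open>l\<close> primitive,
  which it determines uniquely; hence the shift \<open>H(t)\<close> is \<open>half_plane l (c + t)\<close>.\<close>

definition supporting_half_planes :: "(real^2) set \<Rightarrow> ((real^2) \<times> real) set" where
  "supporting_half_planes \<Phi> = {(l, c). primitive_vec l \<and> \<Phi> \<subseteq> half_plane l c \<and>
     frontier (half_plane l c) \<inter> frontier \<Phi> \<noteq> {}}"

definition evolve :: "(real^2) set \<Rightarrow> real \<Rightarrow> (real^2) set" where
  "evolve \<Phi> t = (\<Inter>(l, c)\<in>supporting_half_planes \<Phi>. half_plane l (c + t))"

definition final_time :: "(real^2) set \<Rightarrow> real" where
  "final_time \<Phi> = (LEAST t. 0 \<le> t \<and> interior (evolve \<Phi> t) = {})"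

definition final_set :: "(real^2) set \<Rightarrow> (real^2) set" where
  "final_set \<Phi> = evolve \<Phi> (final_time \<Phi>)"

definition caustic :: "(real^2) set \<Rightarrow> (real^2) set" where
  "caustic \<Phi> =
     {p. \<exists>t. 0 < t \<and> t < final_time \<Phi> \<and> p extreme_point_of evolve \<Phi> t} \<union> final_set \<Phi>"

text \<open>The description in the last branch is unambiguous: the boundaries of \<open>evolve \<Phi> t\<close> for different
  \<open>t\<close> are disjoint, and a vertex of a polygon lies on exactly two sides.\<close>

definition caustic_weight :: "(real^2) set \<Rightarrow> real^2 \<Rightarrow> real" where
  "caustic_weight \<Phi> p =
     (if p \<in> final_set \<Phi> then 2
      else (THE m. \<exists>t e f. 0 < t \<and> t < final_time \<Phi> \<and> p extreme_point_of evolve \<Phi> t \<and>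
              e edge_of evolve \<Phi> t \<and> f edge_of evolve \<Phi> t \<and> e \<noteq> f \<and> p \<in> e \<and> p \<in> f \<and>
              m = \<bar>wedge (primitive_dir e) (primitive_dir f)\<bar>))"

text \<open>Graph structure of the caustic: its (open) edges are the maximal open segments which are
  relatively open in the caustic, so that no branching occurs inside, and of constant weight.
  Weights at the remaining points, the nodes of the graph, do not enter the length.\<close>

definition caustic_segment :: "(real^2) set \<Rightarrow> (real^2) set \<Rightarrow> bool" where
  "caustic_segment \<Phi> I \<longleftrightarrow> (\<exists>a b. a \<noteq> b \<and> I = open_segment a b) \<and>
     openin (top_of_set (caustic \<Phi>)) I \<and> caustic_weight \<Phi> constant_on I"

definition caustic_edges :: "(real^2) set \<Rightarrow> (real^2) set set" where
  "caustic_edges \<Phi> =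
     {I. caustic_segment \<Phi> I \<and> (\<forall>J. caustic_segment \<Phi> J \<and> I \<subseteq> J \<longrightarrow> J = I)}"

definition edge_weight :: "(real^2) set \<Rightarrow> (real^2) set \<Rightarrow> real" where
  "edge_weight \<Phi> I = the_elem (caustic_weight \<Phi> ` I)"

definition rational_polygon :: "(real^2) set \<Rightarrow> bool" where
  "rational_polygon \<Phi> \<longleftrightarrow> polytope \<Phi> \<and> interior \<Phi> \<noteq> {} \<and>
     (\<forall>e. e edge_of \<Phi> \<longrightarrow> (\<exists>v. primitive_vec v \<and> parallel_to e v))"

text \<open>The finite sums are the lengths for polygons with rational slopes; the limits apply to
  all other compact convex sets.\<close>

definition polygon_caustic_length :: "(real^2) set \<Rightarrow> real" where
  "polygon_caustic_length \<Phi> = (\<Sum>I\<in>caustic_edges \<Phi>. edge_weight \<Phi> I * tropical_length I)"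

definition polygon_boundary_length :: "(real^2) set \<Rightarrow> real" where
  "polygon_boundary_length \<Phi> = (\<Sum>e | e edge_of \<Phi>. tropical_length e)"

definition caustic_length :: "(real^2) set \<Rightarrow> real" where
  "caustic_length \<Phi> =
     (if rational_polygon \<Phi> then polygon_caustic_length \<Phi>
      else Lim (at_right 0) (\<lambda>t. polygon_caustic_length (evolve \<Phi> t)))"

definition boundary_length :: "(real^2) set \<Rightarrow> real" where
  "boundary_length \<Phi> =
     (if rational_polygon \<Phi> then polygon_boundary_length \<Phi>
      else Lim (at_right 0) (\<lambda>t. polygon_boundary_length (evolve \<Phi> t)))"

end

theory Submission
  imports Defs
begin

text \<open>While the combinatorial type of \<open>\<Phi>(t)\<close> is constant, a vertex with adjacent primitive normals
  \<open>l, m\<close> moves with the velocity \<open>v\<close> given by \<open>l \<bullet> v = m \<bullet> v = 1\<close>, which is a primitive lattice vector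
  because the triangle \<open>0, l, m\<close> contains no lattice points off \<open>[l, m]\<close> other than \<open>0\<close>. Hence the length
  of the caustic is the time integral of the sum \<open>W\<close> of the weights of the vertices plus twice the
  length of the final set. The perimeter \<open>B\<close> satisfies \<open>W - B' = 12\<close>: this is Noether's formula for
  the normal fan, and follows by telescoping from a potential on primitive vectors whose differences
  along unimodular cones are the terms \<open>3 - a/b - b/a\<close>, up to a jump by \<open>12\<close> per turn, where \<open>a, b\<close>
  are the values of a fixed irrational functional on the generators. Since \<open>B\<close> tends to twice the length
  of the final set, integration proves the formula for polygons. In general, \<open>\<Phi>(s)\<close> is a polygon for
  \<open>s > 0\<close> with \<open>\<Phi>(s)(t) = \<Phi>(s + t)\<close>, and the limits exist because \<open>B(t) + 12 t\<close> is nonnegative and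
  nondecreasing.\<close>

text \<open>A cyclic enumeration of the sides is avoided in two ways. A functional of irrational
  slope vanishes on no nonzero lattice covector, so each side length is a difference of two corner
  terms and the perimeter is a sum over corners. The maps from a corner to its two normals are
  bijections onto the side normals, so telescoping is a cancellation of two equal sums. That the
  normals wind around once is seen at the single corner where they enter the upper half-plane. The
  12 is 6 + 6: passing from the cone (l, m) to (-m, l) turns a Noether term x into 6 - x, so each
  half-turn contributes 6. The triangle 0, l, m is empty because the evolution uses all primitive
  covectors: one below the segment [l, m] would have cut off the corner. Hence the finite sets of
  normals are chosen generously, and the notions of side and corner tolerate normals that are
  redundant at a given moment. The edges of the caustic are maximal segments, whereas the proof
  produces one trajectory per pair of normals; it is left undecided whether a trajectory is
  maximal.\<close>

lemma inner2: "x \<bullet> y = x$1 * y$1 + x$2 * y$2" for x y :: "real^2"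
  by (simp add: inner_vec_def sum_2)

lemma vec2_eq_iff: "x = y \<longleftrightarrow> x$1 = y$1 \<and> x$2 = y$2" for x y :: "real^2"
  by (simp add: vec_eq_iff forall_2)

text \<open>Counterclockwise quarter turn. For an inner normal \<open>l\<close>, the vector
  \<open>rot l\<close> runs along the side and keeps the polygon on its right.\<close>

definition rot :: "real^2 \<Rightarrow> real^2" where
  "rot v = vector [- v$2, v$1]"

lemma rot_nth [simp]: "rot v $ 1 = - v$2" "rot v $ 2 = v$1"
  by (simp_all add: rot_def)

lemmas vec2_simps = inner2 wedge_def vec2_eq_iff

lemma wedge_eq_inner_rot: "wedge l m = m \<bullet> rot l"
  by (simp add: vec2_simps)

lemma wedge_swap: "wedge m l = - wedge l m"
  by (simp add: wedge_def)

lemma wedge_self [simp]: "wedge l l = 0"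
  by (simp add: wedge_def)

lemma wedge_add_left: "wedge (l + m) n = wedge l n + wedge m n"
  and wedge_add_right: "wedge n (l + m) = wedge n l + wedge n m"
  and wedge_diff_left: "wedge (l - m) n = wedge l n - wedge m n"
  and wedge_diff_right: "wedge n (l - m) = wedge n l - wedge n m"
  and wedge_scale_left: "wedge (c *\<^sub>R l) n = c * wedge l n"
  and wedge_scale_right: "wedge n (c *\<^sub>R l) = c * wedge n l"
  and wedge_minus_left: "wedge (- l) n = - wedge l n"
  and wedge_minus_right: "wedge n (- l) = - wedge n l"
  by (simp_all add: wedge_def algebra_simps)

lemmas wedge_linear = wedge_add_left wedge_add_right wedge_diff_left wedge_diff_right
  wedge_scale_left wedge_scale_right wedge_minus_left wedge_minus_right

text \<open>Cramer's rule, multiplied out so that it also covers parallel \<open>l\<close> and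
  \<open>m\<close>.\<close>

lemma wedge_decompose: "wedge l m *\<^sub>R x = wedge x m *\<^sub>R l + wedge l x *\<^sub>R m"
  by (simp add: vec2_simps algebra_simps)

lemma wedge_decompose_inner: "wedge l m * (x \<bullet> p) = wedge x m * (l \<bullet> p) + wedge l x * (m \<bullet> p)"
  using arg_cong[OF wedge_decompose, of "\<lambda>y. y \<bullet> p" l m x] by (simp add: inner_add_left)

lemma rot_eq_0_iff [simp]: "rot v = 0 \<longleftrightarrow> v = 0"
  by (auto simp: vec2_eq_iff)

lemma inner_rot_self [simp]: "v \<bullet> rot v = 0" "rot v \<bullet> v = 0"
  by (simp_all add: inner2)

lemma orthogonal_imp_multiple_rot:
  assumes "l \<noteq> 0" "l \<bullet> x = 0"
  obtains c where "x = c *\<^sub>R rot l"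
proof
  have "(l \<bullet> l) *\<^sub>R x = (l \<bullet> x) *\<^sub>R l + (rot l \<bullet> x) *\<^sub>R rot l"
    by (simp add: vec2_simps algebra_simps)
  then have "(l \<bullet> l) *\<^sub>R x = (rot l \<bullet> x) *\<^sub>R rot l"
    using assms by simp
  then show "x = ((rot l \<bullet> x) / (l \<bullet> l)) *\<^sub>R rot l"
    using \<open>l \<noteq> 0\<close> by (smt (verit) divide_inverse_commute inner_eq_zero_iff scaleR_left_imp_eq scaleR_scaleR
        left_inverse scaleR_one mult.commute)
qed

section \<open>Lattice vectors\<close>

lemma lattice_vecs_iff: "v \<in> lattice_vecs \<longleftrightarrow> v$1 \<in> \<int> \<and> v$2 \<in> \<int>"
  by (simp add: lattice_vecs_def forall_2)

lemma lattice_vecs_add: "v \<in> lattice_vecs \<Longrightarrow> w \<in> lattice_vecs \<Longrightarrow> v + w \<in> lattice_vecs"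
  and lattice_vecs_diff: "v \<in> lattice_vecs \<Longrightarrow> w \<in> lattice_vecs \<Longrightarrow> v - w \<in> lattice_vecs"
  and lattice_vecs_minus: "v \<in> lattice_vecs \<Longrightarrow> - v \<in> lattice_vecs"
  and lattice_vecs_scale: "c \<in> \<int> \<Longrightarrow> v \<in> lattice_vecs \<Longrightarrow> c *\<^sub>R v \<in> lattice_vecs"
  and lattice_vecs_rot: "v \<in> lattice_vecs \<Longrightarrow> rot v \<in> lattice_vecs"
  by (auto simp: lattice_vecs_iff)

lemmas lattice_vecs_closed = lattice_vecs_add lattice_vecs_diff lattice_vecs_minus
  lattice_vecs_scale lattice_vecs_rot

lemma wedge_in_Ints: "v \<in> lattice_vecs \<Longrightarrow> w \<in> lattice_vecs \<Longrightarrow> wedge v w \<in> \<int>"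
  by (auto simp: lattice_vecs_iff wedge_def)

lemma lattice_vecE:
  assumes "v \<in> lattice_vecs"
  obtains x y :: int where "v = vector [of_int x, of_int y]"
  using assms by (auto simp: lattice_vecs_iff vec2_eq_iff elim!: Ints_cases)

lemma lattice_vector_int: "vector [of_int x, of_int y] \<in> lattice_vecs"
  by (simp add: lattice_vecs_iff)

lemma primitive_vecD:
  assumes "primitive_vec v"
  shows "v \<in> lattice_vecs" "v \<noteq> 0"
  using assms by (auto simp: primitive_vec_def)

text \<open>Primitivity makes the coordinates coprime, and Bezout coefficients complete
  \<open>l\<close> to a basis of the lattice.\<close>

lemma primitive_bezout:
  assumes "primitive_vec l"
  obtains n where "n \<in> lattice_vecs" "wedge l n = 1"
proof -
  obtain x y :: int where l: "l = vector [of_int x, of_int y]"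
    using assms lattice_vecE primitive_vecD by blast
  define g where "g = gcd x y"
  have "l = of_int g *\<^sub>R vector [of_int (x div g), of_int (y div g)]"
    by (simp add: l g_def vec2_eq_iff flip: of_int_mult)
  then have "g = 1"
    using assms lattice_vector_int unfolding primitive_vec_def
    by (metis abs_of_nonneg g_def gcd_ge_0_int)
  moreover obtain u v where "u * x + v * y = gcd x y"
    using bezout_int by blast
  ultimately have "x * u - y * (- v) = 1"
    by (simp add: g_def algebra_simps)
  then have "wedge l (vector [of_int (- v), of_int u]) = 1"
    unfolding l wedge_def by (simp add: mult.commute flip: of_int_mult of_int_add)
  then show ?thesis
    using that lattice_vector_int by blast
qed

text \<open>An integer factor of \<open>l\<close> divides \<open>wedge l n\<close>, which is
  1.\<close>

lemma primitive_if_wedge_1: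
  assumes "l \<in> lattice_vecs" "n \<in> lattice_vecs" "wedge l n = 1"
  shows "primitive_vec l"
  unfolding primitive_vec_def
proof (intro conjI ballI allI impI)
  show "l \<noteq> 0" using assms by (auto simp: wedge_def)
  fix w k assume w: "w \<in> lattice_vecs" and l: "l = of_int k *\<^sub>R w"
  obtain j :: int where j: "wedge w n = of_int j"
    using wedge_in_Ints[OF w assms(2)] by (auto elim: Ints_cases)
  have "of_int (k * j) = (1::real)"
    using assms(3) by (simp add: l wedge_linear j)
  then have "k * j = 1" by linarith
  then show "\<bar>k\<bar> = 1"
    by (metis abs_zmult_eq_1 abs_1)
qed fact

lemma primitive_minus: "primitive_vec l \<Longrightarrow> primitive_vec (- l)"
  by (metis primitive_bezout primitive_if_wedge_1 primitive_vecD(1) lattice_vecs_minus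
      wedge_minus_left wedge_minus_right minus_minus)

lemma primitive_rot: "primitive_vec l \<Longrightarrow> primitive_vec (rot l)"
proof -
  assume l: "primitive_vec l"
  then obtain n where n: "n \<in> lattice_vecs" "wedge l n = 1"
    by (rule primitive_bezout)
  have "wedge (rot l) (rot n) = 1"
    using n(2) by (simp add: wedge_def algebra_simps)
  then show "primitive_vec (rot l)"
    using l n by (intro primitive_if_wedge_1[of _ "rot n"]) (auto intro!: lattice_vecs_closed intro: primitive_vecD)
qed

lemma lattice_parallel_multiple:
  assumes "primitive_vec l" "m \<in> lattice_vecs" "wedge l m = 0"
  obtains k :: int where "m = of_int k *\<^sub>R l"
proof -
  obtain n where n: "n \<in> lattice_vecs" "wedge l n = 1"
    using assms primitive_bezout by blast
  then have "m = wedge m n *\<^sub>R l"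
    using wedge_decompose[of l n m] assms by simp
  moreover obtain k :: int where "wedge m n = of_int k"
    using wedge_in_Ints[OF assms(2) n(1)] by (rule Ints_cases)
  ultimately show ?thesis
    using that by metis
qed

lemma primitive_parallel:
  assumes "primitive_vec l" "primitive_vec m" "wedge l m = 0"
  shows "m = l \<or> m = - l"
proof -
  obtain k :: int where k: "m = of_int k *\<^sub>R l"
    using assms lattice_parallel_multiple primitive_vecD by metis
  then have "\<bar>k\<bar> = 1"
    using assms unfolding primitive_vec_def by blast
  then have "k = 1 \<or> k = -1" by linarith
  then show ?thesis using k by auto
qed

lemma primitive_same_direction:
  assumes "primitive_vec l" "primitive_vec m" "wedge l m = 0" "l \<bullet> v > 0" "m \<bullet> v > 0"
  shows "m = l"
  using primitive_parallel[OF assms(1-3)] assms(4,5) by auto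

lemma lattice_multiple_primitive:
  assumes "v \<in> lattice_vecs" "v \<noteq> 0"
  obtains k w where "k \<ge> (1::nat)" "primitive_vec w" "v = real k *\<^sub>R w"
proof -
  obtain x y :: int where v: "v = vector [of_int x, of_int y]"
    using assms lattice_vecE by blast
  define g where "g = gcd x y"
  have g: "g > 0" using assms(2) by (auto simp: v g_def vec2_eq_iff)
  define w :: "real^2" where "w = vector [of_int (x div g), of_int (y div g)]"
  have vw: "v = of_int g *\<^sub>R w"
    by (simp add: v w_def g_def vec2_eq_iff flip: of_int_mult)
  obtain a b where ab: "a * x + b * y = g"
    unfolding g_def using bezout_int by blast
  have "g * ((x div g) * a - (y div g) * (- b)) = g * 1"
    using ab by (simp add: g_def algebra_simps)
  then have "(x div g) * a - (y div g) * (- b) = 1"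
    using g by (metis less_irrefl mult_cancel_left)
  then have "of_int ((x div g) * a - (y div g) * (- b)) = (1::real)"
    by simp
  then have "wedge w (vector [of_int (- b), of_int a]) = 1"
    by (simp add: w_def wedge_def)
  then have "primitive_vec w"
    unfolding w_def by (metis primitive_if_wedge_1 lattice_vector_int)
  moreover have "v = real (nat g) *\<^sub>R w" "nat g \<ge> 1"
    using g vw by simp_all
  ultimately show ?thesis using that by blast
qed

lemma primitive_norm_ge_1:
  assumes "primitive_vec l"
  shows "norm l \<ge> 1"
proof -
  obtain x y :: int where l: "l = vector [of_int x, of_int y]"
    using assms lattice_vecE primitive_vecD by blast
  have "x \<noteq> 0 \<or> y \<noteq> 0"
    using primitive_vecD(2)[OF assms] by (auto simp: l vec2_eq_iff)
  then have "\<bar>l$1\<bar> \<ge> 1 \<or> \<bar>l$2\<bar> \<ge> 1"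
    by (auto simp: l)
  then show ?thesis
    using component_le_norm_cart[of l 1] component_le_norm_cart[of l 2] by linarith
qed

lemma finite_lattice_vecs_ball: "finite {l \<in> lattice_vecs. norm l \<le> R}"
proof (rule finite_subset)
  let ?I = "{- \<lceil>R\<rceil>..\<lceil>R\<rceil>}"
  show "{l \<in> lattice_vecs. norm l \<le> R} \<subseteq> (\<lambda>(x, y). vector [of_int x, of_int y]) ` (?I \<times> ?I)"
  proof
    fix l :: "real^2" assume l: "l \<in> {l \<in> lattice_vecs. norm l \<le> R}"
    then obtain x y where xy: "l = vector [of_int x, of_int y]"
      using lattice_vecE by blast
    have "\<bar>l$1\<bar> \<le> R" "\<bar>l$2\<bar> \<le> R"
      using l component_le_norm_cart[of l] by (auto intro: order_trans)
    then have "x \<in> ?I" "y \<in> ?I"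
      by (auto simp: xy) linarith+
    then show "l \<in> (\<lambda>(x, y). vector [of_int x, of_int y]) ` (?I \<times> ?I)"
      using xy by auto
  qed
qed simp

text \<open>Emptiness of the triangle spanned by \<open>0\<close>, \<open>l\<close>, \<open>m\<close> off its side \<open>[l, m]\<close> puts this side at
  lattice distance one from the origin.\<close>

lemma height_one_cone:
  assumes l: "primitive_vec l" and m: "primitive_vec m" and w: "wedge l m > 0"
    and empty: "\<And>x \<alpha> \<beta>. primitive_vec x \<Longrightarrow> \<alpha> \<ge> 0 \<Longrightarrow> \<beta> \<ge> 0 \<Longrightarrow> x = \<alpha> *\<^sub>R l + \<beta> *\<^sub>R m \<Longrightarrow> \<alpha> + \<beta> \<ge> 1"
  obtains k d where "k \<ge> (1::nat)" "wedge l m = real k" "d \<in> lattice_vecs" "wedge l d = 1" "m = l + real k *\<^sub>R d"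
proof -
  obtain w' :: int where w': "wedge l m = of_int w'"
    using wedge_in_Ints l m primitive_vecD by (metis Ints_cases)
  have w'pos: "w' > 0" using w w' by simp
  obtain n where n: "n \<in> lattice_vecs" "wedge l n = 1"
    using l primitive_bezout by blast
  obtain j :: int where j: "wedge m n = of_int j"
    using wedge_in_Ints m n primitive_vecD by (metis Ints_cases)
  \<comment> \<open>Subtracting \<open>q\<close> times \<open>l\<close> from \<open>n\<close> keeps
    \<open>wedge l n = 1\<close> and moves \<open>wedge m n\<close> to its residue \<open>r\<close>
    in the range from \<open>1 - w'\<close> to 0. For such a residue the coefficients of
    \<open>n'\<close> with respect to \<open>l\<close> and \<open>m\<close> are nonnegative.\<close>
  define q where "q = (- j) div w'"
  define r where "r = j + q * w'"
  have "r = - ((- j) mod w')"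
    using div_mult_mod_eq[of "- j" w'] unfolding r_def q_def by linarith
  then have r: "r \<le> 0" "- w' < r"
    using w'pos by simp_all
  define n' where "n' = n - of_int q *\<^sub>R l"
  have n': "n' \<in> lattice_vecs" "wedge l n' = 1" 
    using n l by (auto simp: n'_def wedge_linear intro!: lattice_vecs_closed intro: primitive_vecD)
  have mn': "wedge m n' = of_int r"
    using wedge_swap[of m l] by (simp add: n'_def wedge_linear j w' r_def)
  have "wedge n' (- l) = 1"
    using n' wedge_swap[of n' l] by (simp add: wedge_linear)
  then have "primitive_vec n'"
    using n' l by (intro primitive_if_wedge_1[of _ "- l"]) (auto intro!: lattice_vecs_closed intro: primitive_vecD)
  moreover have "of_int w' *\<^sub>R n' = (- of_int r) *\<^sub>R l + m"
    using wedge_decompose[of l m n'] n' mn' w' wedge_swap[of n' m] by simp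
  then have "n' = (1 / of_int w') *\<^sub>R ((- of_int r) *\<^sub>R l + m)"
    using w'pos by (smt (verit, best) divideR_right of_int_0_less_iff inverse_eq_divide)
  then have "n' = (- of_int r / of_int w') *\<^sub>R l + (1 / of_int w') *\<^sub>R m"
    by (simp add: scaleR_add_right scaleR_diff_right)
  \<comment> \<open>Emptiness gives \<open>1 - r \<ge> w'\<close>, and the range of \<open>r\<close>
    leaves only \<open>r = 1 - w'\<close>. The coefficients then add up to 1, so \<open>n'\<close>
    lies on the line through \<open>l\<close> and \<open>m\<close>.\<close>
  ultimately have "- of_int r / of_int w' + 1 / of_int w' \<ge> (1::real)"
    using r w'pos by (intro empty[of n']) (simp_all add: divide_nonpos_pos)
  then have "of_int (1 - r) \<ge> (of_int w' :: real)"
    using w'pos by (simp add: field_simps)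
  then have "r = 1 - w'"
    using r by (smt (verit) of_int_le_iff)
  then have "real_of_int r = 1 - of_int w'"
    by simp
  then have "m = l + of_int w' *\<^sub>R (n' - l)"
    using \<open>of_int w' *\<^sub>R n' = _\<close> by (simp only:) (simp add: algebra_simps)
  moreover have "wedge l (n' - l) = 1"
    using n' by (simp add: wedge_linear)
  moreover have "n' - l \<in> lattice_vecs"
    using n' l by (auto intro!: lattice_vecs_closed intro: primitive_vecD)
  ultimately show ?thesis
    using w'pos w' by (intro that[of "nat w'" "n' - l"]) auto
qed

section \<open>The number twelve\<close>

lemma sqrt2_irrational:
  fixes x y :: int
  assumes "real_of_int x * sqrt 2 = real_of_int y"
  shows "x = 0"
proof (rule ccontr)
  assume "x \<noteq> 0"
  have *: "\<not> (\<exists>x y :: int. nat \<bar>x\<bar> = n \<and> x \<noteq> 0 \<and> y^2 = 2 * x^2)" for n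
  proof (induction n rule: less_induct)
    case (less n)
    show ?case
    proof
      assume "\<exists>x y :: int. nat \<bar>x\<bar> = n \<and> x \<noteq> 0 \<and> y^2 = 2 * x^2"
      then obtain x y :: int where xy: "nat \<bar>x\<bar> = n" "x \<noteq> 0" "y^2 = 2 * x^2" by blast
      then have "even y" by (metis dvd_triv_left even_power pos2)
      then obtain z where z: "y = 2 * z" by blast
      with xy have x: "x^2 = 2 * z^2" by (simp add: power2_eq_square)
      then have "even x" by (metis dvd_triv_left even_power pos2)
      then obtain u where u: "x = 2 * u" by blast
      with x have "z^2 = 2 * u^2" by (simp add: power2_eq_square)
      moreover have "u \<noteq> 0" "nat \<bar>u\<bar> < n" using xy u by auto
      ultimately show False using less by blast
    qed
  qed
  have "(real_of_int x * sqrt 2)^2 = real_of_int y ^2" using assms by simp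
  then have "real_of_int (y^2) = real_of_int (2 * x^2)" by (simp add: power_mult_distrib)
  then have "y^2 = 2 * x^2" by linarith
  with * \<open>x \<noteq> 0\<close> show False by blast
qed

text \<open>A vector of irrational slope: every nonzero lattice covector can be divided by its value
  there.\<close>

definition eta :: "real^2" where
  "eta = vector [sqrt 2, 1]"

lemma eta_inner_neq_0:
  assumes "l \<in> lattice_vecs" "l \<noteq> 0"
  shows "l \<bullet> eta \<noteq> 0"
proof
  assume "l \<bullet> eta = 0"
  moreover obtain x y where l: "l = vector [of_int x, of_int y]"
    using assms lattice_vecE by blast
  ultimately have *: "of_int x * sqrt 2 = of_int (- y)"
    by (simp add: inner2 eta_def)
  then have "x = 0" by (rule sqrt2_irrational)
  with * l have "l = 0" by (simp add: vec2_eq_iff)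
  with assms show False by simp
qed

text \<open>The summand \<open>3 - b\<^sub>i\<close> of Noether's formula, with \<open>b\<^sub>i\<close> distributed to the two cones at
  its ray; it is additive under the subdivision of a unimodular cone at \<open>l + m\<close>.\<close>

definition noether_term :: "real^2 \<Rightarrow> real^2 \<Rightarrow> real" where
  "noether_term l m = 3 - (l \<bullet> eta) / (m \<bullet> eta) - (m \<bullet> eta) / (l \<bullet> eta)"

lemma noether_term_subdivide:
  assumes "l \<in> lattice_vecs" "m \<in> lattice_vecs" "wedge l m \<noteq> 0"
  shows "noether_term l m = noether_term l (l + m) + noether_term (l + m) m"
proof -
  have "l \<noteq> 0" "m \<noteq> 0" "l + m \<noteq> 0"
    using assms(3) by (auto simp: wedge_def add_eq_0_iff2)
  then have ne: "l \<bullet> eta \<noteq> 0" "m \<bullet> eta \<noteq> 0" "l \<bullet> eta + m \<bullet> eta \<noteq> 0"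
    using eta_inner_neq_0 assms lattice_vecs_add[OF assms(1,2)] by (metis inner_add_left)+
  have "3 - a / b - b / a = (3 - a / (a + b) - (a + b) / a) + (3 - (a + b) / b - b / (a + b))"
    if "a \<noteq> 0" "b \<noteq> 0" "a + b \<noteq> 0" for a b :: real
    using that by (simp add: divide_simps) algebra
  from this[OF ne] show ?thesis
    by (simp add: noether_term_def inner_add_left)
qed

section \<open>A potential for the Noether terms\<close>

definition upper :: "real^2 \<Rightarrow> bool" where
  "upper l \<longleftrightarrow> l$2 > 0 \<or> l$2 = 0 \<and> l$1 > 0"

text \<open>The half-plane is half-open, with the ray of (1, 0) but not its opposite, so it contains
  exactly one vector of each antipodal pair.\<close>

lemma upper_minus: "l \<noteq> 0 \<Longrightarrow> upper (- l) \<longleftrightarrow> \<not> upper l"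
  by (auto simp: upper_def vec2_eq_iff)

lemma upper_combination:
  assumes "upper l" "upper m" "a \<ge> 0" "b \<ge> 0" "a > 0 \<or> b > 0"
  shows "upper (a *\<^sub>R l + b *\<^sub>R m)"
proof -
  have "a * l$2 \<ge> 0" "b * m$2 \<ge> 0" using assms by (auto simp: upper_def)
  consider "a * l$2 > 0 \<or> b * m$2 > 0" | "a * l$2 = 0" "b * m$2 = 0" 
    using \<open>a * l$2 \<ge> 0\<close> \<open>b * m$2 \<ge> 0\<close> by linarith
  then show ?thesis
  proof cases
    case 1
    then show ?thesis using \<open>a * l$2 \<ge> 0\<close> \<open>b * m$2 \<ge> 0\<close> by (auto simp: upper_def)
  next
    case 2
    then have "a * l$1 \<ge> 0" "b * m$1 \<ge> 0" "a * l$1 > 0 \<or> b * m$1 > 0"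
      using assms by (auto simp: upper_def)
    then show ?thesis using 2 by (auto simp: upper_def)
  qed
qed

text \<open>The solutions of \<open>wedge m l = 1\<close> form a coset of the multiples of
  \<open>l\<close>; the window for the height picks one, the clockwise Farey neighbour of smaller
  height.\<close>

definition left_parent :: "real^2 \<Rightarrow> real^2" where
  "left_parent l = (SOME m. m \<in> lattice_vecs \<and> wedge m l = 1 \<and> 0 \<le> m$2 \<and> m$2 < l$2)"

lemma left_parent_exists:
  assumes "primitive_vec l" "l$2 > 0"
  shows "\<exists>m. m \<in> lattice_vecs \<and> wedge m l = 1 \<and> 0 \<le> m$2 \<and> m$2 < l$2"
proof -
  obtain n where n: "n \<in> lattice_vecs" "wedge l n = 1"
    using assms primitive_bezout by blast
  \<comment> \<open>This \<open>k\<close> puts the height of \<open>m\<close> above 0 and at most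
    \<open>l$2\<close>. If the upper end is hit, one more multiple of \<open>l\<close> is subtracted
    below.\<close>
  define k where "k = \<lfloor>n$2 / l$2\<rfloor> + 1"
  define m where "m = of_int k *\<^sub>R l - n"
  have "m \<in> lattice_vecs" "wedge m l = 1"
    using n assms wedge_swap[of n l]
    by (auto simp: m_def wedge_linear intro!: lattice_vecs_closed intro: primitive_vecD)
  moreover
  have "of_int \<lfloor>n$2 / l$2\<rfloor> * l$2 \<le> n$2" "n$2 < (of_int \<lfloor>n$2 / l$2\<rfloor> + 1) * l$2"
    using assms(2) floor_divide_lower floor_divide_upper by blast+
  then have "of_int \<lfloor>n$2 / l$2\<rfloor> * l$2 \<le> n$2" "n$2 < of_int \<lfloor>n$2 / l$2\<rfloor> * l$2 + l$2"
    by (simp_all add: algebra_simps)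
  then have "m$2 \<ge> 0" "m$2 \<le> l$2"  "m$2 > 0"
    by (simp_all add: m_def k_def algebra_simps)
  ultimately show ?thesis
  proof (cases "m$2 = l$2")
    case True
    have "wedge (m - l) l = 1" "m - l \<in> lattice_vecs"
      using \<open>wedge m l = 1\<close> \<open>m \<in> _\<close> assms by (auto simp: wedge_linear intro!: lattice_vecs_closed intro: primitive_vecD)
    then show ?thesis using True assms by (intro exI[of _ "m - l"]) auto
  qed (use \<open>m$2 \<le> l$2\<close> in force)
qed

text \<open>Two candidates differ by an integer multiple of \<open>l\<close> whose height is smaller
  in absolute value than that of \<open>l\<close>.\<close>

lemma left_parent_unique:
  assumes "primitive_vec l" "l$2 > 0" "m \<in> lattice_vecs" "wedge m l = 1" "0 \<le> m$2" "m$2 < l$2"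
  shows "left_parent l = m"
proof -
  define m' where "m' = left_parent l"
  have m': "m' \<in> lattice_vecs" "wedge m' l = 1" "0 \<le> m'$2" "m'$2 < l$2"
    using someI_ex[OF left_parent_exists[OF assms(1,2)]] unfolding m'_def left_parent_def by auto
  have "wedge l (m' - m) = 0"
    using m' assms wedge_swap[of l] by (simp add: wedge_linear)
  then obtain k where k: "m' - m = of_int k *\<^sub>R l"
    using lattice_parallel_multiple[OF assms(1) lattice_vecs_diff[OF m'(1) assms(3)]] by blast
  then have "m'$2 - m$2 = of_int k * l$2"
    by (metis vector_minus_component vector_scaleR_component real_scaleR_def)
  then have "of_int k * l$2 < 1 * l$2" "of_int k * l$2 > - 1 * l$2"
    using m' assms by linarith+
  then have "real_of_int k < 1" "real_of_int k > - 1"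
    using assms(2) mult_less_cancel_right_pos by blast+
  then have "k = 0" by linarith
  then show ?thesis using k by (simp add: m'_def)
qed

text \<open>Noether terms telescope: a potential along the Stern--Brocot descent to \<open>(1, 0)\<close>.\<close>

function half_potential :: "real^2 \<Rightarrow> real" where
  "half_potential l = (if primitive_vec l \<and> l$2 > 0
     then half_potential (left_parent l) + noether_term (left_parent l) l else 0)"
  by auto
termination
proof (relation "Wellfounded.measure (\<lambda>l. nat \<lfloor>l$2\<rfloor>)")
  fix l assume l: "primitive_vec l \<and> 0 < l $ 2"
  define m where "m = left_parent l"
  have m: "m \<in> lattice_vecs" "0 \<le> m$2" "m$2 < l$2"
    using someI_ex[OF left_parent_exists[of l]] l unfolding m_def left_parent_def by auto
  \<comment> \<open>Heights of lattice vectors are integers, so the strict decrease survives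
    rounding down.\<close>
  obtain i j :: int where "m$2 = of_int i" "l$2 = of_int j"
    using m l primitive_vecD(1)[of l] by (auto simp: lattice_vecs_iff elim!: Ints_cases)
  then show "(left_parent l, l) \<in> Wellfounded.measure (\<lambda>l. nat \<lfloor>l$2\<rfloor>)"
    using m by (simp flip: m_def)
qed auto

declare half_potential.simps [simp del]

text \<open>If \<open>l\<close> is lower than \<open>m\<close>, it is the left parent of
  \<open>m\<close> and the claim is the recursion. Otherwise \<open>n = l - m\<close> is the left
  parent of \<open>l\<close>, and subdividing the cone of \<open>n\<close> and \<open>m\<close> at
  \<open>l\<close> reduces the claim to the pair \<open>n\<close>, \<open>m\<close> of smaller total
  height.\<close>

lemma half_potential_diff:
  assumes "l \<in> lattice_vecs" "m \<in> lattice_vecs" "wedge l m = 1" "upper l" "upper m"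
  shows "half_potential m - half_potential l = noether_term l m"
  using assms
proof (induction "nat \<lfloor>l$2 + m$2\<rfloor>" arbitrary: l m rule: less_induct)
  case less
  have wml: "wedge m l = - 1" using wedge_swap[of m l] less.prems by simp
  have prim: "primitive_vec l" "primitive_vec m"
    using less.prems wml
    by (auto intro!: primitive_if_wedge_1[of l m] primitive_if_wedge_1[of m "- l"] lattice_vecs_minus simp: wedge_linear)
  have step: "half_potential m = half_potential l + noether_term l m"
    if "primitive_vec m" "l \<in> lattice_vecs" "wedge l m = 1" "0 \<le> l$2" "l$2 < m$2" for l m
    using half_potential.simps[of m] left_parent_unique[of m l] that by auto
  have nonneg: "l$2 \<ge> 0" "m$2 \<ge> 0" using less.prems by (auto simp: upper_def)
  show ?case
  proof (cases "l$2 < m$2")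
    case True
    then show ?thesis using step[of m l] less.prems prim nonneg by auto
  next
    case False
    have "m$2 \<noteq> 0"
    proof
      assume "m$2 = 0"
      then have "- (l$2 * m$1) = 1" "m$1 > 0" using less.prems by (auto simp: wedge_def upper_def)
      then show False using nonneg by (smt (verit) mult_nonneg_nonneg)
    qed
    then have m2: "m$2 > 0" using nonneg by simp
    define n where "n = l - m"
    have n: "n \<in> lattice_vecs" "wedge n m = 1" "wedge n l = 1" "l = n + m"
      using less.prems wml by (auto simp: n_def wedge_linear lattice_vecs_closed)
    have n2: "0 \<le> n$2" "n$2 < l$2" using False m2 by (auto simp: n_def)
    have "upper n"
    proof (cases "n$2 = 0")
      case True
      then have "n$1 * m$2 = 1" using n by (simp add: wedge_def)
      then show ?thesis using True m2
        by (metis upper_def zero_less_mult_pos2 zero_less_one)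
    qed (use n2 in \<open>auto simp: upper_def\<close>)
    obtain i j :: int where "n$2 + m$2 = of_int i" "l$2 + m$2 = of_int j"
      using n less.prems by (auto simp: lattice_vecs_iff elim!: Ints_cases)
        (metis of_int_add)
    then have "nat \<lfloor>n$2 + m$2\<rfloor> < nat \<lfloor>l$2 + m$2\<rfloor>"
      using n2 m2 by auto
    then have "half_potential m - half_potential n = noether_term n m"
      using less.hyps[of n m] n less.prems \<open>upper n\<close> by blast
    moreover have "half_potential l = half_potential n + noether_term n l"
      using step[of l n] prim n n2 by auto
    moreover have "noether_term n m = noether_term n l + noether_term l m"
      using noether_term_subdivide[of n m] n less.prems by auto
    ultimately show ?thesis by simp
  qed
qed

text \<open>The 6 comes from \<open>noether_term (- m) l = 6 - noether_term l m\<close>: leaving the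
  upper half-plane is absorbed by this shift, and the return leaves a jump of 6 + 6.\<close>

definition potential :: "real^2 \<Rightarrow> real" where
  "potential l = (if upper l then half_potential l else half_potential (- l) + 6)"

lemma noether_term_potential:
  assumes "l \<in> lattice_vecs" "m \<in> lattice_vecs" "wedge l m = 1"
  shows "noether_term l m = potential m - potential l + (if \<not> upper l \<and> upper m then 12 else 0)"
proof -
  have ne: "l \<noteq> 0" "m \<noteq> 0" using assms by (auto simp: wedge_def)
  note up = upper_minus[OF ne(1)] upper_minus[OF ne(2)]
  have minus: "- l \<in> lattice_vecs" "- m \<in> lattice_vecs"
    using assms by (auto intro: lattice_vecs_closed)
  have sym: "wedge (- l) (- m) = 1" "wedge (- m) l = 1" "wedge m (- l) = 1"
    using assms wedge_swap[of m l] by (simp_all add: wedge_linear)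
  have t: "noether_term (- l) (- m) = noether_term l m" 
    "noether_term (- m) l = 6 - noether_term l m" "noether_term m (- l) = 6 - noether_term l m"
    by (simp_all add: noether_term_def)
  consider "upper l" "upper m" | "upper l" "\<not> upper m" | "\<not> upper l" "upper m" | "\<not> upper l" "\<not> upper m"
    by blast
  then show ?thesis
  proof cases
    case 1
    then show ?thesis using half_potential_diff[OF assms] by (simp add: potential_def)
  next
    case 2
    then show ?thesis using half_potential_diff[of "- m" l] assms minus sym t up
      by (simp add: potential_def)
  next
    case 3
    then show ?thesis using half_potential_diff[of m "- l"] assms minus sym t up
      by (simp add: potential_def)
  next
    case 4
    then show ?thesis using half_potential_diff[of "- l" "- m"] assms minus sym t up
      by (simp add: potential_def)
  qed
qed

text \<open>The lattice points \<open>l + i d\<close> cut the cone into \<open>k\<close> unimodular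
  cones; the left side is the closed form of the sum of their Noether terms.\<close>

lemma height_one_cone_potential:
  assumes "l \<in> lattice_vecs" "d \<in> lattice_vecs" "wedge l d = 1" "k \<ge> 1"
  shows "real k - real k * (d \<bullet> eta)^2 / ((l \<bullet> eta) * ((l + real k *\<^sub>R d) \<bullet> eta)) =
    potential (l + real k *\<^sub>R d) - potential l + (if \<not> upper l \<and> upper (l + real k *\<^sub>R d) then 12 else 0)"
  using assms(4)
proof (induction k rule: nat_induct_at_least)
  case base
  have lat: "l + d \<in> lattice_vecs" using assms by (intro lattice_vecs_closed)
  have "l \<noteq> 0" "l + d \<noteq> 0" using assms(3) by (auto simp: wedge_def vec2_eq_iff add_eq_0_iff2)
  then have ne: "l \<bullet> eta \<noteq> 0" "l \<bullet> eta + d \<bullet> eta \<noteq> 0"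
    using eta_inner_neq_0 assms lat by (metis inner_add_left)+
  have "1 - b^2 / (a * (a + b)) = 3 - a / (a + b) - (a + b) / a" if "a \<noteq> 0" "a + b \<noteq> 0" for a b :: real
    using that by (simp add: divide_simps power2_eq_square) (simp add: algebra_simps)
  from this[OF ne] have "1 - (d \<bullet> eta)^2 / ((l \<bullet> eta) * ((l + d) \<bullet> eta)) = noether_term l (l + d)"
    by (simp add: noether_term_def inner_add_left)
  also have "\<dots> = potential (l + d) - potential l + (if \<not> upper l \<and> upper (l + d) then 12 else 0)"
    using assms lat by (intro noether_term_potential) (auto simp: wedge_linear)
  finally show ?case by simp
next
  case (Suc k)
  define m where "m = l + real k *\<^sub>R d"
  define m' where "m' = m + d"
  have m'_eq: "l + real (Suc k) *\<^sub>R d = m'" by (simp add: m'_def m_def algebra_simps)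
  have lat: "m \<in> lattice_vecs" "m' \<in> lattice_vecs"
    unfolding m_def m'_def using assms by (auto intro!: lattice_vecs_closed)
  have w: "wedge m d = 1" "wedge m m' = 1" "wedge l m > 0" "wedge l m' > 0"
    using assms Suc.hyps by (auto simp: m_def m'_def wedge_linear)
  then have nz: "l \<noteq> 0" "m \<noteq> 0" "m' \<noteq> 0" by (auto simp: wedge_def)
  define a e where "a = l \<bullet> eta" and "e = d \<bullet> eta"
  have ip: "m \<bullet> eta = a + k * e" "m' \<bullet> eta = a + (k + 1) * e"
    by (simp_all add: m_def m'_def a_def e_def inner_add_left algebra_simps)
  have ne: "a \<noteq> 0" "a + k * e \<noteq> 0" "a + (k + 1) * e \<noteq> 0"
    using eta_inner_neq_0 assms lat nz ip unfolding a_def by metis+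
  have alg: "x + 1 - (x + 1) * e^2 / (a * (a + (x + 1) * e)) = (x - x * e^2 / (a * (a + x * e))) +
    (3 - (a + x * e) / (a + (x + 1) * e) - (a + (x + 1) * e) / (a + x * e))" 
    if "a \<noteq> 0" "a + x * e \<noteq> 0" "a + (x + 1) * e \<noteq> 0" for x :: real
    using that by (simp add: divide_simps power2_eq_square) algebra
  have "real (Suc k) - real (Suc k) * e^2 / (a * (m' \<bullet> eta)) =
    (real k - real k * e^2 / (a * (m \<bullet> eta))) + noether_term m m'"
    using alg[of "real k"] ne by (simp add: noether_term_def ip algebra_simps)
  also have "real k - real k * e^2 / (a * (m \<bullet> eta)) =
      potential m - potential l + (if \<not> upper l \<and> upper m then 12 else 0)"
    using Suc.IH by (simp add: m_def a_def e_def)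
  also have "noether_term m m' = potential m' - potential m + (if \<not> upper m \<and> upper m' then 12 else 0)"
    by (rule noether_term_potential[OF lat w(2)])
  finally have eq: "real (Suc k) - real (Suc k) * e^2 / (a * (m' \<bullet> eta)) = potential m' - potential l +
    ((if \<not> upper l \<and> upper m then 12 else 0) + (if \<not> upper m \<and> upper m' then 12 else 0))"
    by simp
  \<comment> \<open>A point of the segment from \<open>l\<close> to \<open>m'\<close> lies in the
    half-plane, or outside it, if both ends do. So at most one of the two steps enters the upper
    half-plane, and it does so exactly when the ends say so.\<close>
  have m_comb: "m = (1 / (k + 1)) *\<^sub>R l + (k / (k + 1)) *\<^sub>R m'"
    by (simp add: m_def m'_def vec2_eq_iff divide_simps) (simp add: algebra_simps)
  have up: "upper m" if "upper l" "upper m'"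
    unfolding m_comb using that by (intro upper_combination) auto
  have "upper (- m)" if "upper (- l)" "upper (- m')"
  proof -
    have "- m = (1 / (k + 1)) *\<^sub>R (- l) + (k / (k + 1)) *\<^sub>R (- m')"
      by (subst m_comb) (simp add: algebra_simps)
    then show ?thesis using that by (auto intro!: upper_combination simp del: scaleR_minus_right)
  qed
  then have low: "\<not> upper m" if "\<not> upper l" "\<not> upper m'"
    using that by (simp add: upper_minus nz)
  show ?case
    unfolding m'_eq using eq up low unfolding a_def e_def by (auto split: if_splits)
qed

text \<open>The previous identity with the lattice step eliminated through
  \<open>(m - l) \<bullet> eta = k * (d \<bullet> eta)\<close>. The second summand on the left is
  minus the rate at which the moving corner changes the perimeter.\<close>

lemma cone_potential:
  assumes l: "primitive_vec l" and m: "primitive_vec m" and w: "wedge l m > 0"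
    and empty: "\<And>x \<alpha> \<beta>. primitive_vec x \<Longrightarrow> \<alpha> \<ge> 0 \<Longrightarrow> \<beta> \<ge> 0 \<Longrightarrow> x = \<alpha> *\<^sub>R l + \<beta> *\<^sub>R m \<Longrightarrow> \<alpha> + \<beta> \<ge> 1"
  shows "wedge l m + (2 - (l \<bullet> eta) / (m \<bullet> eta) - (m \<bullet> eta) / (l \<bullet> eta)) / wedge l m =
    potential m - potential l + (if \<not> upper l \<and> upper m then 12 else 0)"
proof -
  obtain k d where kd: "k \<ge> (1::nat)" "wedge l m = real k" "d \<in> lattice_vecs" "wedge l d = 1" "m = l + real k *\<^sub>R d"
    by (metis height_one_cone[OF l m w] empty)
  have ne: "l \<bullet> eta \<noteq> 0" "m \<bullet> eta \<noteq> 0"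
    using l m eta_inner_neq_0 primitive_vecD by auto
  have m: "m \<bullet> eta = l \<bullet> eta + k * (d \<bullet> eta)"
    by (simp add: kd inner_add_left)
  have "(2 - a / (a + k * b) - (a + k * b) / a) / k = - k * b^2 / (a * (a + k * b))"
    if "a \<noteq> 0" "a + k * b \<noteq> 0" for a b :: real
    using that kd(1) by (simp add: divide_simps power2_eq_square) (simp add: algebra_simps)
  then show ?thesis
    using height_one_cone_potential[OF primitive_vecD(1)[OF l] kd(3,4,1)] ne kd(2) 
    by (simp add: m flip: kd(5))
qed

section \<open>Polygons cut out by finitely many lattice normals\<close>

definition cut :: "(real^2) set \<Rightarrow> (real^2 \<Rightarrow> real) \<Rightarrow> (real^2) set" where
  "cut L d = {p. \<forall>l\<in>L. d l \<le> l \<bullet> p}"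

definition active :: "(real^2) set \<Rightarrow> (real^2 \<Rightarrow> real) \<Rightarrow> real^2 \<Rightarrow> (real^2) set" where
  "active L d p = {l \<in> L. l \<bullet> p = d l}"

definition side :: "(real^2) set \<Rightarrow> (real^2 \<Rightarrow> real) \<Rightarrow> real^2 \<Rightarrow> (real^2) set" where
  "side L d l = {p \<in> cut L d. l \<bullet> p = d l}"

text \<open>Two distinct points are demanded in order to discard redundant normals, including those
  that merely touch the polygon in a corner.\<close>

definition side_normals :: "(real^2) set \<Rightarrow> (real^2 \<Rightarrow> real) \<Rightarrow> (real^2) set" where
  "side_normals L d = {l \<in> L. \<exists>p\<in>side L d l. \<exists>q\<in>side L d l. p \<noteq> q}"

text \<open>\<open>L\<close> may contain redundant normals that are active at \<open>p\<close>; the extreme ones \<open>l\<close> and \<open>m\<close> belong to the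
  two sides at \<open>p\<close>.\<close>

definition corner_at :: "(real^2) set \<Rightarrow> (real^2 \<Rightarrow> real) \<Rightarrow> real^2 \<Rightarrow> real^2 \<Rightarrow> real^2 \<Rightarrow> bool" where
  "corner_at L d p l m \<longleftrightarrow> p \<in> cut L d \<and> l \<in> active L d p \<and> m \<in> active L d p \<and> wedge l m > 0 \<and>
     (\<forall>x\<in>active L d p. wedge l x \<ge> 0 \<and> wedge x m \<ge> 0)"

definition corners :: "(real^2) set \<Rightarrow> (real^2 \<Rightarrow> real) \<Rightarrow> ((real^2) \<times> (real^2)) set" where
  "corners L d = {(l, m). \<exists>p. corner_at L d p l m}"

text \<open>Cramer's rule for the two bounding lines. The expression is linear in \<open>d\<close>,
  so shifting all bounds by \<open>t\<close> moves the point with constant velocity.\<close>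

definition intersection_point :: "(real^2 \<Rightarrow> real) \<Rightarrow> real^2 \<Rightarrow> real^2 \<Rightarrow> real^2" where
  "intersection_point d l m = (1 / wedge l m) *\<^sub>R (d m *\<^sub>R rot l - d l *\<^sub>R rot m)"

lemma intersection_point_inner:
  assumes "wedge l m \<noteq> 0"
  shows "l \<bullet> intersection_point d l m = d l" "m \<bullet> intersection_point d l m = d m"
proof -
  have "l \<bullet> rot m = - wedge l m" "m \<bullet> rot l = wedge l m"
    by (simp_all add: vec2_simps)
  then show "l \<bullet> intersection_point d l m = d l" "m \<bullet> intersection_point d l m = d m"
    using assms by (simp_all add: intersection_point_def inner_diff_right)
qed

lemma inner_determines_point:
  assumes "wedge l m \<noteq> 0" "l \<bullet> p = l \<bullet> q" "m \<bullet> p = m \<bullet> q"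
  shows "p = q"
proof -
  have "wedge l m *\<^sub>R x = (m \<bullet> x) *\<^sub>R rot l - (l \<bullet> x) *\<^sub>R rot m" for x
    by (simp add: vec2_simps algebra_simps)
  from this[of p] this[of q] have "wedge l m *\<^sub>R p = wedge l m *\<^sub>R q"
    using assms by simp
  then show ?thesis using assms(1) by simp
qed

lemma corner_at_eq_intersection_point:
  assumes "corner_at L d p l m"
  shows "p = intersection_point d l m"
  using assms intersection_point_inner[of l m d]
  by (intro inner_determines_point[of l m]) (auto simp: corner_at_def active_def)

lemma closed_cut: "closed (cut L d)"
proof -
  have "cut L d = (\<Inter>l\<in>L. {p. l \<bullet> p \<ge> d l})"
    by (auto simp: cut_def)
  then show ?thesis by (auto intro: closed_halfspace_ge)
qed

lemma convex_cut: "convex (cut L d)"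
proof -
  have "cut L d = (\<Inter>l\<in>L. {p. l \<bullet> p \<ge> d l})"
    by (auto simp: cut_def)
  then show ?thesis by (auto intro: convex_INT convex_halfspace_ge)
qed

section \<open>Tropical length of segments\<close>

lemma parallel_to_primitive_dir:
  assumes v: "primitive_vec v" and I: "parallel_to I v" and ab: "a \<in> I" "b \<in> I" "a \<noteq> b"
  shows "primitive_dir I = v \<or> primitive_dir I = - v"
proof -
  define u where "u = primitive_dir I"
  have u: "primitive_vec u" "parallel_to I u"
    using someI_ex[of "\<lambda>v. primitive_vec v \<and> parallel_to I v"] v I
    by (auto simp: u_def primitive_dir_def)
  \<comment> \<open>Two distinct points determine the direction, so the choice made in
    \<open>primitive_dir\<close> is free only up to sign.\<close>
  obtain s t where "a - b = s *\<^sub>R v" "a - b = t *\<^sub>R u"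
    using u I ab unfolding parallel_to_def span_singleton by blast
  moreover have "s \<noteq> 0" "t \<noteq> 0" using calculation ab by auto
  ultimately have "wedge v u = 0"
    by (metis wedge_scale_left wedge_scale_right wedge_self mult_eq_0_iff)
  then show ?thesis using primitive_parallel v u unfolding u_def by blast
qed

lemma parallel_to_subset_segment:
  assumes "I \<subseteq> closed_segment a (a + c *\<^sub>R v)"
  shows "parallel_to I v"
  unfolding parallel_to_def
proof (intro ballI)
  fix x y assume "x \<in> I" "y \<in> I"
  then obtain s t where "x = (1 - s) *\<^sub>R a + s *\<^sub>R (a + c *\<^sub>R v)" "y = (1 - t) *\<^sub>R a + t *\<^sub>R (a + c *\<^sub>R v)"
    using assms unfolding closed_segment_def by blast
  then have "x - y = (s * c - t * c) *\<^sub>R v" by (simp add: algebra_simps)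
  then show "x - y \<in> span {v}" by (metis span_base span_scale singletonI)
qed

lemma diameter_closed_segment: "diameter (closed_segment a b) = dist a b" for a b :: "real^2"
proof (rule antisym)
  have "norm (x - y) \<le> dist a b" if xy: "x \<in> closed_segment a b" "y \<in> closed_segment a b" for x y
  proof -
    obtain s t where st: "0 \<le> s" "s \<le> 1" "0 \<le> t" "t \<le> 1"
      "x = (1 - s) *\<^sub>R a + s *\<^sub>R b" "y = (1 - t) *\<^sub>R a + t *\<^sub>R b"
      using xy unfolding closed_segment_def by blast
    have "x - y = (t - s) *\<^sub>R (a - b)" by (simp add: st algebra_simps)
    moreover have "\<bar>t - s\<bar> * norm (a - b) \<le> 1 * norm (a - b)"
      using st by (intro mult_right_mono) auto
    ultimately show ?thesis by (simp add: dist_norm)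
  qed
  then show "diameter (closed_segment a b) \<le> dist a b"
    by (intro diameter_le) auto
  show "dist a b \<le> diameter (closed_segment a b)"
    by (rule diameter_bounded_bound) (auto simp: bounded_closed_segment)
qed

lemma tropical_length_closed_segment:
  assumes "primitive_vec v" "c \<ge> 0"
  shows "tropical_length (closed_segment a (a + c *\<^sub>R v)) = c"
proof (cases "c = 0")
  case True
  then show ?thesis by (simp add: tropical_length_def)
next
  case False
  have v: "v \<noteq> 0" using assms primitive_vecD by blast
  have "norm (primitive_dir (closed_segment a (a + c *\<^sub>R v))) = norm v"
    using parallel_to_primitive_dir[OF assms(1) parallel_to_subset_segment[OF order_refl], of a a c "a + c *\<^sub>R v"]
      False v by auto
  then show ?thesis
    using assms v by (simp add: tropical_length_def diameter_closed_segment dist_norm)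
qed

lemma tropical_length_open_segment:
  assumes "primitive_vec v" "c > 0"
  shows "tropical_length (open_segment a (a + c *\<^sub>R v)) = c"
proof -
  have v: "v \<noteq> 0" using assms primitive_vecD by blast
  let ?I = "open_segment a (a + c *\<^sub>R v)"
  have ne: "a \<noteq> a + c *\<^sub>R v" using v assms by simp
  have "infinite ?I" using ne by simp
  then obtain x y where "x \<in> ?I" "y \<in> ?I" "x \<noteq> y"
    by (metis finite.emptyI finite_insert insertCI is_singletonI' is_singleton_def)
  then have "norm (primitive_dir ?I) = norm v"
    using parallel_to_primitive_dir[OF assms(1) parallel_to_subset_segment[OF open_closed_segment[THEN subsetI]]]
    by fastforce
  moreover have "diameter ?I = diameter (closed_segment a (a + c *\<^sub>R v))"
    using diameter_closure[of ?I] ne by (simp add: bounded_open_segment)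
  ultimately show ?thesis
    using assms v by (simp add: tropical_length_def diameter_closed_segment dist_norm)
qed

text \<open>An average with positive weights attains a common lower bound only if both entries
  do.\<close>

lemma inner_minimal_in_open_segment:
  fixes z a b :: "real^2"
  assumes p: "p \<in> open_segment a b" "z \<bullet> p = c" and le: "c \<le> z \<bullet> a" "c \<le> z \<bullet> b"
  shows "z \<bullet> a = c" "z \<bullet> b = c"
proof -
  obtain u where u: "0 < u" "u < 1" "p = (1 - u) *\<^sub>R a + u *\<^sub>R b"
    using p(1) by (auto simp: in_segment)
  have "(1 - u) * (z \<bullet> a - c) + u * (z \<bullet> b - c) = 0"
    using p(2) by (simp add: u(3) inner_add_right algebra_simps)
  moreover have "(1 - u) * (z \<bullet> a - c) \<ge> 0" "u * (z \<bullet> b - c) \<ge> 0"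
    using u le by (intro mult_nonneg_nonneg; simp)+
  ultimately have "(1 - u) * (z \<bullet> a - c) = 0" "u * (z \<bullet> b - c) = 0" by linarith+
  then show "z \<bullet> a = c" "z \<bullet> b = c" using u by auto
qed

section \<open>Corners and sides of a lattice polygon\<close>

locale lattice_polygon =
  fixes L :: "(real^2) set" and d :: "real^2 \<Rightarrow> real"
  assumes finite_normals: "finite L"
    and primitive_normals: "\<And>l. l \<in> L \<Longrightarrow> primitive_vec l"
    and bounded_cut: "bounded (cut L d)"
    and strict_point: "\<exists>x. \<forall>l\<in>L. d l < l \<bullet> x"
begin

lemma compact_cut: "compact (cut L d)"
  using bounded_cut closed_cut compact_eq_bounded_closed by blast

lemma cut_nonempty: "cut L d \<noteq> {}"
  using strict_point by (force simp: cut_def intro: less_imp_le)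

lemma interior_cutI:
  assumes "\<forall>l\<in>L. d l < l \<bullet> x"
  shows "x \<in> interior (cut L d)"
proof (rule interiorI)
  show "open (\<Inter>l\<in>L. {p. l \<bullet> p > d l})"
    using finite_normals by (intro open_INT ballI open_halfspace_gt)
  show "x \<in> (\<Inter>l\<in>L. {p. l \<bullet> p > d l})" using assms by auto
  show "(\<Inter>l\<in>L. {p. l \<bullet> p > d l}) \<subseteq> cut L d"
    by (auto simp: cut_def intro: less_imp_le)
qed

lemma interior_cut_nonempty: "interior (cut L d) \<noteq> {}"
  using strict_point interior_cutI by blast

lemma finite_active: "finite (active L d p)"
  using finite_normals by (simp add: active_def)

lemma active_primitive: "l \<in> active L d p \<Longrightarrow> primitive_vec l"
  using primitive_normals by (auto simp: active_def)

text \<open>Inactive constraints have slack at \<open>p\<close>; as there are finitely many, one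
  short step respects them all.\<close>

lemma feasible_direction:
  assumes "p \<in> cut L d" "\<forall>x\<in>active L d p. x \<bullet> v \<ge> 0"
  obtains s where "s > 0" "p + s *\<^sub>R v \<in> cut L d"
proof -
  have "\<forall>\<^sub>F s in at_right 0. d l \<le> l \<bullet> (p + s *\<^sub>R v)" if l: "l \<in> L" for l
  proof (cases "l \<bullet> p = d l")
    case True
    then have "l \<bullet> v \<ge> 0" using assms l by (auto simp: active_def)
    then have "d l \<le> l \<bullet> (p + s *\<^sub>R v)" if "s > 0" for s
      using that True by (simp add: inner_add_right)
    then show ?thesis by (rule eventually_mono[OF eventually_at_right_less])
  next
    case False
    then have "d l < l \<bullet> p" using assms l by (force simp: cut_def)
    moreover have "((\<lambda>s. l \<bullet> (p + s *\<^sub>R v)) \<longlongrightarrow> l \<bullet> (p + 0 *\<^sub>R v)) (at_right 0)"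
      by (intro tendsto_intros)
    ultimately have "\<forall>\<^sub>F s in at_right 0. d l < l \<bullet> (p + s *\<^sub>R v)"
      by (intro order_tendstoD(1)) auto
    then show ?thesis by (rule eventually_mono) simp
  qed
  then have "\<forall>\<^sub>F s in at_right 0. \<forall>l\<in>L. d l \<le> l \<bullet> (p + s *\<^sub>R v)"
    by (intro eventually_ball_finite finite_normals) auto
  then have "\<forall>\<^sub>F s in at_right (0::real). p + s *\<^sub>R v \<in> cut L d \<and> s > 0"
    using eventually_at_right_less[of "0::real"] by eventually_elim (simp add: cut_def)
  then show ?thesis
    using that eventually_happens'[OF trivial_limit_at_right_real] by blast
qed

text \<open>The active normals are positive on the direction \<open>v\<close> from \<open>p\<close>
  to a strictly feasible point. Within that open half-plane, the sign of \<open>wedge\<close>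
  compares slopes, and \<open>s\<close> is the slope with respect to \<open>v\<close> and
  \<open>rot v\<close>.\<close>

lemma active_order:
  assumes "p \<in> cut L d"
  obtains s :: "real^2 \<Rightarrow> real" where
    "\<And>x y. x \<in> active L d p \<Longrightarrow> y \<in> active L d p \<Longrightarrow> wedge x y \<ge> 0 \<longleftrightarrow> s x \<le> s y"
    "\<And>x y. x \<in> active L d p \<Longrightarrow> y \<in> active L d p \<Longrightarrow> wedge x y > 0 \<longleftrightarrow> s x < s y"
proof -
  obtain q where q: "\<forall>l\<in>L. d l < l \<bullet> q" using strict_point by blast
  define v where "v = q - p"
  have pos: "x \<bullet> v > 0" if "x \<in> active L d p" for x
    using that q by (auto simp: active_def v_def inner_diff_right)
  define s where "s x = (x \<bullet> rot v) / (x \<bullet> v)" for x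
  have *: "(s y - s x) * ((x \<bullet> v) * (y \<bullet> v)) = wedge x y * (v \<bullet> v)"
    if "x \<in> active L d p" "y \<in> active L d p" for x y
  proof -
    have "(s y - s x) * ((x \<bullet> v) * (y \<bullet> v)) = (x \<bullet> v) * (y \<bullet> rot v) - (x \<bullet> rot v) * (y \<bullet> v)"
      using pos[OF that(1)] pos[OF that(2)] by (simp add: s_def field_simps)
    also have "\<dots> = wedge x y * (v \<bullet> v)"
      by (simp add: vec2_simps algebra_simps)
    finally show ?thesis .
  qed
  have "wedge x y \<ge> 0 \<longleftrightarrow> s x \<le> s y" "wedge x y > 0 \<longleftrightarrow> s x < s y" if xy: "x \<in> active L d p" "y \<in> active L d p" for x y
  proof -
    have v: "v \<bullet> v > 0" using pos[OF xy(1)] by auto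
    have p: "(x \<bullet> v) * (y \<bullet> v) > 0" using pos xy by simp
    show "wedge x y \<ge> 0 \<longleftrightarrow> s x \<le> s y"
      using *[OF xy] v p by (smt (verit) zero_le_mult_iff)
    show "wedge x y > 0 \<longleftrightarrow> s x < s y"
      using *[OF xy] v p by (smt (verit) zero_less_mult_iff)
  qed
  then show ?thesis using that by blast
qed

text \<open>Opposite normals cannot both be active, since both are positive towards a strictly
  feasible point.\<close>

lemma active_parallel_eq:
  assumes "x \<in> active L d p" "y \<in> active L d p" "wedge x y = 0"
  shows "y = x"
proof -
  obtain q where q: "\<forall>l\<in>L. d l < l \<bullet> q" using strict_point by blast
  have "z \<bullet> (q - p) > 0" if "z \<in> active L d p" for z
    using that q by (auto simp: active_def inner_diff_right)
  then show ?thesis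
    using primitive_same_direction active_primitive assms by blast
qed

lemma corner_at_unique:
  assumes "corner_at L d p l m" "corner_at L d p l' m'"
  shows "l' = l \<and> m' = m"
proof -
  have "wedge l l' \<ge> 0" "wedge l' l \<ge> 0" "wedge m m' \<ge> 0" "wedge m' m \<ge> 0"
    using assms unfolding corner_at_def by blast+
  then have "wedge l l' = 0" "wedge m m' = 0"
    using wedge_swap[of l l'] wedge_swap[of m m'] by auto
  then show ?thesis
    using active_parallel_eq assms unfolding corner_at_def by blast
qed

lemma corner_at_exists:
  assumes p: "p \<in> cut L d" and xy: "x \<in> active L d p" "y \<in> active L d p" "wedge x y \<noteq> 0"
  shows "\<exists>l m. corner_at L d p l m"
proof -
  obtain s :: "real^2 \<Rightarrow> real" where s:
    "\<And>x y. x \<in> active L d p \<Longrightarrow> y \<in> active L d p \<Longrightarrow> wedge x y \<ge> 0 \<longleftrightarrow> s x \<le> s y"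
    "\<And>x y. x \<in> active L d p \<Longrightarrow> y \<in> active L d p \<Longrightarrow> wedge x y > 0 \<longleftrightarrow> s x < s y"
    by (rule active_order[OF p]) blast
  have ne: "active L d p \<noteq> {}" using xy by blast
  define l where "l = arg_min_on s (active L d p)"
  have l: "l \<in> active L d p" "\<And>x. x \<in> active L d p \<Longrightarrow> s l \<le> s x"
    using arg_min_if_finite[OF finite_active ne, of s] unfolding l_def by force+
  define m where "m = arg_min_on (\<lambda>x. - s x) (active L d p)"
  have m: "m \<in> active L d p" "\<And>x. x \<in> active L d p \<Longrightarrow> s x \<le> s m"
    using arg_min_if_finite[OF finite_active ne, of "\<lambda>x. - s x"] unfolding m_def by force+
  have "wedge x y > 0 \<or> wedge y x > 0" using xy(3) wedge_swap[of x y] by auto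
  then have "s x < s y \<or> s y < s x" using s(2)[OF xy(1,2)] s(2)[OF xy(2,1)] by blast
  then have "s l < s m" using l(2)[OF xy(1)] l(2)[OF xy(2)] m(2)[OF xy(1)] m(2)[OF xy(2)] by linarith
  then have "wedge l m > 0" "\<forall>x\<in>active L d p. wedge l x \<ge> 0 \<and> wedge x m \<ge> 0"
    using s l m by simp_all
  then show ?thesis
    using p l(1) m(1) unfolding corner_at_def by blast
qed

text \<open>Extremality of \<open>l\<close> says that \<open>rot l\<close> is a feasible direction
  at \<open>p\<close>, and that of \<open>m\<close> says the same of \<open>- rot m\<close>; each
  gives a second point of the side.\<close>

lemma corner_at_normals:
  assumes "corner_at L d p l m"
  shows "l \<in> side_normals L d" "m \<in> side_normals L d"
proof -
  have c: "p \<in> cut L d" "l \<in> active L d p" "m \<in> active L d p" "wedge l m > 0"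
    "\<And>x. x \<in> active L d p \<Longrightarrow> wedge l x \<ge> 0 \<and> wedge x m \<ge> 0"
    using assms by (auto simp: corner_at_def)
  have nz: "l \<noteq> 0" "m \<noteq> 0" using c(4) by (auto simp: wedge_def)
  obtain s where s: "s > 0" "p + s *\<^sub>R rot l \<in> cut L d"
    using feasible_direction[OF c(1), of "rot l"] c(5) by (metis wedge_eq_inner_rot)
  then have "p \<in> side L d l" "p + s *\<^sub>R rot l \<in> side L d l" "p \<noteq> p + s *\<^sub>R rot l"
    using c nz by (auto simp: side_def active_def inner_add_right)
  then show "l \<in> side_normals L d"
    using c(2) unfolding side_normals_def active_def by blast
  have "x \<bullet> (- rot m) \<ge> 0" if "x \<in> active L d p" for x
    using c(5)[OF that] wedge_eq_inner_rot[of m x] wedge_swap[of x m] by simp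
  then obtain s where s: "s > 0" "p + s *\<^sub>R (- rot m) \<in> cut L d"
    using feasible_direction[OF c(1), of "- rot m"] by blast
  then have "p \<in> side L d m" "p + s *\<^sub>R (- rot m) \<in> side L d m" "p \<noteq> p + s *\<^sub>R (- rot m)"
    using c nz by (auto simp: side_def active_def inner_diff_right)
  then show "m \<in> side_normals L d"
    using c(3) unfolding side_normals_def active_def by blast
qed

lemma compact_side: "compact (side L d l)"
proof -
  have "side L d l = cut L d \<inter> {p. l \<bullet> p = d l}" by (auto simp: side_def)
  then show ?thesis using compact_cut closed_hyperplane by (metis compact_Int_closed)
qed

lemma side_multiple_rot:
  assumes "l \<in> L" "p \<in> side L d l" "q \<in> side L d l"
  obtains c where "q = p + c *\<^sub>R rot l"
proof -
  have "l \<bullet> (q - p) = 0" using assms by (simp add: side_def inner_diff_right)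
  then obtain c where "q - p = c *\<^sub>R rot l"
    using orthogonal_imp_multiple_rot primitive_normals[OF assms(1)] primitive_vecD by metis
  then show ?thesis using that by (metis add_diff_cancel_left' diff_add_cancel add.commute)
qed

text \<open>The end \<open>\<sigma> = 1\<close> is the one from which \<open>rot l\<close> points into the side.\<close>

lemma side_end:
  assumes l: "l \<in> side_normals L d" and \<sigma>: "\<sigma> = 1 \<or> \<sigma> = - 1"
  obtains p m where "p \<in> cut L d" "l \<in> active L d p" "m \<in> active L d p" "\<sigma> * wedge l m > 0"
    "\<And>x. x \<in> active L d p \<Longrightarrow> \<sigma> * wedge l x \<ge> 0"
proof -
  obtain a b where ab: "a \<in> side L d l" "b \<in> side L d l" "a \<noteq> b" and lL: "l \<in> L"
    using l by (auto simp: side_normals_def)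
  have l0: "l \<noteq> 0" using primitive_normals[OF lL] primitive_vecD by blast
  have "continuous_on (side L d l) (\<lambda>p. \<sigma> * (rot l \<bullet> p))" by (intro continuous_intros)
  then obtain p where p: "p \<in> side L d l" "\<And>q. q \<in> side L d l \<Longrightarrow> \<sigma> * (rot l \<bullet> p) \<le> \<sigma> * (rot l \<bullet> q)"
    using continuous_attains_inf[OF compact_side[of l]] ab by blast
  obtain q where q: "q \<in> side L d l" "q \<noteq> p" using ab by metis
  obtain c where c: "q = p + c *\<^sub>R rot l" using side_multiple_rot[OF lL p(1) q(1)] .
  have "\<sigma> * (c * (rot l \<bullet> rot l)) \<ge> 0" using p(2)[OF q(1)] c by (simp add: inner_add_right algebra_simps)
  moreover have "rot l \<bullet> rot l > 0" using l0 by simp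
  ultimately have "\<sigma> * c \<ge> 0" by (metis mult.assoc zero_le_mult_iff not_less order.asym mult_less_0_iff)
  moreover have "c \<noteq> 0" using q c by auto
  ultimately have sc: "\<sigma> * c > 0" using \<sigma> by auto
  have pc: "p \<in> cut L d" "l \<in> active L d p" using p(1) lL by (auto simp: side_def active_def)
  have nonneg: "\<sigma> * wedge l x \<ge> 0" if "x \<in> active L d p" for x
  proof -
    have "x \<bullet> q \<ge> x \<bullet> p" using q that by (auto simp: side_def cut_def active_def)
    then have "c * wedge l x \<ge> 0" by (simp add: c inner_add_right wedge_eq_inner_rot)
    then show ?thesis using sc \<sigma> by (auto simp: zero_le_mult_iff)
  qed
  have "\<exists>m\<in>active L d p. \<sigma> * wedge l m > 0"
  proof (rule ccontr)
    assume "\<not> ?thesis"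
    \<comment> \<open>If no active normal stops the motion, the side continues beyond its extreme
      point \<open>p\<close>.\<close>
    then have "\<forall>x\<in>active L d p. x \<bullet> ((- \<sigma>) *\<^sub>R rot l) \<ge> 0"
      using nonneg by (force simp: wedge_eq_inner_rot)
    then obtain s where s: "s > 0" "p + s *\<^sub>R ((- \<sigma>) *\<^sub>R rot l) \<in> cut L d"
      using feasible_direction[OF pc(1)] by metis
    then have "p + s *\<^sub>R ((- \<sigma>) *\<^sub>R rot l) \<in> side L d l"
      using p(1) by (simp add: side_def inner_diff_right)
    from p(2)[OF this] have "\<sigma> * \<sigma> * (s * (rot l \<bullet> rot l)) \<le> 0"
      by (simp add: inner_diff_right algebra_simps)
    then show False using s(1) \<open>rot l \<bullet> rot l > 0\<close> \<sigma> by (auto simp: mult_le_0_iff)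
  qed
  then show ?thesis using that pc nonneg by blast
qed

text \<open>At the end from which \<open>rot l\<close> points into the side, \<open>l\<close> is the
  first active normal in the rotational order, hence the first normal of the corner.\<close>

lemma side_normal_next:
  assumes "l \<in> side_normals L d"
  obtains p m where "corner_at L d p l m"
proof -
  obtain p m where pm: "p \<in> cut L d" "l \<in> active L d p" "m \<in> active L d p" "wedge l m > 0"
    "\<And>x. x \<in> active L d p \<Longrightarrow> wedge l x \<ge> 0"
    using side_end[OF assms, of 1] by auto
  then obtain l' m' where c: "corner_at L d p l' m'" using corner_at_exists by (metis less_irrefl)
  have "wedge l' l \<ge> 0" "wedge l l' \<ge> 0" using c pm by (auto simp: corner_at_def)
  then have "wedge l l' = 0" using wedge_swap[of l l'] by simp
  then have "l' = l" using active_parallel_eq c pm unfolding corner_at_def by blast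
  then show ?thesis using that c by blast
qed

lemma side_normal_prev:
  assumes "m \<in> side_normals L d"
  obtains p l where "corner_at L d p l m"
proof -
  obtain p x where px: "p \<in> cut L d" "m \<in> active L d p" "x \<in> active L d p" "wedge m x < 0"
    "\<And>x. x \<in> active L d p \<Longrightarrow> wedge m x \<le> 0"
    using side_end[OF assms, of "- 1"] by auto
  then obtain l' m' where c: "corner_at L d p l' m'" using corner_at_exists by (metis less_irrefl)
  have "wedge m m' \<ge> 0" "wedge m m' \<le> 0" using c px by (auto simp: corner_at_def)
  then have "wedge m m' = 0" by simp
  then have "m' = m" using active_parallel_eq c px unfolding corner_at_def by blast
  then show ?thesis using that c by blast
qed

text \<open>Two such corners differ by \<open>k *\<^sub>R rot l\<close>. The constraint of
  \<open>m\<close> allows only \<open>k \<ge> 0\<close> and that of \<open>m'\<close> only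
  \<open>k \<le> 0\<close>.\<close>

lemma corner_at_next_unique:
  assumes "corner_at L d p l m" "corner_at L d p' l m'"
  shows "p' = p \<and> m' = m"
proof -
  have c: "p \<in> cut L d" "l \<in> active L d p" "m \<in> active L d p" "wedge l m > 0" 
    "p' \<in> cut L d" "l \<in> active L d p'" "m' \<in> active L d p'" "wedge l m' > 0" 
    using assms by (auto simp: corner_at_def)
  then have lL: "l \<in> L" and s: "p \<in> side L d l" "p' \<in> side L d l"
    by (auto simp: active_def side_def)
  obtain k where k: "p' = p + k *\<^sub>R rot l" using side_multiple_rot[OF lL s] .
  have "m \<bullet> p' \<ge> m \<bullet> p" "m' \<bullet> p \<ge> m' \<bullet> p'" using c by (auto simp: cut_def active_def)
  then have "k * wedge l m \<ge> 0" "k * wedge l m' \<le> 0"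
    by (auto simp: k inner_add_right wedge_eq_inner_rot)
  then have "k = 0" using c by (simp add: zero_le_mult_iff mult_le_0_iff)
  then have "p' = p" using k by simp
  then show ?thesis using corner_at_unique assms by blast
qed

lemma corner_at_prev_unique:
  assumes "corner_at L d p l m" "corner_at L d p' l' m"
  shows "p' = p \<and> l' = l"
proof -
  have c: "p \<in> cut L d" "m \<in> active L d p" "l \<in> active L d p" "wedge l m > 0" 
    "p' \<in> cut L d" "m \<in> active L d p'" "l' \<in> active L d p'" "wedge l' m > 0" 
    using assms by (auto simp: corner_at_def)
  then have mL: "m \<in> L" and s: "p \<in> side L d m" "p' \<in> side L d m"
    by (auto simp: active_def side_def)
  obtain k where k: "p' = p + k *\<^sub>R rot m" using side_multiple_rot[OF mL s] .
  have "l \<bullet> p' \<ge> l \<bullet> p" "l' \<bullet> p \<ge> l' \<bullet> p'" using c by (auto simp: cut_def active_def)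
  then have "k * wedge m l \<ge> 0" "k * wedge m l' \<le> 0"
    by (auto simp: k inner_add_right wedge_eq_inner_rot)
  then have "k = 0" using c wedge_swap[of m l] wedge_swap[of m l'] by (simp add: zero_le_mult_iff mult_le_0_iff)
  then have "p' = p" using k by simp
  then show ?thesis using corner_at_unique assms by blast
qed

text \<open>Each side is the first side of one corner and, by the companion statement, the second
  side of one corner. The two bijections replace a cyclic order of the sides.\<close>

lemma bij_betw_fst_corners: "bij_betw fst (corners L d) (side_normals L d)"
proof (rule bij_betwI')
  fix x y assume "x \<in> corners L d" "y \<in> corners L d"
  then show "(fst x = fst y) = (x = y)"
    using corner_at_next_unique by (auto simp: corners_def)
next
  fix x assume "x \<in> corners L d"
  then show "fst x \<in> side_normals L d" using corner_at_normals by (auto simp: corners_def)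
next
  fix l assume "l \<in> side_normals L d"
  then show "\<exists>x\<in>corners L d. l = fst x"
    using side_normal_next by (metis (mono_tags, lifting) corners_def case_prodI fst_conv mem_Collect_eq)
qed

lemma bij_betw_snd_corners: "bij_betw snd (corners L d) (side_normals L d)"
proof (rule bij_betwI')
  fix x y assume "x \<in> corners L d" "y \<in> corners L d"
  then show "(snd x = snd y) = (x = y)"
    using corner_at_prev_unique by (auto simp: corners_def)
next
  fix x assume "x \<in> corners L d"
  then show "snd x \<in> side_normals L d" using corner_at_normals by (auto simp: corners_def)
next
  fix l assume "l \<in> side_normals L d"
  then show "\<exists>x\<in>corners L d. l = snd x"
    using side_normal_prev by (metis (mono_tags, lifting) corners_def case_prodI snd_conv mem_Collect_eq)
qed

lemma finite_corners: "finite (corners L d)"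
  by (rule finite_subset[of _ "L \<times> L"])
    (auto simp: corners_def corner_at_def active_def finite_normals)

text \<open>Two independent active normals pin the point down. If all active normals are parallel,
  \<open>p\<close> can be moved both ways along the common kernel and lies inside a segment.\<close>

lemma extreme_point_iff_corner: "p extreme_point_of cut L d \<longleftrightarrow> (\<exists>l m. corner_at L d p l m)"
proof
  assume "\<exists>l m. corner_at L d p l m"
  then obtain l m where c: "p \<in> cut L d" "l \<in> active L d p" "m \<in> active L d p" "wedge l m > 0"
    by (auto simp: corner_at_def)
  show "p extreme_point_of cut L d"
    unfolding extreme_point_of_def
  proof (intro conjI ballI notI)
    fix a b assume ab: "a \<in> cut L d" "b \<in> cut L d" "p \<in> open_segment a b"
    have ne: "a \<noteq> b" using ab(3) by auto
    have eq: "x \<bullet> a = x \<bullet> b" if "x \<in> active L d p" for x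
    proof -
      have "x \<bullet> p = d x" "d x \<le> x \<bullet> a" "d x \<le> x \<bullet> b"
        using that ab by (auto simp: active_def cut_def)
      from inner_minimal_in_open_segment[OF ab(3) this] show ?thesis by simp
    qed
    then have "a = b" using inner_determines_point[of l m] c by auto
    with ne show False by blast
  qed (use c in blast)
next
  assume ex: "p extreme_point_of cut L d"
  then have p: "p \<in> cut L d" by (simp add: extreme_point_of_def)
  show "\<exists>l m. corner_at L d p l m"
  proof (rule ccontr)
    assume no: "\<nexists>l m. corner_at L d p l m"
    have "\<exists>u. u \<noteq> 0 \<and> (\<forall>x\<in>active L d p. x \<bullet> u = 0)"
    proof (cases "active L d p = {}")
      case True
      then show ?thesis by (intro exI[of _ "vector [1, 0]"]) (simp add: vec2_eq_iff)
    next
      case False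
      then obtain l where l: "l \<in> active L d p" by blast
      then have "\<forall>x\<in>active L d p. x \<bullet> rot l = 0"
        using corner_at_exists[OF p l] no by (metis wedge_eq_inner_rot)
      moreover have "rot l \<noteq> 0" using active_primitive[OF l] primitive_vecD by simp
      ultimately show ?thesis by blast
    qed
    then obtain u where u: "u \<noteq> 0" "\<forall>x\<in>active L d p. x \<bullet> u = 0" by blast
    obtain s where s: "s > 0" "p + s *\<^sub>R u \<in> cut L d"
      using feasible_direction[OF p, of u] u by auto
    obtain t where t: "t > 0" "p + t *\<^sub>R (- u) \<in> cut L d"
      using feasible_direction[OF p, of "- u"] u by auto
    have "p = (1 - t / (s + t)) *\<^sub>R (p + t *\<^sub>R (- u)) + (t / (s + t)) *\<^sub>R (p + s *\<^sub>R u)"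
      using s t by (simp add: vec2_eq_iff divide_simps) (simp add: algebra_simps)
    moreover have "p + t *\<^sub>R (- u) \<noteq> p + s *\<^sub>R u"
    proof
      assume "p + t *\<^sub>R (- u) = p + s *\<^sub>R u"
      then have "(s + t) *\<^sub>R u = 0" by (simp add: algebra_simps)
      then show False using u s t by simp
    qed
    moreover have "0 < t / (s + t)" "t / (s + t) < 1" using s t by simp_all
    ultimately have "p \<in> open_segment (p + t *\<^sub>R (- u)) (p + s *\<^sub>R u)"
      unfolding in_segment by blast
    then show False using ex s t unfolding extreme_point_of_def by blast
  qed
qed

text \<open>The minimum of \<open>z\<close> is attained at an extreme point; since \<open>z\<close>
  does not decrease along the two sides leaving it, \<open>z\<close> lies in the cone of
  \<open>l\<close> and \<open>m\<close>.\<close>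

lemma minimizing_corner:
  obtains p l m where "corner_at L d p l m" "wedge l z \<ge> 0" "wedge z m \<ge> 0"
    "\<And>q. q \<in> cut L d \<Longrightarrow> z \<bullet> p \<le> z \<bullet> q"
proof -
  have "continuous_on (cut L d) (\<lambda>p. z \<bullet> p)" by (intro continuous_intros)
  then obtain p0 where p0: "p0 \<in> cut L d" "\<And>q. q \<in> cut L d \<Longrightarrow> z \<bullet> p0 \<le> z \<bullet> q"
    using continuous_attains_inf[OF compact_cut cut_nonempty] by blast
  let ?F = "cut L d \<inter> {x. z \<bullet> x = z \<bullet> p0}"
  have F: "?F face_of cut L d"
    using face_of_Int_supporting_hyperplane_ge[OF convex_cut] p0 by blast
  moreover have "compact ?F" "convex ?F" "?F \<noteq> {}"
    using p0 face_of_imp_compact[OF convex_cut compact_cut F] face_of_imp_convex[OF F] by auto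
  then obtain p where "p extreme_point_of ?F"
    using extreme_point_exists_convex by blast
  ultimately have p: "p extreme_point_of cut L d" "p \<in> ?F"
    by (simp_all add: extreme_point_of_face)
  then obtain l m where c: "corner_at L d p l m"
    using extreme_point_iff_corner by blast
  have min: "z \<bullet> p \<le> z \<bullet> q" if "q \<in> cut L d" for q
    using p p0 that by auto
  have c': "p \<in> cut L d"
    "\<And>x. x \<in> active L d p \<Longrightarrow> wedge l x \<ge> 0 \<and> wedge x m \<ge> 0"
    using c by (auto simp: corner_at_def)
  obtain s where "s > 0" "p + s *\<^sub>R rot l \<in> cut L d"
    using feasible_direction[OF c'(1), of "rot l"] c'(2) by (metis wedge_eq_inner_rot)
  with min[of "p + s *\<^sub>R rot l"] have "wedge l z \<ge> 0"
    by (simp add: inner_add_right wedge_eq_inner_rot zero_le_mult_iff)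
  moreover have "x \<bullet> (- rot m) \<ge> 0" if "x \<in> active L d p" for x
    using c'(2)[OF that] wedge_eq_inner_rot[of m x] wedge_swap[of x m] by simp
  then obtain s where "s > 0" "p + s *\<^sub>R (- rot m) \<in> cut L d"
    using feasible_direction[OF c'(1), of "- rot m"] by blast
  with min[of "p + s *\<^sub>R (- rot m)"] have "wedge z m \<ge> 0"
    using wedge_swap[of z m] by (simp add: inner_diff_right wedge_eq_inner_rot mult_le_0_iff)
  ultimately show ?thesis using that c min by blast
qed

text \<open>Completeness of the normal fan: the cones of the corners cover the plane. The
  coefficients form a dual solution of the problem of minimizing \<open>z\<close>.\<close>

lemma vertex_cone_decomposition:
  obtains p l m \<alpha> \<beta> where "corner_at L d p l m" "\<alpha> \<ge> 0" "\<beta> \<ge> 0" "z = \<alpha> *\<^sub>R l + \<beta> *\<^sub>R m"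
proof -
  obtain p l m where c: "corner_at L d p l m" "wedge l z \<ge> 0" "wedge z m \<ge> 0"
    using minimizing_corner[of z] by metis
  then have w: "wedge l m > 0" by (simp add: corner_at_def)
  have "wedge l m *\<^sub>R z = wedge l m *\<^sub>R ((wedge z m / wedge l m) *\<^sub>R l + (wedge l z / wedge l m) *\<^sub>R m)"
    using wedge_decompose[of l m z] w by (simp add: scaleR_add_right)
  then have eq: "z = (wedge z m / wedge l m) *\<^sub>R l + (wedge l z / wedge l m) *\<^sub>R m"
    using w by (simp del: scaleR_scaleR)
  show ?thesis by (rule that[OF c(1) _ _ eq]) (use c w in simp_all)
qed

end

section \<open>Edges, perimeter and winding of the normals\<close>

lemma aff_dim_side_le:
  assumes "l \<noteq> 0"
  shows "aff_dim (side L d l) \<le> 1"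
proof -
  have "aff_dim (side L d l) \<le> aff_dim {x. l \<bullet> x = d l}"
    by (rule aff_dim_subset) (auto simp: side_def)
  then show ?thesis using assms by (simp add: aff_dim_hyperplane)
qed

lemma side_face_of_cut: "l \<in> L \<Longrightarrow> side L d l face_of cut L d"
proof -
  assume "l \<in> L"
  then have "cut L d \<inter> {x. l \<bullet> x = d l} face_of cut L d"
    by (intro face_of_Int_supporting_hyperplane_ge convex_cut) (auto simp: cut_def)
  moreover have "side L d l = cut L d \<inter> {x. l \<bullet> x = d l}" by (auto simp: side_def)
  ultimately show ?thesis by simp
qed

context lattice_polygon
begin

lemma inj_on_side: "inj_on (side L d) (side_normals L d)"
proof (rule inj_onI)
  fix l m assume lm: "l \<in> side_normals L d" "m \<in> side_normals L d" "side L d l = side L d m"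
  obtain p q where pq: "p \<in> side L d l" "q \<in> side L d l" "p \<noteq> q" and L: "l \<in> L" "m \<in> L"
    using lm by (auto simp: side_normals_def)
  obtain c where c: "q = p + c *\<^sub>R rot l" using side_multiple_rot[OF L(1) pq(1,2)] .
  have "p \<in> side L d m" "q \<in> side L d m" using pq lm(3) by simp_all
  then have "m \<bullet> p = m \<bullet> q" by (simp add: side_def)
  then have "wedge l m = 0" using c pq by (simp add: inner_add_right wedge_eq_inner_rot)
  moreover have "l \<in> active L d p" "m \<in> active L d p" using pq lm(3) L by (auto simp: side_def active_def)
  ultimately show "l = m" using active_parallel_eq by metis
qed

text \<open>A relatively interior point of an edge is not interior to the polygon, so some
  constraint is tight there and hence on the whole edge; comparing dimensions, the edge is that
  side.\<close>

lemma edge_of_cut_iff: "e edge_of cut L d \<longleftrightarrow> e \<in> side L d ` side_normals L d"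
proof
  assume e: "e edge_of cut L d"
  then have face: "e face_of cut L d" and dim: "aff_dim e = 1" by (auto simp: edge_of_def)
  have "aff_dim (cut L d) = 2"
    using aff_dim_nonempty_interior[OF interior_cut_nonempty] by simp
  then have "e \<noteq> cut L d" using dim by auto
  then have disj: "e \<inter> interior (cut L d) = {}" using face_of_disjoint_interior face by blast
  have "rel_interior e \<noteq> {}"
    using dim rel_interior_eq_empty[OF face_of_imp_convex[OF face]] by force
  then obtain p where p: "p \<in> rel_interior e" by blast
  then have pe: "p \<in> e" using rel_interior_subset by blast
  then have pc: "p \<in> cut L d" using face face_of_imp_subset by blast
  have "p \<notin> interior (cut L d)" using disj pe by blast
  then obtain l where "l \<in> L" "\<not> d l < l \<bullet> p" using interior_cutI by blast
  then have l: "l \<in> L" "p \<in> side L d l" using pc by (force simp: side_def cut_def)+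
  have l0: "l \<noteq> 0" using primitive_normals[OF l(1)] primitive_vecD by blast
  have sub: "e \<subseteq> side L d l"
    using subset_of_face_of[OF side_face_of_cut[OF l(1)] face_of_imp_subset[OF face]] p l by blast
  have "side L d l \<subseteq> cut L d" by (auto simp: side_def)
  then have "e face_of side L d l" using face_of_subset face sub by blast
  moreover have "convex (side L d l)" using face_of_imp_convex side_face_of_cut l by blast
  ultimately have "e = side L d l" using face_of_aff_dim_lt dim aff_dim_side_le[OF l0, of L d] by fastforce
  moreover have "\<exists>a\<in>e. \<exists>b\<in>e. a \<noteq> b"
  proof (rule ccontr)
    assume "\<not> ?thesis"
    then have "e \<subseteq> {p}" using pe by blast
    then have "aff_dim e \<le> 0" using aff_dim_subset[of e "{p}"] by simp
    with dim show False by simp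
  qed
  ultimately show "e \<in> side L d ` side_normals L d" using l(1) unfolding side_normals_def by blast
next
  assume "e \<in> side L d ` side_normals L d"
  then obtain l p q where l: "e = side L d l" "l \<in> L" "p \<in> e" "q \<in> e" "p \<noteq> q"
    by (auto simp: side_normals_def)
  have l0: "l \<noteq> 0" using primitive_normals[OF l(2)] primitive_vecD by blast
  have "aff_dim {p, q} \<le> aff_dim e" using l by (intro aff_dim_subset) auto
  then have "aff_dim e = 1" using aff_dim_side_le[OF l0, of L d] l by simp
  then show "e edge_of cut L d" using side_face_of_cut l by (simp add: edge_of_def)
qed

lemma side_eq_closed_segment:
  assumes p: "corner_at L d p l m" and q: "corner_at L d q k l"
  obtains c where "c \<ge> 0" "q = p + c *\<^sub>R rot l" "side L d l = closed_segment p q"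
proof -
  have pd: "p \<in> cut L d" "l \<in> active L d p" "m \<in> active L d p" "wedge l m > 0"
    and qd: "q \<in> cut L d" "l \<in> active L d q" "k \<in> active L d q" "wedge k l > 0"
    using p q by (auto simp: corner_at_def)
  have lL: "l \<in> L" and s: "p \<in> side L d l" "q \<in> side L d l"
    using pd qd by (auto simp: active_def side_def)
  obtain c where c: "q = p + c *\<^sub>R rot l" using side_multiple_rot[OF lL s] .
  have "m \<bullet> q \<ge> m \<bullet> p" using pd qd by (auto simp: cut_def active_def)
  then have c0: "c \<ge> 0" using pd by (simp add: c inner_add_right wedge_eq_inner_rot zero_le_mult_iff)
  have "side L d l \<subseteq> closed_segment p q"
  proof
    fix x assume x: "x \<in> side L d l"
    obtain t where t: "x = p + t *\<^sub>R rot l" using side_multiple_rot[OF lL s(1) x] .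
    have "m \<bullet> x \<ge> m \<bullet> p" "k \<bullet> x \<ge> k \<bullet> q" using pd qd x by (auto simp: cut_def active_def side_def)
    then have "t * wedge l m \<ge> 0" "(t - c) * wedge l k \<ge> 0"
      by (auto simp: t c inner_add_right wedge_eq_inner_rot algebra_simps)
    then have "t \<ge> 0" "t \<le> c" using pd qd wedge_swap[of l k] by (auto simp: zero_le_mult_iff mult_le_0_iff)
    then show "x \<in> closed_segment p q"
      by (cases "c = 0") (auto simp: t c in_segment algebra_simps intro!: exI[of _ "t / c"])
  qed
  moreover have "closed_segment p q \<subseteq> side L d l"
    using s closed_segment_subset face_of_imp_convex side_face_of_cut lL by metis
  ultimately show ?thesis using that c c0 by blast
qed

lemma sum_corners_fst: "(\<Sum>x\<in>corners L d. f (fst x)) = (\<Sum>l\<in>side_normals L d. f l)"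
  by (rule sum.reindex_bij_betw[OF bij_betw_fst_corners])

lemma sum_corners_snd: "(\<Sum>x\<in>corners L d. f (snd x)) = (\<Sum>l\<in>side_normals L d. f l)"
  by (rule sum.reindex_bij_betw[OF bij_betw_snd_corners])

lemma inner_eta_neq_0: "l \<in> L \<Longrightarrow> l \<bullet> eta \<noteq> 0"
  using primitive_normals primitive_vecD eta_inner_neq_0 by blast

text \<open>The side is a multiple of the primitive vector \<open>rot l\<close>, on which
  \<open>rot eta\<close> takes the nonzero value \<open>l \<bullet> eta\<close>; so this functional
  reads off the multiple.\<close>

lemma tropical_length_side:
  assumes p: "corner_at L d p l m" and q: "corner_at L d q k l"
  shows "tropical_length (side L d l) = (rot eta \<bullet> q) / (l \<bullet> eta) - (rot eta \<bullet> p) / (l \<bullet> eta)"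
proof -
  obtain c where c: "c \<ge> 0" "q = p + c *\<^sub>R rot l" "side L d l = closed_segment p q"
    using side_eq_closed_segment[OF p q] .
  have l: "l \<in> L" using p by (simp add: corner_at_def active_def)
  have "rot eta \<bullet> rot l = l \<bullet> eta" by (simp add: inner2)
  then have "rot eta \<bullet> q = rot eta \<bullet> p + c * (l \<bullet> eta)"
    by (simp add: c inner_add_right)
  moreover have "tropical_length (side L d l) = c"
    unfolding c using c(1) primitive_rot primitive_normals[OF l] by (intro tropical_length_closed_segment)
  ultimately show ?thesis using inner_eta_neq_0[OF l] by (simp add: field_simps)
qed

text \<open>Summation by parts: the corner \<open>(l, m)\<close> is the start of the side of
  \<open>l\<close> and the end of the side of \<open>m\<close>, and all lengths are measured with
  the same functional \<open>rot eta\<close>.\<close>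

lemma sum_tropical_length_sides:
  "(\<Sum>l\<in>side_normals L d. tropical_length (side L d l)) =
   (\<Sum>(l, m)\<in>corners L d. (rot eta \<bullet> intersection_point d l m) * (1 / (m \<bullet> eta) - 1 / (l \<bullet> eta)))"
proof -
  let ?P = "\<lambda>x. rot eta \<bullet> intersection_point d (fst x) (snd x)"
  define nxt where "nxt = the_inv_into (corners L d) fst"
  define prv where "prv = the_inv_into (corners L d) snd"
  note bij = bij_betw_fst_corners bij_betw_snd_corners
  have nxt: "nxt (fst x) = x" if "x \<in> corners L d" for x
    unfolding nxt_def using bij(1) that by (simp add: bij_betw_def the_inv_into_f_f)
  have prv: "prv (snd x) = x" if "x \<in> corners L d" for x
    unfolding prv_def using bij(2) that by (simp add: bij_betw_def the_inv_into_f_f)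
  have len: "tropical_length (side L d l) = ?P (prv l) / (l \<bullet> eta) - ?P (nxt l) / (l \<bullet> eta)"
    if l: "l \<in> side_normals L d" for l
  proof -
    obtain p m where p: "corner_at L d p l m" using side_normal_next[OF l] .
    obtain q k where q: "corner_at L d q k l" using side_normal_prev[OF l] .
    have "(l, m) \<in> corners L d" "(k, l) \<in> corners L d" using p q by (auto simp: corners_def)
    then have "nxt l = (l, m)" "prv l = (k, l)" using nxt[of "(l, m)"] prv[of "(k, l)"] by auto
    then show ?thesis
      using tropical_length_side[OF p q] corner_at_eq_intersection_point[OF p]
        corner_at_eq_intersection_point[OF q] by simp
  qed
  have "(\<Sum>l\<in>side_normals L d. tropical_length (side L d l)) =
    (\<Sum>l\<in>side_normals L d. ?P (prv l) / (l \<bullet> eta)) - (\<Sum>l\<in>side_normals L d. ?P (nxt l) / (l \<bullet> eta))"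
    by (simp add: len sum_subtractf)
  also have "(\<Sum>l\<in>side_normals L d. ?P (prv l) / (l \<bullet> eta)) = (\<Sum>x\<in>corners L d. ?P x / (snd x \<bullet> eta))"
    by (subst sum_corners_snd[symmetric], rule sum.cong) (simp_all add: prv)
  also have "(\<Sum>l\<in>side_normals L d. ?P (nxt l) / (l \<bullet> eta)) = (\<Sum>x\<in>corners L d. ?P x / (fst x \<bullet> eta))"
    by (subst sum_corners_fst[symmetric], rule sum.cong) (simp_all add: nxt)
  also have "(\<Sum>x\<in>corners L d. ?P x / (snd x \<bullet> eta)) - (\<Sum>x\<in>corners L d. ?P x / (fst x \<bullet> eta)) =
    (\<Sum>(l, m)\<in>corners L d. (rot eta \<bullet> intersection_point d l m) * (1 / (m \<bullet> eta) - 1 / (l \<bullet> eta)))"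
    by (simp add: sum_subtractf[symmetric] case_prod_beta right_diff_distrib)
  finally show ?thesis .
qed

lemma polygon_boundary_length_cut:
  "polygon_boundary_length (cut L d) = (\<Sum>l\<in>side_normals L d. tropical_length (side L d l))"
proof -
  have "{e. e edge_of cut L d} = side L d ` side_normals L d"
    using edge_of_cut_iff by blast
  then show ?thesis
    unfolding polygon_boundary_length_def by (simp add: sum.reindex inj_on_side)
qed

text \<open>A covector slightly clockwise of \<open>(1, 0)\<close>, where the upper half-plane begins.\<close>

lemma upper_covector:
  obtains z where "\<And>l. l \<in> L \<Longrightarrow> upper l \<longleftrightarrow> wedge z l > 0" "\<And>l. l \<in> L \<Longrightarrow> \<not> upper l \<longleftrightarrow> wedge z l < 0"
proof -
  \<comment> \<open>\<open>M\<close> exceeds all first coordinates, so the perturbation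
    \<open>l$1 / M\<close> is smaller than 1 and cannot change the sign of a nonzero integer
    \<open>l$2\<close>.\<close>
  define M where "M = (\<Sum>l\<in>L. \<bar>l$1\<bar>) + 1"
  have M: "\<bar>l$1\<bar> < M" if "l \<in> L" for l
    using member_le_sum[OF that, of "\<lambda>l. \<bar>l$1\<bar>"] finite_normals by (simp add: M_def)
  have Mpos: "M > 0" by (simp add: M_def sum_nonneg add_nonneg_pos)
  define z :: "real^2" where "z = vector [1, - 1 / M]"
  have zl: "wedge z l = l$2 + l$1 / M" for l by (simp add: z_def wedge_def)
  have *: "upper l \<longleftrightarrow> wedge z l > 0" "wedge z l \<noteq> 0" if l: "l \<in> L" for l
  proof -
    have "\<bar>l$1 / M\<bar> < 1" using M[OF l] Mpos by simp
    obtain x y :: int where xy: "l = vector [of_int x, of_int y]"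
      using primitive_normals[OF l] primitive_vecD(1) lattice_vecE by blast
    have "l \<noteq> 0" using primitive_normals[OF l] primitive_vecD by blast
    consider "y \<ge> 1" | "y \<le> - 1" | "y = 0" "x \<noteq> 0"
      using \<open>l \<noteq> 0\<close> xy by (fastforce simp: vec2_eq_iff)
    then have "(upper l \<longleftrightarrow> wedge z l > 0) \<and> wedge z l \<noteq> 0"
    proof cases
      case 1
      then have "l$2 \<ge> 1" by (simp add: xy)
      then show ?thesis using \<open>\<bar>l$1 / M\<bar> < 1\<close> unfolding zl upper_def by linarith
    next
      case 2
      then have "l$2 \<le> - 1" by (simp add: xy)
      then show ?thesis using \<open>\<bar>l$1 / M\<bar> < 1\<close> unfolding zl upper_def by linarith
    next
      case 3
      then show ?thesis using Mpos by (simp add: zl upper_def xy zero_less_divide_iff)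
    qed
    then show "upper l \<longleftrightarrow> wedge z l > 0" "wedge z l \<noteq> 0" by auto
  qed
  then have "\<not> upper l \<longleftrightarrow> wedge z l < 0" if "l \<in> L" for l
    using that by (meson linorder_neqE_linordered_idom not_less_iff_gr_or_eq)
  then show ?thesis using that * by blast
qed

text \<open>The normals wind around exactly once. A minimizing corner of \<open>z\<close> is a
  crossing; conversely, at a crossing \<open>z\<close> is a combination of both normals with
  positive coefficients, so its minimum over the polygon is attained there and nowhere else.\<close>

lemma unique_crossing_corner:
  obtains l m where "{x \<in> corners L d. \<not> upper (fst x) \<and> upper (snd x)} = {(l, m)}"
proof -
  obtain z where z: "\<And>l. l \<in> L \<Longrightarrow> upper l \<longleftrightarrow> wedge z l > 0" "\<And>l. l \<in> L \<Longrightarrow> \<not> upper l \<longleftrightarrow> wedge z l < 0"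
    using upper_covector by blast
  have L: "l \<in> L" "m \<in> L" if "corner_at L d p l m" for p l m
    using that by (auto simp: corner_at_def active_def)
  obtain p l m where c: "corner_at L d p l m" "wedge l z \<ge> 0" "wedge z m \<ge> 0"
    "\<And>q. q \<in> cut L d \<Longrightarrow> z \<bullet> p \<le> z \<bullet> q"
    using minimizing_corner[of z] by blast
  have cross: "\<not> upper l" "upper m"
    using c(2,3) z(1)[OF L(1)[OF c(1)]] z(2)[OF L(2)[OF c(1)]] wedge_swap[of z l] by auto
  have uniq: "l' = l \<and> m' = m" if c': "corner_at L d p' l' m'" "\<not> upper l'" "upper m'" for p' l' m'
  proof -
    have w: "wedge l' m' > 0" "wedge z m' > 0" "wedge l' z > 0"
      using c' z(1)[OF L(2)[OF c'(1)]] z(2)[OF L(1)[OF c'(1)]] wedge_swap[of z l']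
      by (simp_all add: corner_at_def)
    have pd: "p \<in> cut L d" "p' \<in> cut L d" "l' \<in> active L d p'" "m' \<in> active L d p'"
      using c(1) c'(1) by (auto simp: corner_at_def)
    have "z \<bullet> p \<le> z \<bullet> p'" using c(4) pd by blast
    then have "wedge l' m' * (z \<bullet> p) \<le> wedge l' m' * (z \<bullet> p')" using w by simp
    then have "wedge z m' * (l' \<bullet> p - l' \<bullet> p') + wedge l' z * (m' \<bullet> p - m' \<bullet> p') \<le> 0"
      by (simp add: wedge_decompose_inner[of l' m' z] algebra_simps)
    moreover have "l' \<bullet> p \<ge> l' \<bullet> p'" "m' \<bullet> p \<ge> m' \<bullet> p'"
      using pd by (auto simp: cut_def active_def)
    ultimately have "wedge z m' * (l' \<bullet> p - l' \<bullet> p') = 0" "wedge l' z * (m' \<bullet> p - m' \<bullet> p') = 0"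
      using w by (smt (verit) mult_nonneg_nonneg)+
    then have "p = p'" using inner_determines_point[of l' m' p p'] w by auto
    then show ?thesis using corner_at_unique c(1) c'(1) by blast
  qed
  have only: "x = (l, m)" if x: "x \<in> corners L d" "\<not> upper (fst x)" "upper (snd x)" for x
  proof -
    obtain p' where "corner_at L d p' (fst x) (snd x)" using x(1) by (auto simp: corners_def)
    then show ?thesis using uniq x by (metis prod.collapse)
  qed
  have mem: "(l, m) \<in> corners L d" using c(1) unfolding corners_def by blast
  have "{x \<in> corners L d. \<not> upper (fst x) \<and> upper (snd x)} = {(l, m)}"
  proof (intro equalityI subsetI)
    fix x assume "x \<in> {x \<in> corners L d. \<not> upper (fst x) \<and> upper (snd x)}"
    then show "x \<in> {(l, m)}" using only by blast
  next
    fix x assume "x \<in> {(l, m)}"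
    then have "x = (l, m)" by simp
    then show "x \<in> {x \<in> corners L d. \<not> upper (fst x) \<and> upper (snd x)}"
      using mem cross by simp
  qed
  then show ?thesis using that by blast
qed

theorem sum_corners_eq_12:
  assumes empty: "\<And>l m x \<alpha> \<beta>. (l, m) \<in> corners L d \<Longrightarrow> primitive_vec x \<Longrightarrow> \<alpha> \<ge> 0 \<Longrightarrow> \<beta> \<ge> 0 \<Longrightarrow>
    x = \<alpha> *\<^sub>R l + \<beta> *\<^sub>R m \<Longrightarrow> \<alpha> + \<beta> \<ge> 1"
  shows "(\<Sum>(l, m)\<in>corners L d. wedge l m +
    (2 - (l \<bullet> eta) / (m \<bullet> eta) - (m \<bullet> eta) / (l \<bullet> eta)) / wedge l m) = 12"
proof -
  have cone: "wedge l m + (2 - (l \<bullet> eta) / (m \<bullet> eta) - (m \<bullet> eta) / (l \<bullet> eta)) / wedge l m =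
    potential m - potential l + (if \<not> upper l \<and> upper m then 12 else 0)" if lm: "(l, m) \<in> corners L d" for l m
  proof -
    have "primitive_vec l" "primitive_vec m" "wedge l m > 0"
      using lm primitive_normals by (auto simp: corners_def corner_at_def active_def)
    then show ?thesis by (rule cone_potential) (rule empty[OF lm])
  qed
  have "(\<Sum>(l, m)\<in>corners L d. wedge l m +
      (2 - (l \<bullet> eta) / (m \<bullet> eta) - (m \<bullet> eta) / (l \<bullet> eta)) / wedge l m) =
    (\<Sum>x\<in>corners L d. potential (snd x) - potential (fst x) +
      (if \<not> upper (fst x) \<and> upper (snd x) then 12 else 0))"
    by (rule sum.cong) (auto simp: cone)
  also have "\<dots> = (\<Sum>x\<in>corners L d. if \<not> upper (fst x) \<and> upper (snd x) then 12 else 0)"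
    by (simp add: sum.distrib sum_subtractf sum_corners_fst[of potential] sum_corners_snd[of potential])
  also have "\<dots> = (\<Sum>x\<in>{x \<in> corners L d. \<not> upper (fst x) \<and> upper (snd x)}. 12)"
    by (rule sum.inter_filter[symmetric, OF finite_corners])
  also have "\<dots> = 12" by (rule unique_crossing_corner) simp
  finally show ?thesis .
qed

section \<open>Side lengths as functions of the bounds\<close>

lemma exists_normal_inner_neg:
  assumes "v \<noteq> 0"
  shows "\<exists>m\<in>L. m \<bullet> v < 0"
proof (rule ccontr)
  assume no: "\<not> ?thesis"
  obtain p where p: "p \<in> cut L d" using cut_nonempty by blast
  \<comment> \<open>If no normal opposes \<open>v\<close>, the polygon contains a ray and is
    unbounded.\<close>
  have ray: "p + s *\<^sub>R v \<in> cut L d" if "s \<ge> 0" for s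
    using p no that by (auto simp: cut_def inner_add_right intro!: add_increasing2 mult_nonneg_nonneg)
  obtain B where B: "\<And>x. x \<in> cut L d \<Longrightarrow> norm x \<le> B" using bounded_cut bounded_iff by blast
  define s where "s = (B + norm p + 1) / norm v"
  have "B \<ge> 0" using B[OF p] norm_ge_zero order_trans by blast
  then have s: "s \<ge> 0" by (simp add: s_def)
  have "norm (s *\<^sub>R v) = B + norm p + 1" using assms s \<open>B \<ge> 0\<close> by (simp add: s_def)
  moreover have "norm (s *\<^sub>R v) \<le> norm (p + s *\<^sub>R v) + norm p"
    by (metis add_diff_cancel_left' norm_triangle_ineq4)
  ultimately show False using B[OF ray[OF s]] by linarith
qed

text \<open>The origin on the line of a side is its intersection with the line spanned by \<open>eta\<close>, which makes
  all bounds affine in \<open>d'\<close>.\<close>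

definition chord_bound :: "(real^2 \<Rightarrow> real) \<Rightarrow> real^2 \<Rightarrow> real^2 \<Rightarrow> real" where
  "chord_bound d' l m = (d' m - d' l * (m \<bullet> eta) / (l \<bullet> eta)) / wedge l m"

definition chord :: "(real^2 \<Rightarrow> real) \<Rightarrow> real^2 \<Rightarrow> real" where
  "chord d' l = max 0 (Min (chord_bound d' l ` {m\<in>L. wedge l m < 0}) -
     Max (chord_bound d' l ` {m\<in>L. wedge l m > 0}))"

lemma chord_normals_nonempty:
  assumes "l \<in> L"
  shows "{m\<in>L. wedge l m < 0} \<noteq> {}" "{m\<in>L. wedge l m > 0} \<noteq> {}"
proof -
  have "rot l \<noteq> 0" using primitive_normals[OF assms] primitive_vecD by simp
  then show "{m\<in>L. wedge l m < 0} \<noteq> {}"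
    using exists_normal_inner_neg[of "rot l"] by (auto simp: wedge_eq_inner_rot)
  show "{m\<in>L. wedge l m > 0} \<noteq> {}"
    using exists_normal_inner_neg[of "- rot l"] \<open>rot l \<noteq> 0\<close> by (auto simp: wedge_eq_inner_rot)
qed

text \<open>A formula that also holds for degenerate and empty sides and, since only nonemptiness is
  asked of the new bounds, at the final time. It makes side lengths continuous in the
  bounds.\<close>

lemma tropical_length_side_eq_chord:
  assumes l: "l \<in> L" and ne: "cut L d' \<noteq> {}"
  shows "tropical_length (side L d' l) = chord d' l"
proof -
  define foot where "foot = (d' l / (l \<bullet> eta)) *\<^sub>R eta"
  define lo where "lo = Max (chord_bound d' l ` {m\<in>L. wedge l m > 0})"
  define hi where "hi = Min (chord_bound d' l ` {m\<in>L. wedge l m < 0})"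
  have prim: "primitive_vec l" using primitive_normals l by blast
  have eta: "l \<bullet> eta \<noteq> 0" using inner_eta_neq_0 l by blast
  have lfoot: "l \<bullet> foot = d' l" using eta by (simp add: foot_def)
  have inner: "m \<bullet> (foot + x *\<^sub>R rot l) \<ge> d' m \<longleftrightarrow> x * wedge l m \<ge> chord_bound d' l m * wedge l m"
    if "wedge l m \<noteq> 0" for m x
    using that by (simp add: foot_def chord_bound_def inner_add_right wedge_eq_inner_rot) (simp add: algebra_simps)
  have mem: "foot + x *\<^sub>R rot l \<in> side L d' l \<longleftrightarrow> lo \<le> x \<and> x \<le> hi" for x
  proof -
    \<comment> \<open>A normal opposite to \<open>l\<close> accepts or rejects the whole line; as
      the polygon is nonempty, it accepts it.\<close>
    have "d' m \<le> m \<bullet> (foot + x *\<^sub>R rot l)" if m: "m \<in> L" "wedge l m = 0" for m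
    proof -
      have "m = l \<or> m = - l" using primitive_parallel prim primitive_normals m by blast
      moreover obtain p where "d' l \<le> l \<bullet> p" "d' m \<le> m \<bullet> p" using ne l m by (auto simp: cut_def)
      ultimately show ?thesis by (auto simp: inner_add_right lfoot)
    qed
    then have "d' m \<le> m \<bullet> (foot + x *\<^sub>R rot l) \<longleftrightarrow>
        (wedge l m > 0 \<longrightarrow> chord_bound d' l m \<le> x) \<and> (wedge l m < 0 \<longrightarrow> x \<le> chord_bound d' l m)"
      if "m \<in> L" for m
      using that inner[of m x]
      by (cases "wedge l m" "0::real" rule: linorder_cases) (simp_all add: mult_le_cancel_right)
    moreover have "l \<bullet> (foot + x *\<^sub>R rot l) = d' l" by (simp add: inner_add_right lfoot)
    ultimately have "foot + x *\<^sub>R rot l \<in> side L d' l \<longleftrightarrow>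
        (\<forall>m\<in>L. wedge l m > 0 \<longrightarrow> chord_bound d' l m \<le> x) \<and> (\<forall>m\<in>L. wedge l m < 0 \<longrightarrow> x \<le> chord_bound d' l m)"
      unfolding side_def cut_def by blast
    also have "\<dots> \<longleftrightarrow> lo \<le> x \<and> x \<le> hi"
      unfolding lo_def hi_def using chord_normals_nonempty[OF l] finite_normals
      by (subst Max_le_iff, simp, simp, subst Min_ge_iff) auto
    finally show ?thesis .
  qed
  have on_line: "\<exists>x. p = foot + x *\<^sub>R rot l" if "p \<in> side L d' l" for p
  proof -
    have "l \<bullet> (p - foot) = 0" using that by (simp add: side_def inner_diff_right lfoot)
    then show ?thesis
      using orthogonal_imp_multiple_rot prim primitive_vecD(2) by (metis add.commute diff_add_cancel)
  qed
  show ?thesis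
  proof (cases "lo \<le> hi")
    case True
    have "side L d' l = closed_segment (foot + lo *\<^sub>R rot l) ((foot + lo *\<^sub>R rot l) + (hi - lo) *\<^sub>R rot l)"
      (is "_ = closed_segment ?a ?b")
    proof (intro equalityI subsetI)
      fix p assume p: "p \<in> side L d' l"
      then obtain x where x: "p = foot + x *\<^sub>R rot l" using on_line by blast
      then have lx: "lo \<le> x" "x \<le> hi" using p mem by auto
      show "p \<in> closed_segment ?a ?b"
      proof (cases "lo = hi")
        case True
        then show ?thesis using lx x by simp
      next
        case False
        define u where "u = (x - lo) / (hi - lo)"
        have u: "x = lo + u * (hi - lo)" "0 \<le> u" "u \<le> 1"
          using False lx by (simp_all add: u_def divide_simps)
        have "p = (1 - u) *\<^sub>R ?a + u *\<^sub>R ?b"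
          unfolding x u(1) by (simp add: algebra_simps)
        then show ?thesis using u unfolding in_segment by blast
      qed
    next
      fix p assume "p \<in> closed_segment ?a ?b"
      then obtain u where u: "0 \<le> u" "u \<le> 1" "p = (1 - u) *\<^sub>R ?a + u *\<^sub>R ?b" by (auto simp: in_segment)
      define w where "w = u * (hi - lo)"
      have p: "p = foot + (lo + w) *\<^sub>R rot l" using u(3) by (simp add: w_def algebra_simps)
      have "w \<ge> 0" using u True by (simp add: w_def)
      moreover have "w \<le> 1 * (hi - lo)"
        unfolding w_def using u True by (intro mult_right_mono) auto
      ultimately show "p \<in> side L d' l" unfolding p mem by simp
    qed
    then have "tropical_length (side L d' l) = hi - lo"
      using tropical_length_closed_segment[OF primitive_rot[OF prim], of "hi - lo"] True by simp
    then show ?thesis using True by (simp add: chord_def lo_def hi_def)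
  next
    case False
    then have "side L d' l = {}" using on_line mem by fastforce
    then have "tropical_length (side L d' l) = 0" by (simp add: tropical_length_def)
    then show ?thesis using False by (simp add: chord_def lo_def hi_def)
  qed
qed

end

section \<open>The moving polygon\<close>

lemma tropical_length_degenerate:
  assumes "\<And>p q. p \<in> S \<Longrightarrow> q \<in> S \<Longrightarrow> p = q"
  shows "tropical_length S = 0"
proof -
  have "S = {} \<or> (\<exists>p. S = {p})" using assms by blast
  then show ?thesis by (auto simp: tropical_length_def)
qed

text \<open>The ends may or may not belong to \<open>S\<close>, which is all that integration
  requires. For an empty or one-point set the two ends coincide.\<close>

lemma is_interval_bounds:
  fixes S :: "real set"
  assumes "is_interval S" "bounded S"
  shows "\<exists>a b. a \<le> b \<and> {a<..<b} \<subseteq> S \<and> S \<subseteq> {a..b}"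
proof (cases "S = {}")
  case True
  then show ?thesis by (intro exI[of _ 0]) auto
next
  case False
  have bdd: "bdd_below S" "bdd_above S"
    by (rule bounded_imp_bdd_below[OF assms(2)], rule bounded_imp_bdd_above[OF assms(2)])
  have sub: "S \<subseteq> {Inf S..Sup S}" using bdd by (auto intro: cInf_lower cSup_upper)
  moreover have "{Inf S<..<Sup S} \<subseteq> S"
  proof
    fix x assume "x \<in> {Inf S<..<Sup S}"
    then obtain y z where "y \<in> S" "y < x" "z \<in> S" "x < z"
      using cInf_less_iff[OF False bdd(1)] less_cSup_iff[OF False bdd(2)] by auto
    then show "x \<in> S" using assms(1) mem_is_interval_1_I[of S y z x] by auto
  qed
  moreover have "Inf S \<le> Sup S" using sub False by fastforce
  ultimately show ?thesis by blast
qed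

lemma continuous_on_Max_image:
  fixes f :: "'i \<Rightarrow> 'a::topological_space \<Rightarrow> real"
  assumes "finite I" "I \<noteq> {}" "\<And>i. i \<in> I \<Longrightarrow> continuous_on S (f i)"
  shows "continuous_on S (\<lambda>x. Max ((\<lambda>i. f i x) ` I))"
  using assms
proof (induction I rule: finite_ne_induct)
  case (insert i I)
  then have "(\<lambda>x. Max ((\<lambda>i. f i x) ` insert i I)) = (\<lambda>x. max (f i x) (Max ((\<lambda>i. f i x) ` I)))"
    by simp
  then show ?case using insert by (auto intro: continuous_on_max)
qed simp

lemma continuous_on_Min_image:
  fixes f :: "'i \<Rightarrow> 'a::topological_space \<Rightarrow> real"
  assumes "finite I" "I \<noteq> {}" "\<And>i. i \<in> I \<Longrightarrow> continuous_on S (f i)"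
  shows "continuous_on S (\<lambda>x. Min ((\<lambda>i. f i x) ` I))"
  using assms
proof (induction I rule: finite_ne_induct)
  case (insert i I)
  then have "(\<lambda>x. Min ((\<lambda>i. f i x) ` insert i I)) = (\<lambda>x. min (f i x) (Min ((\<lambda>i. f i x) ` I)))"
    by simp
  then show ?case using insert by (auto intro: continuous_on_min)
qed simp

lemma has_integral_indicator_Ioo:
  fixes p q s t :: real
  assumes "p \<le> q" "{p<..<q} \<subseteq> {s..t}"
  shows "(indicator {p<..<q} has_integral q - p) {s..t}"
proof -
  have "((\<lambda>x. 1 :: real) has_integral q - p) {p<..<q}"
    using has_integral_const_real[of "1::real" p q] assms(1) by (simp add: has_integral_Icc_iff_Ioo)
  then have "((\<lambda>x. if x \<in> {p<..<q} then 1 else 0 :: real) has_integral q - p) {s..t}"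
    by (subst has_integral_restrict[OF assms(2)])
  then show ?thesis by (simp add: indicator_def[abs_def] of_bool_def)
qed

text \<open>\<open>T\<close> is the maximum over \<open>x\<close> of the least slack
  \<open>l \<bullet> x - d l\<close>. Empty cones are demanded only strictly between 0 and
  \<open>T\<close>: at time 0, the cone at a vertex of a rational polygon may well contain a
  covector below the segment, which then gives rise to a new side.\<close>

locale shrinking_polygon =
  fixes L :: "(real^2) set" and d :: "real^2 \<Rightarrow> real" and T :: real
  assumes fin: "finite L"
    and prim: "\<And>l. l \<in> L \<Longrightarrow> primitive_vec l"
    and bounded_start: "bounded (cut L d)"
    and T_pos: "T > 0"
    and top_point: "\<exists>x. \<forall>l\<in>L. d l + T \<le> l \<bullet> x"
    and top_maximal: "\<And>x. \<exists>l\<in>L. l \<bullet> x \<le> d l + T"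
    and empty_cones: "\<And>t l m x \<alpha> \<beta>. 0 < t \<Longrightarrow> t < T \<Longrightarrow> (l, m) \<in> corners L (\<lambda>l. d l + t) \<Longrightarrow>
      primitive_vec x \<Longrightarrow> \<alpha> \<ge> 0 \<Longrightarrow> \<beta> \<ge> 0 \<Longrightarrow> x = \<alpha> *\<^sub>R l + \<beta> *\<^sub>R m \<Longrightarrow> \<alpha> + \<beta> \<ge> 1"
begin

abbreviation dt :: "real \<Rightarrow> real^2 \<Rightarrow> real" where
  "dt t \<equiv> (\<lambda>l. d l + t)"

lemma polygon_at:
  assumes "0 \<le> t" "t < T"
  shows "lattice_polygon L (dt t)"
proof
  have "cut L (dt t) \<subseteq> cut L d" using assms by (force simp: cut_def)
  then show "bounded (cut L (dt t))" using bounded_start bounded_subset by blast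
  obtain x where "\<forall>l\<in>L. d l + T \<le> l \<bullet> x" using top_point by blast
  then have "\<forall>l\<in>L. d l + t < l \<bullet> x" using assms by force
  then show "\<exists>x. \<forall>l\<in>L. d l + t < l \<bullet> x" by blast
qed (use fin prim in auto)

sublocale start: lattice_polygon L d
  using polygon_at[of 0] T_pos by simp

section \<open>Trajectories of the corners\<close>

definition vertex :: "real^2 \<Rightarrow> real^2 \<Rightarrow> real \<Rightarrow> real^2" where
  "vertex l m t = intersection_point (dt t) l m"

definition velocity :: "real^2 \<Rightarrow> real^2 \<Rightarrow> real^2" where
  "velocity l m = (1 / wedge l m) *\<^sub>R (rot l - rot m)"

lemma vertex_affine: "vertex l m t = vertex l m 0 + t *\<^sub>R velocity l m"
  by (simp add: vertex_def velocity_def intersection_point_def algebra_simps)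

lemma vertex_inner:
  assumes "wedge l m \<noteq> 0"
  shows "l \<bullet> vertex l m t = d l + t" "m \<bullet> vertex l m t = d m + t"
  unfolding vertex_def using intersection_point_inner[OF assms, of "dt t"] by simp_all

definition lifetime :: "real^2 \<Rightarrow> real^2 \<Rightarrow> real set" where
  "lifetime l m = {t. 0 < t \<and> t < T \<and> (l, m) \<in> corners L (dt t)}"

lemma corner_at_vertex:
  assumes "(l, m) \<in> corners L (dt t)"
  shows "corner_at L (dt t) (vertex l m t) l m"
  using assms corner_at_eq_intersection_point unfolding corners_def vertex_def by fastforce

lemma lifetime_corner_at:
  "t \<in> lifetime l m \<Longrightarrow> corner_at L (dt t) (vertex l m t) l m"
  by (simp add: lifetime_def corner_at_vertex)

lemma corner_at_lifetime:
  assumes "corner_at L (dt t) p l m" "0 < t" "t < T"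
  shows "t \<in> lifetime l m" "p = vertex l m t"
  using assms corner_at_eq_intersection_point unfolding corners_def lifetime_def vertex_def by blast+

lemma lifetime_normals:
  assumes "t \<in> lifetime l m"
  shows "l \<in> L" "m \<in> L" "wedge l m > 0"
  using lifetime_corner_at[OF assms] by (auto simp: corner_at_def active_def)

text \<open>That the cone of \<open>l\<close> and \<open>m\<close> contains all active normals is
  rephrased as strict slack for the normals outside it. All conditions are then affine inequalities
  in \<open>t\<close>.\<close>

lemma mem_lifetime_iff:
  assumes "l \<in> L" "m \<in> L" "wedge l m > 0"
  shows "t \<in> lifetime l m \<longleftrightarrow> 0 < t \<and> t < T \<and> (\<forall>x\<in>L. d x + t \<le> x \<bullet> vertex l m t) \<and>
    (\<forall>x\<in>{x \<in> L. wedge l x < 0 \<or> wedge x m < 0}. d x + t < x \<bullet> vertex l m t)"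
  (is "_ \<longleftrightarrow> ?R")
proof
  assume t: "t \<in> lifetime l m"
  have c: "vertex l m t \<in> cut L (dt t)"
    "\<And>x. x \<in> active L (dt t) (vertex l m t) \<Longrightarrow> wedge l x \<ge> 0 \<and> wedge x m \<ge> 0"
    using lifetime_corner_at[OF t] by (auto simp: corner_at_def)
  have le: "d x + t \<le> x \<bullet> vertex l m t" if "x \<in> L" for x
    using c(1) that by (simp add: cut_def)
  moreover have "d x + t < x \<bullet> vertex l m t" if "x \<in> L" "wedge l x < 0 \<or> wedge x m < 0" for x
    using le[OF that(1)] c(2)[of x] that by (force simp: active_def)
  ultimately show ?R using t by (simp add: lifetime_def)
next
  assume R: ?R
  have "corner_at L (dt t) (vertex l m t) l m"
    unfolding corner_at_def
  proof (intro conjI ballI)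
    fix x assume "x \<in> active L (dt t) (vertex l m t)"
    then have x: "x \<in> L" "x \<bullet> vertex l m t = d x + t" by (auto simp: active_def)
    then show "wedge l x \<ge> 0" "wedge x m \<ge> 0" using R by force+
  qed (use R assms vertex_inner[of l m t] in \<open>auto simp: cut_def active_def\<close>)
  then show "t \<in> lifetime l m" using R corner_at_lifetime(1) by blast
qed

text \<open>An affine slack that is nonnegative, or positive, at two times is so in between.\<close>

lemma is_interval_lifetime: "is_interval (lifetime l m)"
proof (cases "l \<in> L \<and> m \<in> L \<and> wedge l m > 0")
  case True
  then have iff: "\<And>t. t \<in> lifetime l m \<longleftrightarrow> 0 < t \<and> t < T \<and> (\<forall>x\<in>L. d x + t \<le> x \<bullet> vertex l m t) \<and>
    (\<forall>x\<in>{x \<in> L. wedge l x < 0 \<or> wedge x m < 0}. d x + t < x \<bullet> vertex l m t)"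
    using mem_lifetime_iff by blast
  have slack: "x \<bullet> vertex l m t - (d x + t) = (x \<bullet> vertex l m 0 - d x) + t * (x \<bullet> velocity l m - 1)" for x t
    by (subst vertex_affine) (simp add: inner_add_right algebra_simps)
  have comb: "\<exists>u\<ge>0. \<exists>v\<ge>0. u + v = 1 \<and> t = u * r + v * s" if "r \<le> t" "t \<le> s" for r s t :: real
  proof -
    have "t \<in> closed_segment r s" using that by (simp add: closed_segment_eq_real_ivl)
    then obtain u where "0 \<le> u" "u \<le> 1" "t = (1 - u) * r + u * s" by (auto simp: in_segment)
    then show ?thesis by (intro exI[of _ "1 - u"] exI[of _ u] conjI) auto
  qed
  show ?thesis
    unfolding is_interval_1
  proof (intro ballI allI impI)
    fix r s t assume rs: "r \<in> lifetime l m" "s \<in> lifetime l m" and t: "r \<le> t \<and> t \<le> s"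
    then obtain u v where uv: "u \<ge> 0" "v \<ge> 0" "u + v = 1" "t = u * r + v * s" using comb by blast
    define f where "f x t = x \<bullet> vertex l m t - (d x + t)" for x t
    have f: "f x t = u * f x r + v * f x s" for x
    proof -
      have "u * f x r + v * f x s = (u + v) * (x \<bullet> vertex l m 0 - d x) + (u * r + v * s) * (x \<bullet> velocity l m - 1)"
        unfolding f_def slack by (simp add: algebra_simps)
      then show ?thesis unfolding f_def slack uv(3) uv(4)[symmetric] by simp
    qed
    have "f x t \<ge> 0" if "x \<in> L" for x
      using rs uv that unfolding f by (intro add_nonneg_nonneg mult_nonneg_nonneg) (auto simp: iff f_def)
    moreover have "f x t > 0" if "x \<in> L" "wedge l x < 0 \<or> wedge x m < 0" for x
    proof -
      have "f x r > 0" "f x s > 0" using rs that by (auto simp: iff f_def)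
      then have "u * f x r \<ge> 0" "v * f x s \<ge> 0" "u * f x r > 0 \<or> v * f x s > 0"
        using uv by (auto simp: zero_less_mult_iff)
      then show ?thesis unfolding f by linarith
    qed
    moreover have "0 < t" "t < T" using rs t by (auto simp: lifetime_def)
    ultimately show "t \<in> lifetime l m" unfolding iff f_def by auto
  qed
next
  case False
  then have "lifetime l m = {}" using lifetime_normals by blast
  then show ?thesis by simp
qed

text \<open>If the lifetime is empty, any choice has equal components, so that a pair which never
  forms a corner contributes nothing.\<close>

definition birth_death :: "real^2 \<Rightarrow> real^2 \<Rightarrow> real \<times> real" where
  "birth_death l m = (SOME x. fst x \<le> snd x \<and> {fst x<..<snd x} \<subseteq> lifetime l m \<and> lifetime l m \<subseteq> {fst x..snd x})"

definition birth :: "real^2 \<Rightarrow> real^2 \<Rightarrow> real" where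
  "birth l m = fst (birth_death l m)"

definition death :: "real^2 \<Rightarrow> real^2 \<Rightarrow> real" where
  "death l m = snd (birth_death l m)"

lemma lifetime_bounds:
  "birth l m \<le> death l m" "{birth l m<..<death l m} \<subseteq> lifetime l m" "lifetime l m \<subseteq> {birth l m..death l m}"
proof -
  have "bounded (lifetime l m)"
    by (rule bounded_subset[of "{0..T}"]) (auto simp: lifetime_def)
  then have "\<exists>x. fst x \<le> snd x \<and> {fst x<..<snd x} \<subseteq> lifetime l m \<and> lifetime l m \<subseteq> {fst x..snd x}"
    using is_interval_bounds[OF is_interval_lifetime] by auto
  from someI_ex[OF this] show "birth l m \<le> death l m" "{birth l m<..<death l m} \<subseteq> lifetime l m"
    "lifetime l m \<subseteq> {birth l m..death l m}"
    by (simp_all add: birth_def death_def birth_death_def)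
qed

definition event_times :: "real set" where
  "event_times = (\<lambda>(l, m). birth l m) ` (L \<times> L) \<union> (\<lambda>(l, m). death l m) ` (L \<times> L)"

lemma finite_event_times: "finite event_times"
  using fin by (simp add: event_times_def)

lemma lifetime_iff_between:
  assumes "t \<notin> event_times" "l \<in> L" "m \<in> L"
  shows "t \<in> lifetime l m \<longleftrightarrow> t \<in> {birth l m<..<death l m}"
proof -
  have "t \<noteq> birth l m" "t \<noteq> death l m" using assms by (force simp: event_times_def)+
  then show ?thesis using lifetime_bounds[of l m] by fastforce
qed

lemma corners_eq_lifetime:
  assumes "0 < t" "t < T"
  shows "corners L (dt t) = {(l, m) \<in> L \<times> L. t \<in> lifetime l m}"
  using assms lifetime_normals by (auto simp: lifetime_def)

text \<open>Away from birth and death times, being alive means lying in an open interval, and not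
  being alive means lying in the open complement of its closure; finitely many such conditions
  persist together.\<close>

lemma corners_locally_constant:
  assumes "0 < t" "t < T" "t \<notin> event_times"
  shows "\<forall>\<^sub>F s in nhds t. 0 < s \<and> s < T \<and> corners L (dt s) = corners L (dt t)"
proof -
  have "open ({0<..<T} - event_times)" 
    by (intro open_Diff finite_imp_closed finite_event_times open_greaterThanLessThan)
  then have "\<forall>\<^sub>F s in nhds t. s \<in> {0<..<T} - event_times" using assms by (intro eventually_nhds_in_open) auto
  moreover have "\<forall>\<^sub>F s in nhds t. \<forall>x\<in>L \<times> L. s \<in> {birth (fst x) (snd x)<..<death (fst x) (snd x)} \<longleftrightarrow>
      t \<in> {birth (fst x) (snd x)<..<death (fst x) (snd x)}"
  proof (rule eventually_ball_finite; (intro ballI)?)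
    fix x assume x: "x \<in> L \<times> L"
    define a b where "a = birth (fst x) (snd x)" and "b = death (fst x) (snd x)"
    have ne: "t \<noteq> a" "t \<noteq> b" using x assms by (auto simp: event_times_def a_def b_def)
    show "\<forall>\<^sub>F s in nhds t. s \<in> {birth (fst x) (snd x)<..<death (fst x) (snd x)} \<longleftrightarrow>
      t \<in> {birth (fst x) (snd x)<..<death (fst x) (snd x)}"
      unfolding a_def[symmetric] b_def[symmetric]
    proof (cases "t \<in> {a<..<b}")
      case True
      then have "\<forall>\<^sub>F s in nhds t. s \<in> {a<..<b}" by (intro eventually_nhds_in_open) auto
      then show "\<forall>\<^sub>F s in nhds t. s \<in> {a<..<b} \<longleftrightarrow> t \<in> {a<..<b}" using True by simp
    next
      case False
      then have "t \<in> {..<a} \<union> {b<..}" using ne by auto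
      then have "\<forall>\<^sub>F s in nhds t. s \<in> {..<a} \<union> {b<..}" by (intro eventually_nhds_in_open) auto
      then show "\<forall>\<^sub>F s in nhds t. s \<in> {a<..<b} \<longleftrightarrow> t \<in> {a<..<b}"
        by (rule eventually_mono) (use False in auto)
    qed
  qed (use fin in simp)
  ultimately show ?thesis
  proof eventually_elim
    case (elim s)
    then have s: "0 < s" "s < T" "s \<notin> event_times" by auto
    have "s \<in> lifetime l m \<longleftrightarrow> t \<in> lifetime l m" if "l \<in> L" "m \<in> L" for l m
      using elim that lifetime_iff_between[OF s(3) that] lifetime_iff_between[OF assms(3) that] by force
    then show ?case using s assms corners_eq_lifetime by auto
  qed
qed

section \<open>The perimeter as a function of time\<close>

definition perimeter :: "real \<Rightarrow> real" where
  "perimeter t = (\<Sum>l\<in>L. start.chord (dt t) l)"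

lemma cut_nonempty: "t \<le> T \<Longrightarrow> cut L (dt t) \<noteq> {}"
proof -
  assume "t \<le> T"
  obtain x where "\<forall>l\<in>L. d l + T \<le> l \<bullet> x" using top_point by blast
  then have "x \<in> cut L (dt t)" using \<open>t \<le> T\<close> by (force simp: cut_def)
  then show ?thesis by blast
qed

lemma perimeter_eq_sides:
  "t \<le> T \<Longrightarrow> perimeter t = (\<Sum>l\<in>L. tropical_length (side L (dt t) l))"
  unfolding perimeter_def using start.tropical_length_side_eq_chord cut_nonempty by (simp cong: sum.cong)

lemma perimeter_eq_side_normals:
  assumes "t \<le> T"
  shows "perimeter t = (\<Sum>l\<in>side_normals L (dt t). tropical_length (side L (dt t) l))"
  unfolding perimeter_eq_sides[OF assms]
proof (rule sum.mono_neutral_right[OF fin])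
  show "\<forall>l\<in>L - side_normals L (dt t). tropical_length (side L (dt t) l) = 0"
    by (auto simp: side_normals_def intro!: tropical_length_degenerate)
qed (auto simp: side_normals_def)

lemma perimeter_eq_boundary_length:
  assumes "0 \<le> t" "t < T"
  shows "polygon_boundary_length (cut L (dt t)) = perimeter t"
  using lattice_polygon.polygon_boundary_length_cut[OF polygon_at[OF assms]]
    perimeter_eq_side_normals assms by simp

lemma perimeter_eq_corners:
  assumes "0 \<le> t" "t < T"
  shows "perimeter t = (\<Sum>(l, m)\<in>corners L (dt t). (rot eta \<bullet> vertex l m t) * (1 / (m \<bullet> eta) - 1 / (l \<bullet> eta)))"
  using lattice_polygon.sum_tropical_length_sides[OF polygon_at[OF assms]]
    perimeter_eq_side_normals assms by (simp add: vertex_def)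

text \<open>Each chord is built from affine functions of \<open>t\<close> by minima and maxima over
  index sets that do not depend on \<open>t\<close>. So no case distinction arises when a side
  disappears.\<close>

lemma continuous_on_perimeter: "continuous_on S perimeter"
proof -
  have "continuous_on S (\<lambda>t. start.chord_bound (dt t) l m)" for l m
    unfolding start.chord_bound_def divide_inverse by (intro continuous_intros)
  then have "continuous_on S (\<lambda>t. start.chord (dt t) l)" if "l \<in> L" for l
    unfolding start.chord_def using start.chord_normals_nonempty[OF that] fin
    by (intro continuous_on_max continuous_on_diff continuous_on_const continuous_on_Max_image
        continuous_on_Min_image) auto
  then show ?thesis unfolding perimeter_def by (intro continuous_on_sum)
qed

lemma mem_corners_normals:
  assumes "(l, m) \<in> corners L (dt t)"
  shows "l \<in> L" "m \<in> L" "wedge l m > 0"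
  using assms by (auto simp: corners_def corner_at_def active_def)

lemma perimeter_has_derivative:
  assumes t: "0 < t" "t < T" "t \<notin> event_times"
  shows "(perimeter has_vector_derivative (\<Sum>(l, m)\<in>corners L (dt t). wedge l m) - 12) (at t)"
proof -
  let ?C = "corners L (dt t)"
  let ?k = "\<lambda>l m. 1 / (m \<bullet> eta) - 1 / (l \<bullet> eta)"
  have finC: "finite ?C" using lattice_polygon.finite_corners polygon_at t by simp
  have deriv: "((\<lambda>s. \<Sum>(l, m)\<in>?C. (rot eta \<bullet> vertex l m s) * ?k l m) has_vector_derivative
    (\<Sum>(l, m)\<in>?C. (rot eta \<bullet> velocity l m) * ?k l m)) (at t)"
  proof -
    have "((\<lambda>s. (rot eta \<bullet> vertex l m s) * ?k l m) has_vector_derivative (rot eta \<bullet> velocity l m) * ?k l m) (at t)"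
      for l m
    proof -
      have "(\<lambda>s. (rot eta \<bullet> vertex l m s) * ?k l m) =
        (\<lambda>s. (rot eta \<bullet> vertex l m 0 + s * (rot eta \<bullet> velocity l m)) * ?k l m)"
        by (rule ext, subst vertex_affine) (simp add: inner_add_right)
      then show ?thesis
        unfolding has_real_derivative_iff_has_vector_derivative[symmetric]
        by (auto intro!: derivative_eq_intros)
    qed
    then show ?thesis by (auto intro!: has_vector_derivative_sum simp: case_prod_beta)
  qed
  \<comment> \<open>Corner by corner, the rate of change of the perimeter is the weight minus the
    share of the corner in the 12.\<close>
  have "(rot eta \<bullet> velocity l m) * ?k l m = wedge l m -
      (wedge l m + (2 - (l \<bullet> eta) / (m \<bullet> eta) - (m \<bullet> eta) / (l \<bullet> eta)) / wedge l m)"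
    if lm: "(l, m) \<in> ?C" for l m
  proof -
    have *: "l \<bullet> eta \<noteq> 0" "m \<bullet> eta \<noteq> 0" "wedge l m > 0"
      using mem_corners_normals[OF lm] start.inner_eta_neq_0 by auto
    have "rot eta \<bullet> velocity l m = (l \<bullet> eta - m \<bullet> eta) / wedge l m"
      by (simp add: velocity_def inner2 algebra_simps diff_divide_distrib add_divide_distrib)
    moreover have "(a - b) / w * (1 / b - 1 / a) = w - (w + (2 - a / b - b / a) / w)"
      if "a \<noteq> 0" "b \<noteq> 0" "w > 0" for a b w :: real
      using that by (simp add: field_simps)
    ultimately show ?thesis using * by simp
  qed
  then have "(\<Sum>(l, m)\<in>?C. (rot eta \<bullet> velocity l m) * ?k l m) = (\<Sum>(l, m)\<in>?C. wedge l m) -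
      (\<Sum>(l, m)\<in>?C. wedge l m + (2 - (l \<bullet> eta) / (m \<bullet> eta) - (m \<bullet> eta) / (l \<bullet> eta)) / wedge l m)"
    unfolding sum_subtractf[symmetric] by (intro sum.cong) (auto simp: case_prod_beta)
  also have "(\<Sum>(l, m)\<in>?C. wedge l m + (2 - (l \<bullet> eta) / (m \<bullet> eta) - (m \<bullet> eta) / (l \<bullet> eta)) / wedge l m) = 12"
    using polygon_at[of t] t by (intro lattice_polygon.sum_corners_eq_12) (auto intro: empty_cones)
  finally have rate: "(\<Sum>(l, m)\<in>?C. (rot eta \<bullet> velocity l m) * ?k l m) = (\<Sum>(l, m)\<in>?C. wedge l m) - 12" .
  have "\<forall>\<^sub>F s in nhds t. (\<Sum>(l, m)\<in>?C. (rot eta \<bullet> vertex l m s) * ?k l m) = perimeter s"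
    using corners_locally_constant[OF t]
    by eventually_elim (simp add: perimeter_eq_corners)
  then obtain U where U: "open U" "t \<in> U"
    "\<And>s. s \<in> U \<Longrightarrow> (\<Sum>(l, m)\<in>?C. (rot eta \<bullet> vertex l m s) * ?k l m) = perimeter s"
    unfolding eventually_nhds by blast
  show ?thesis
    by (rule has_vector_derivative_transform_within_open[OF deriv[unfolded rate] U])
qed

text \<open>The fundamental theorem tolerates the finitely many event times, because the perimeter
  is continuous there.\<close>

lemma has_integral_corner_weights:
  assumes "0 \<le> s" "s \<le> T"
  shows "((\<lambda>t. (\<Sum>(l, m)\<in>corners L (dt t). wedge l m) - 12) has_integral perimeter T - perimeter s) {s..T}"
proof (rule fundamental_theorem_of_calculus_interior_strong[OF finite_event_times])
  fix t assume "t \<in> {s<..<T} - event_times"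
  then show "(perimeter has_vector_derivative (\<Sum>(l, m)\<in>corners L (dt t). wedge l m) - 12) (at t)"
    using assms by (intro perimeter_has_derivative) auto
qed (use assms continuous_on_perimeter in auto)

text \<open>The derivative of \<open>perimeter t + 12 * t\<close> is the sum of the weights, which
  is nonnegative.\<close>

lemma perimeter_mono:
  assumes "0 \<le> s" "s \<le> t" "t \<le> T"
  shows "perimeter s + 12 * s \<le> perimeter t + 12 * t"
proof -
  have 1: "((\<lambda>t. (\<Sum>(l, m)\<in>corners L (dt t). wedge l m) - 12) has_integral perimeter t - perimeter s) {s..t}"
  proof (rule fundamental_theorem_of_calculus_interior_strong[OF finite_event_times])
    fix r assume "r \<in> {s<..<t} - event_times"
    then show "(perimeter has_vector_derivative (\<Sum>(l, m)\<in>corners L (dt r). wedge l m) - 12) (at r)"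
      using assms by (intro perimeter_has_derivative) auto
  qed (use assms continuous_on_perimeter in auto)
  have 2: "((\<lambda>t. - 12) has_integral - 12 * (t - s)) {s..t}"
    using has_integral_const_real[of "- 12 :: real" s t] assms by (simp add: algebra_simps)
  have "(\<Sum>(l, m)\<in>corners L (dt r). wedge l m) \<ge> 0" for r
    by (rule sum_nonneg) (use mem_corners_normals(3) in \<open>force intro: less_imp_le\<close>)
  then have "- 12 * (t - s) \<le> perimeter t - perimeter s"
    by (intro has_integral_le[OF 2 1]) simp
  then show ?thesis by simp
qed

text \<open>The integral of the sum of weights is taken pair by pair: outside finitely many times, a
  pair is a corner exactly when \<open>t\<close> lies between its birth and death, so it contributes
  its weight times its duration. Pairs in the wrong rotational order get the factor 0.\<close>

lemma total_weighted_lifetime: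
  "(\<Sum>(l, m)\<in>L \<times> L. max 0 (wedge l m) * (death l m - birth l m)) - 12 * T = perimeter T - perimeter 0"
proof -
  have sub: "{birth l m<..<death l m} \<subseteq> {0..T}" for l m
    using lifetime_bounds(2)[of l m] by (force simp: lifetime_def)
  have ind: "(indicator {birth l m<..<death l m} has_integral death l m - birth l m) {0..T}" for l m
    by (rule has_integral_indicator_Ioo[OF lifetime_bounds(1) sub])
  have main: "((\<lambda>t. (\<Sum>(l, m)\<in>L \<times> L. max 0 (wedge l m) * indicator {birth l m<..<death l m} t) - 12) has_integral
    (\<Sum>(l, m)\<in>L \<times> L. max 0 (wedge l m) * (death l m - birth l m)) - 12 * T) {0..T}"
  proof (intro has_integral_diff)
    show "((\<lambda>t. \<Sum>(l, m)\<in>L \<times> L. max 0 (wedge l m) * indicator {birth l m<..<death l m} t) has_integral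
      (\<Sum>(l, m)\<in>L \<times> L. max 0 (wedge l m) * (death l m - birth l m))) {0..T}"
      unfolding case_prod_beta using ind fin by (intro has_integral_sum has_integral_mult_right) auto
    show "((\<lambda>t. 12) has_integral 12 * T) {0..T}"
      using has_integral_const_real[of "12 :: real" 0 T] T_pos by (simp add: mult.commute)
  qed
  have generic: "(\<Sum>(l, m)\<in>L \<times> L. max 0 (wedge l m) * indicator {birth l m<..<death l m} t) =
    (\<Sum>(l, m)\<in>corners L (dt t). wedge l m)" if t: "t \<in> {0..T} - (event_times \<union> {0, T})" for t
  proof -
    have t': "0 < t" "t < T" "t \<notin> event_times" using t by auto
    have "(\<Sum>(l, m)\<in>corners L (dt t). wedge l m) = (\<Sum>(l, m)\<in>corners L (dt t). max 0 (wedge l m) * indicator {birth l m<..<death l m} t)"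
    proof (rule sum.cong[OF refl], clarify)
      fix l m assume lm: "(l, m) \<in> corners L (dt t)"
      note n = mem_corners_normals[OF lm]
      have "t \<in> lifetime l m" using lm t' by (simp add: lifetime_def)
      then show "wedge l m = max 0 (wedge l m) * indicator {birth l m<..<death l m} t"
        using n lifetime_iff_between[OF t'(3) n(1,2)] by simp
    qed
    also have "\<dots> = (\<Sum>(l, m)\<in>L \<times> L. max 0 (wedge l m) * indicator {birth l m<..<death l m} t)"
    proof (rule sum.mono_neutral_left)
      show "\<forall>x\<in>L \<times> L - corners L (dt t). (case x of (l, m) \<Rightarrow> max 0 (wedge l m) * indicator {birth l m<..<death l m} t) = 0"
      proof clarify
        fix l m assume "l \<in> L" "m \<in> L" "(l, m) \<notin> corners L (dt t)"
        then have "t \<notin> {birth l m<..<death l m}"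
          using lifetime_iff_between[OF t'(3), of l m] by (auto simp: lifetime_def)
        then show "max 0 (wedge l m) * indicator {birth l m<..<death l m} t = 0" by simp
      qed
    qed (use fin mem_corners_normals in auto)
    finally show ?thesis by simp
  qed
  have "((\<lambda>t. (\<Sum>(l, m)\<in>corners L (dt t). wedge l m) - 12) has_integral
    (\<Sum>(l, m)\<in>L \<times> L. max 0 (wedge l m) * (death l m - birth l m)) - 12 * T) {0..T}"
  proof (rule has_integral_spike_finite[OF _ _ main])
    show "finite (event_times \<union> {0, T})" using finite_event_times by simp
  qed (simp only: generic)
  moreover have "((\<lambda>t. (\<Sum>(l, m)\<in>corners L (dt t). wedge l m) - 12) has_integral perimeter T - perimeter 0) {0..T}"
    using has_integral_corner_weights[of 0] T_pos by simp
  ultimately show ?thesis by (rule has_integral_unique)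
qed

end

section \<open>The polygon at the final time\<close>

context shrinking_polygon
begin

lemma compact_cut_at: "t \<ge> 0 \<Longrightarrow> compact (cut L (dt t))"
proof -
  assume "t \<ge> 0"
  then have "cut L (dt t) \<subseteq> cut L d" by (force simp: cut_def)
  then show ?thesis using bounded_start bounded_subset closed_cut compact_eq_bounded_closed by blast
qed

text \<open>A direction on which all active normals are positive gains slack for them at once, while
  the others keep theirs. At the final level this contradicts maximality.\<close>

lemma strict_perturbation:
  assumes "y \<in> cut L d'" "\<And>x. x \<in> active L d' y \<Longrightarrow> x \<bullet> v > 0"
  shows "\<exists>s. \<forall>x\<in>L. d' x < x \<bullet> (y + s *\<^sub>R v)"
proof -
  have "\<forall>\<^sub>F s in at_right 0. d' x < x \<bullet> (y + s *\<^sub>R v)" if x: "x \<in> L" for x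
  proof (cases "x \<bullet> y = d' x")
    case True
    then have "d' x < x \<bullet> (y + s *\<^sub>R v)" if "s > 0" for s
      using that x assms(2)[of x] by (simp add: active_def inner_add_right)
    then show ?thesis by (rule eventually_mono[OF eventually_at_right_less])
  next
    case False
    then have "d' x < x \<bullet> (y + 0 *\<^sub>R v)" using assms x by (force simp: cut_def)
    moreover have "((\<lambda>s. x \<bullet> (y + s *\<^sub>R v)) \<longlongrightarrow> x \<bullet> (y + 0 *\<^sub>R v)) (at_right 0)"
      by (intro tendsto_intros)
    ultimately show ?thesis by (intro order_tendstoD(1)) auto
  qed
  then have "\<forall>\<^sub>F s in at_right (0::real). \<forall>x\<in>L. d' x < x \<bullet> (y + s *\<^sub>R v)"
    by (intro eventually_ball_finite fin) auto
  then show ?thesis using eventually_happens'[OF trivial_limit_at_right_real] by blast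
qed

text \<open>At the final time a relatively interior point of the polygon has exactly the active normals
  \<open>\<plusminus>l\<close>: with an active \<open>l\<close> but not \<open>- l\<close>, one could still move along \<open>l\<close>.\<close>

lemma final_cases:
  obtains p where "cut L (dt T) = {p}"
  | l a c where "l \<in> L" "- l \<in> L" "c > 0" "cut L (dt T) = closed_segment a (a + c *\<^sub>R rot l)"
      "side L (dt T) l = cut L (dt T)" "side L (dt T) (- l) = cut L (dt T)"
proof (cases "\<exists>p. cut L (dt T) = {p}")
  case True
  then show ?thesis using that by blast
next
  case nonpoint: False
  let ?S = "cut L (dt T)"
  have ne: "?S \<noteq> {}" using cut_nonempty by blast
  obtain a0 b0 where ab: "a0 \<in> ?S" "b0 \<in> ?S" "a0 \<noteq> b0"
    using nonpoint ne by (metis is_singletonI' is_singleton_def)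
  obtain y where y: "y \<in> rel_interior ?S"
    using rel_interior_eq_empty[OF convex_cut[of L "dt T"]] ne by blast
  have yS: "y \<in> ?S" using y rel_interior_subset by blast
  \<comment> \<open>A constraint that is tight at a relatively interior point defines a face
    containing that point, hence the whole set.\<close>
  have sub: "?S \<subseteq> side L (dt T) x" if "x \<in> active L (dt T) y" for x
  proof -
    have "x \<in> L" "y \<in> side L (dt T) x" using that yS by (auto simp: active_def side_def)
    then show ?thesis using subset_of_face_of[OF side_face_of_cut subset_refl] y by blast
  qed
  obtain l where l: "l \<in> L" "l \<bullet> y \<le> d l + T" using top_maximal by blast
  then have act: "l \<in> active L (dt T) y" using yS by (force simp: active_def cut_def)
  have l0: "l \<noteq> 0" using prim[OF l(1)] primitive_vecD by blast
  have Sl: "side L (dt T) l = ?S" using sub[OF act] by (auto simp: side_def)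
  have pm: "x = l \<or> x = - l" if x: "x \<in> active L (dt T) y" for x
  proof -
    have "a0 \<in> side L (dt T) l" "b0 \<in> side L (dt T) l" "a0 \<in> side L (dt T) x" "b0 \<in> side L (dt T) x"
      using sub[OF act] sub[OF x] ab by blast+
    then have "l \<bullet> (b0 - a0) = 0" "x \<bullet> (b0 - a0) = 0"
      by (simp_all add: side_def inner_diff_right)
    then have "wedge l x = 0" using inner_determines_point[of l x b0 a0] ab by (auto simp: inner_diff_right)
    then show ?thesis using primitive_parallel prim l(1) x by (auto simp: active_def)
  qed
  have "- l \<in> active L (dt T) y"
  proof (rule ccontr)
    assume "- l \<notin> active L (dt T) y"
    then have "x \<bullet> l > 0" if "x \<in> active L (dt T) y" for x using pm[OF that] that l0 by auto
    then obtain s where "\<forall>x\<in>L. d x + T < x \<bullet> (y + s *\<^sub>R l)"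
      using strict_perturbation[OF yS] by blast
    then show False using top_maximal[of "y + s *\<^sub>R l"] by force
  qed
  then have ml: "- l \<in> L" "side L (dt T) (- l) = ?S"
    using sub[of "- l"] unfolding side_def active_def by blast+
  have "compact ?S" using compact_cut_at T_pos by simp
  moreover have "continuous_on ?S (\<lambda>x. rot l \<bullet> x)" by (intro continuous_intros)
  ultimately obtain a b where a: "a \<in> ?S" "\<And>x. x \<in> ?S \<Longrightarrow> rot l \<bullet> a \<le> rot l \<bullet> x"
    and b: "b \<in> ?S" "\<And>x. x \<in> ?S \<Longrightarrow> rot l \<bullet> x \<le> rot l \<bullet> b"
    using continuous_attains_inf[of ?S] continuous_attains_sup[of ?S] ne by metis
  have line: "\<exists>s. x = a + s *\<^sub>R rot l" if "x \<in> ?S" for x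
  proof -
    have "x \<in> side L (dt T) l" "a \<in> side L (dt T) l" using sub[OF act] that a(1) by blast+
    then have "l \<bullet> (x - a) = 0" by (simp add: side_def inner_diff_right)
    then obtain s where "x - a = s *\<^sub>R rot l" using orthogonal_imp_multiple_rot l0 by blast
    then show ?thesis by (metis add.commute diff_add_cancel)
  qed
  obtain c where c: "b = a + c *\<^sub>R rot l" using line b(1) by blast
  have pos: "rot l \<bullet> rot l > 0" using l0 by simp
  have range: "\<exists>s. x = a + s *\<^sub>R rot l \<and> 0 \<le> s \<and> s \<le> c" if x: "x \<in> ?S" for x
  proof -
    obtain s where s: "x = a + s *\<^sub>R rot l" using line x by blast
    have "0 \<le> s * (rot l \<bullet> rot l)" "s * (rot l \<bullet> rot l) \<le> c * (rot l \<bullet> rot l)"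
      using a(2)[OF x] b(2)[OF x] by (simp_all add: s c inner_add_right)
    then show ?thesis using pos s mult_le_cancel_right_pos zero_le_mult_iff[of s] by fastforce
  qed
  have "c > 0"
  proof (rule ccontr)
    assume "\<not> c > 0"
    then have "x = a" if "x \<in> ?S" for x using range[OF that] by force
    then show False using ab by metis
  qed
  have "?S = closed_segment a b"
  proof
    show "?S \<subseteq> closed_segment a b"
    proof
      fix x assume "x \<in> ?S"
      then obtain s where s: "x = a + s *\<^sub>R rot l" "0 \<le> s" "s \<le> c" using range by blast
      then have "x = (1 - s / c) *\<^sub>R a + (s / c) *\<^sub>R b"
        using \<open>c > 0\<close> by (simp add: c algebra_simps)
      then show "x \<in> closed_segment a b"
        using s \<open>c > 0\<close> unfolding in_segment by (intro exI[of _ "s / c"]) simp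
    qed
    show "closed_segment a b \<subseteq> ?S" using closed_segment_subset a b convex_cut by blast
  qed
  then show ?thesis using that(2) l(1) ml Sl \<open>c > 0\<close> c by blast
qed

text \<open>A final segment is counted twice, as the side of \<open>l\<close> and as the side of
  \<open>- l\<close>; all other sides have shrunk to points or are empty.\<close>

lemma perimeter_final: "perimeter T = 2 * tropical_length (cut L (dt T))"
proof (rule final_cases)
  fix p assume p: "cut L (dt T) = {p}"
  have "tropical_length (side L (dt T) l) = 0" for l
    using p by (intro tropical_length_degenerate) (auto simp: side_def)
  moreover have "tropical_length (cut L (dt T)) = 0"
    using p by (intro tropical_length_degenerate) auto
  ultimately show ?thesis by (simp add: perimeter_eq_sides)
next
  fix l a c assume l: "l \<in> L" "- l \<in> L" "c > 0" "cut L (dt T) = closed_segment a (a + c *\<^sub>R rot l)"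
    "side L (dt T) l = cut L (dt T)" "side L (dt T) (- l) = cut L (dt T)"
  have l0: "l \<noteq> 0" using prim[OF l(1)] primitive_vecD by blast
  have zero: "tropical_length (side L (dt T) x) = 0" if x: "x \<in> L - {l, - l}" for x
  proof (rule tropical_length_degenerate)
    fix p q assume pq: "p \<in> side L (dt T) x" "q \<in> side L (dt T) x"
    then have "p \<in> side L (dt T) l" "q \<in> side L (dt T) l" unfolding l(5) by (auto simp: side_def)
    then have "l \<bullet> p = l \<bullet> q" "x \<bullet> p = x \<bullet> q" using pq by (auto simp: side_def)
    moreover have "wedge l x \<noteq> 0" using primitive_parallel prim l(1) x by blast
    ultimately show "p = q" using inner_determines_point by blast
  qed
  have "l \<noteq> - l"
  proof
    assume "l = - l"
    then have "l \<bullet> l = - (l \<bullet> l)" by (metis inner_minus_left)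
    then show False using l0 by simp
  qed
  have "perimeter T = (\<Sum>x\<in>L. tropical_length (side L (dt T) x))" by (simp add: perimeter_eq_sides)
  also have "\<dots> = (\<Sum>x\<in>{l, - l}. tropical_length (side L (dt T) x))"
    using l(1,2) zero fin by (intro sum.mono_neutral_right) auto
  also have "\<dots> = 2 * tropical_length (cut L (dt T))"
    using \<open>l \<noteq> - l\<close> l(5,6) by simp
  finally show ?thesis .
qed

text \<open>Origin of the factor 4: the final set enters twice as the last value of the perimeter
  and twice more as an edge of weight 2.\<close>

theorem weighted_lifetimes_and_perimeter:
  "(\<Sum>(l, m)\<in>L \<times> L. max 0 (wedge l m) * (death l m - birth l m)) + 2 * tropical_length (cut L (dt T)) + perimeter 0
    = 12 * T + 4 * tropical_length (cut L (dt T))"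
  using total_weighted_lifetime perimeter_final by simp

end

section \<open>The graph structure of the caustic\<close>

lemma affine_line_inj: "v \<noteq> 0 \<Longrightarrow> inj (\<lambda>r::real. a + r *\<^sub>R v)" for v :: "real^2"
  by (auto intro!: injI)

lemma open_segment_on_line:
  fixes a v :: "real^2"
  assumes "v \<noteq> 0" "s < t"
  shows "open_segment (a + s *\<^sub>R v) (a + t *\<^sub>R v) = (\<lambda>r. a + r *\<^sub>R v) ` {s<..<t}"
proof (intro equalityI subsetI)
  fix x assume "x \<in> open_segment (a + s *\<^sub>R v) (a + t *\<^sub>R v)"
  then obtain u where u: "0 < u" "u < 1" "x = (1 - u) *\<^sub>R (a + s *\<^sub>R v) + u *\<^sub>R (a + t *\<^sub>R v)"
    by (auto simp: in_segment)
  define r where "r = s + u * (t - s)"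
  have "x = a + r *\<^sub>R v" by (simp add: u r_def algebra_simps)
  moreover have "0 < u * (t - s)" "u * (t - s) < 1 * (t - s)"
    using u assms by (simp, intro mult_strict_right_mono) auto
  then have "r \<in> {s<..<t}" unfolding r_def by simp
  ultimately show "x \<in> (\<lambda>r. a + r *\<^sub>R v) ` {s<..<t}" by blast
next
  fix x assume "x \<in> (\<lambda>r. a + r *\<^sub>R v) ` {s<..<t}"
  then obtain r where "x = a + r *\<^sub>R v" "r \<in> {s<..<t}" by blast
  then have r: "x = a + r *\<^sub>R v" "s < r" "r < t" by simp_all
  define u where "u = (r - s) / (t - s)"
  have u: "0 < u" "u < 1" "r = s + u * (t - s)" using r assms by (simp_all add: u_def)
  have "x = (1 - u) *\<^sub>R (a + s *\<^sub>R v) + u *\<^sub>R (a + t *\<^sub>R v)"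
    by (simp add: r(1) u(3) algebra_simps)
  moreover have "a + s *\<^sub>R v \<noteq> a + t *\<^sub>R v" using assms by simp
  ultimately show "x \<in> open_segment (a + s *\<^sub>R v) (a + t *\<^sub>R v)"
    unfolding in_segment using u by blast
qed

lemma caustic_segment_subset: "caustic_segment \<Phi> I \<Longrightarrow> I \<subseteq> caustic \<Phi>"
  by (auto simp: caustic_segment_def dest: openin_imp_subset)

lemma caustic_segment_on_line:
  assumes "caustic_segment \<Phi> I"
  obtains a v where "v \<noteq> 0" "I = (\<lambda>r. a + r *\<^sub>R v) ` {0<..<1::real}"
proof -
  obtain a b where ab: "a \<noteq> b" "I = open_segment a b"
    using assms by (auto simp: caustic_segment_def)
  then show ?thesis
    using open_segment_on_line[of "b - a" 0 1 a] that[of "b - a" a] by simp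
qed

text \<open>Both segments are open in the caustic, hence agree near \<open>x\<close> and lie on one line.\<close>

lemma caustic_segments_collinear:
  fixes a v :: "real^2"
  assumes I: "caustic_segment \<Phi> I" "I \<subseteq> range (\<lambda>r. a + r *\<^sub>R v)" and J: "caustic_segment \<Phi> J"
    and x: "x \<in> I" "x \<in> J" and v: "v \<noteq> 0"
  obtains s t where "s < t" "J = (\<lambda>r. a + r *\<^sub>R v) ` {s<..<t}"
proof -
  obtain c w where cw: "w \<noteq> 0" "J = (\<lambda>r. c + r *\<^sub>R w) ` {0<..<1::real}"
    using caustic_segment_on_line[OF J] .
  obtain r0 where r0: "x = c + r0 *\<^sub>R w" "0 < r0" "r0 < 1" using x cw by auto
  obtain U where U: "open U" "I = caustic \<Phi> \<inter> U"
    using I(1) unfolding caustic_segment_def openin_open by blast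
  have "((\<lambda>r. c + r *\<^sub>R w) \<longlongrightarrow> c + r0 *\<^sub>R w) (at_right r0)"
    by (intro tendsto_intros)
  then have "\<forall>\<^sub>F r in at_right r0. c + r *\<^sub>R w \<in> U"
    by (rule topological_tendstoD) (use U x r0 in auto)
  moreover have "\<forall>\<^sub>F r in at_right r0. r < 1"
    by (rule order_tendstoD(2)[OF tendsto_ident_at r0(3)])
  moreover have "\<forall>\<^sub>F r in at_right r0. r0 < r" by (rule eventually_at_right_less)
  ultimately have "\<forall>\<^sub>F r in at_right r0. c + r *\<^sub>R w \<in> U \<and> r < 1 \<and> r0 < r"
    by eventually_elim simp
  then obtain r1 where r1: "c + r1 *\<^sub>R w \<in> U" "r1 < 1" "r0 < r1"
    using eventually_happens'[OF trivial_limit_at_right_real] by blast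
  have "c + r1 *\<^sub>R w \<in> J" using cw r0 r1 by auto
  then have "c + r1 *\<^sub>R w \<in> I" using U r1 caustic_segment_subset[OF J] by blast
  then obtain p q where pq: "c + r1 *\<^sub>R w = a + p *\<^sub>R v" "c + r0 *\<^sub>R w = a + q *\<^sub>R v"
    using I(2) x(1) r0(1) by blast
  define k where "k = (p - q) / (r1 - r0)"
  have "(r1 - r0) *\<^sub>R w = (c + r1 *\<^sub>R w) - (c + r0 *\<^sub>R w)" by (simp add: algebra_simps)
  also have "\<dots> = (p - q) *\<^sub>R v" by (simp only: pq) (simp add: algebra_simps)
  also have "\<dots> = (r1 - r0) *\<^sub>R (k *\<^sub>R v)" using r1 by (simp add: k_def)
  finally have w: "w = k *\<^sub>R v" using r1 by (simp del: scaleR_scaleR)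
  then have k: "k \<noteq> 0" using cw by auto
  have c: "c = a + (q - r0 * k) *\<^sub>R v" using pq(2) by (simp add: w algebra_simps)
  have "J = open_segment c (c + w)"
    using open_segment_on_line[OF cw(1), of 0 1 c] cw by simp
  also have "\<dots> = open_segment (a + (q - r0 * k) *\<^sub>R v) (a + (q - r0 * k + k) *\<^sub>R v)"
    by (simp add: c w algebra_simps)
  finally have J': "J = open_segment (a + (q - r0 * k) *\<^sub>R v) (a + (q - r0 * k + k) *\<^sub>R v)" .
  show ?thesis
  proof (cases "k > 0")
    case True
    then show ?thesis using that[of "q - r0 * k" "q - r0 * k + k"] J'
      open_segment_on_line[OF v, of "q - r0 * k" "q - r0 * k + k"] by simp
  next
    case False
    then have lt: "q - r0 * k + k < q - r0 * k" using k by simp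
    have "J = open_segment (a + (q - r0 * k + k) *\<^sub>R v) (a + (q - r0 * k) *\<^sub>R v)"
      unfolding J' by (rule open_segment_commute)
    then show ?thesis using that[OF lt] open_segment_on_line[OF v lt] by blast
  qed
qed

text \<open>All members are open intervals around \<open>x\<close> on one line, so their union is an
  open interval, bounded because the caustic is. The constant weight of each member is the weight at
  \<open>x\<close>.\<close>

lemma caustic_segment_Union:
  assumes ne: "\<J> \<noteq> {}" and seg: "\<And>J. J \<in> \<J> \<Longrightarrow> caustic_segment \<Phi> J" and x: "\<And>J. J \<in> \<J> \<Longrightarrow> x \<in> J"
    and bdd: "bounded (caustic \<Phi>)"
  shows "caustic_segment \<Phi> (\<Union>\<J>)"
proof -
  obtain J0 where J0: "J0 \<in> \<J>" using ne by blast
  obtain a v where av: "v \<noteq> 0" "J0 = (\<lambda>r. a + r *\<^sub>R v) ` {0<..<1::real}"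
    using caustic_segment_on_line[OF seg[OF J0]] .
  let ?f = "\<lambda>r::real. a + r *\<^sub>R v"
  have inj: "inj ?f" using affine_line_inj av(1) .
  obtain r0 where r0: "x = ?f r0" using x[OF J0] av by auto
  have "J0 \<subseteq> range ?f" using av by auto
  then have "\<exists>s t. s < t \<and> J = ?f ` {s<..<t}" if "J \<in> \<J>" for J
    using caustic_segments_collinear[OF seg[OF J0] _ seg[OF that] x[OF J0] x[OF that] av(1)] by metis
  then have "\<forall>J\<in>\<J>. \<exists>s t. s < t \<and> J = ?f ` {s<..<t}" by blast
  then obtain s t where st: "\<And>J. J \<in> \<J> \<Longrightarrow> s J < t J \<and> J = ?f ` {s J<..<t J}" by metis
  define R where "R = (\<Union>J\<in>\<J>. {s J<..<t J})"
  have fR: "\<Union>\<J> = ?f ` R" using st unfolding R_def by fast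
  have r0_mem: "r0 \<in> {s J<..<t J}" if "J \<in> \<J>" for J
    using st[OF that] x[OF that] inj r0 by (metis inj_image_mem_iff)
  have "open R" unfolding R_def by (intro open_UN ballI open_greaterThanLessThan)
  have "connected R" unfolding R_def
  proof (rule connected_Union)
    have "r0 \<in> (\<Inter>J\<in>\<J>. {s J<..<t J})" using r0_mem by blast
    then show "(\<Inter>J\<in>\<J>. {s J<..<t J}) \<noteq> {}" by blast
  qed (auto intro: connected_Ioo)
  then have int: "is_interval R" by (simp add: is_interval_connected_1)
  have "bounded R"
  proof -
    have "\<Union>\<J> \<subseteq> caustic \<Phi>" using caustic_segment_subset seg by blast
    then obtain B where B: "\<And>y. y \<in> \<Union>\<J> \<Longrightarrow> norm y \<le> B" using bdd by (meson bounded_iff subsetD)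
    have "\<bar>r\<bar> \<le> (B + norm a) / norm v" if "r \<in> R" for r
    proof -
      have "norm (?f r) \<le> B" using B fR that by blast
      moreover have "norm (r *\<^sub>R v) \<le> norm (?f r) + norm a"
        by (metis add_diff_cancel_left' norm_triangle_ineq4)
      ultimately show ?thesis using av(1) by (simp add: pos_le_divide_eq)
    qed
    then show ?thesis unfolding bounded_iff real_norm_def by blast
  qed
  then obtain p q where pq: "p \<le> q" "{p<..<q} \<subseteq> R" "R \<subseteq> {p..q}" using is_interval_bounds int by blast
  have "R \<subseteq> interior {p..q}" using pq(3) \<open>open R\<close> interior_maximal by blast
  then have R: "R = {p<..<q}" using pq(2) by auto
  have "r0 \<in> R" using r0_mem J0 by (auto simp: R_def)
  then have "p < q" using R by auto
  then have "\<Union>\<J> = open_segment (?f p) (?f q)"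
    using open_segment_on_line[OF av(1)] fR R by simp
  moreover have "?f p \<noteq> ?f q" using av(1) \<open>p < q\<close> by simp
  moreover have "openin (top_of_set (caustic \<Phi>)) (\<Union>\<J>)"
    using seg by (intro openin_Union) (auto simp: caustic_segment_def)
  moreover have "caustic_weight \<Phi> constant_on (\<Union>\<J>)"
    unfolding constant_on_def
  proof (intro exI ballI)
    fix y assume "y \<in> \<Union>\<J>"
    then obtain J where "J \<in> \<J>" "y \<in> J" by blast
    then show "caustic_weight \<Phi> y = caustic_weight \<Phi> x"
      using seg[of J] x[of J] unfolding caustic_segment_def constant_on_def by metis
  qed
  ultimately show ?thesis unfolding caustic_segment_def by blast
qed

lemma caustic_edge_absorbs:
  assumes "bounded (caustic \<Phi>)" "J \<in> caustic_edges \<Phi>" "caustic_segment \<Phi> I" "I \<inter> J \<noteq> {}"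
  shows "I \<subseteq> J"
proof -
  obtain x where "x \<in> I" "x \<in> J" using assms(4) by blast
  then have "caustic_segment \<Phi> (\<Union>{I, J})"
    using assms by (intro caustic_segment_Union[of _ _ x]) (auto simp: caustic_edges_def)
  then have "I \<union> J = J" using assms(2) by (auto simp: caustic_edges_def)
  then show ?thesis by blast
qed

text \<open>The union of all segments through one point is again a segment, hence the maximal one;
  no choice principle for chains is involved.\<close>

lemma caustic_segment_in_edge:
  assumes "bounded (caustic \<Phi>)" "caustic_segment \<Phi> I"
  obtains J where "J \<in> caustic_edges \<Phi>" "I \<subseteq> J"
proof -
  obtain a v where "v \<noteq> 0" "I = (\<lambda>r. a + r *\<^sub>R v) ` {0<..<1::real}"
    using caustic_segment_on_line[OF assms(2)] .
  moreover have "(1/2::real) \<in> {0<..<1}" by simp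
  ultimately obtain x where x: "x \<in> I" by blast
  define \<J> where "\<J> = {J. caustic_segment \<Phi> J \<and> x \<in> J}"
  have "I \<in> \<J>" using x assms by (simp add: \<J>_def)
  then have seg: "caustic_segment \<Phi> (\<Union>\<J>)"
    using assms(1) by (intro caustic_segment_Union[of _ _ x]) (auto simp: \<J>_def)
  have "J' = \<Union>\<J>" if "caustic_segment \<Phi> J'" "\<Union>\<J> \<subseteq> J'" for J'
  proof -
    have "x \<in> J'" using that x \<open>I \<in> \<J>\<close> by blast
    then have "J' \<in> \<J>" using that by (simp add: \<J>_def)
    then show ?thesis using that by blast
  qed
  then have "\<Union>\<J> \<in> caustic_edges \<Phi>" using seg unfolding caustic_edges_def by blast
  then show ?thesis using that \<open>I \<in> \<J>\<close> by blast
qed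

lemma edge_weight_eq:
  assumes "caustic_segment \<Phi> I" "x \<in> I"
  shows "edge_weight \<Phi> I = caustic_weight \<Phi> x"
proof -
  have "caustic_weight \<Phi> ` I = {caustic_weight \<Phi> x}"
    using assms unfolding caustic_segment_def constant_on_def by fastforce
  then show ?thesis by (simp add: edge_weight_def)
qed

text \<open>The length can be read off any finite subdivision, so the maximal segments need not be determined.\<close>

lemma polygon_caustic_length_subdivision:
  assumes fin: "finite \<E>" and seg: "\<And>I. I \<in> \<E> \<Longrightarrow> caustic_segment \<Phi> I"
    and rational: "\<And>I. I \<in> \<E> \<Longrightarrow> \<exists>a v. primitive_vec v \<and> I \<subseteq> range (\<lambda>r. a + r *\<^sub>R v)"
    and disj: "\<And>I J. I \<in> \<E> \<Longrightarrow> J \<in> \<E> \<Longrightarrow> I \<noteq> J \<Longrightarrow> I \<inter> J = {}"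
    and cover: "finite (caustic \<Phi> - \<Union>\<E>)"
  shows "polygon_caustic_length \<Phi> = (\<Sum>I\<in>\<E>. edge_weight \<Phi> I * tropical_length I)"
proof -
  have "bounded I" if "I \<in> \<E>" for I
    using seg[OF that] bounded_open_segment unfolding caustic_segment_def by blast
  then have "bounded (\<Union>\<E> \<union> (caustic \<Phi> - \<Union>\<E>))"
    using fin cover by (intro bounded_Un[THEN iffD2] conjI bounded_Union finite_imp_bounded) auto
  then have bdd: "bounded (caustic \<Phi>)" by (rule bounded_subset) blast
  have segE: "caustic_segment \<Phi> J" if "J \<in> caustic_edges \<Phi>" for J
    using that by (simp add: caustic_edges_def)
  have ne: "\<exists>x. x \<in> J" "infinite J" if "caustic_segment \<Phi> J" for J
  proof -
    obtain a b where "a \<noteq> b" "J = open_segment a b" using \<open>caustic_segment \<Phi> J\<close> by (auto simp: caustic_segment_def)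
    then show "infinite J" by simp
    then show "\<exists>x. x \<in> J" by (metis ex_in_conv finite.emptyI)
  qed
  have "\<forall>I\<in>\<E>. \<exists>J. J \<in> caustic_edges \<Phi> \<and> I \<subseteq> J"
    using caustic_segment_in_edge[OF bdd seg] by metis
  then obtain g where g: "\<And>I. I \<in> \<E> \<Longrightarrow> g I \<in> caustic_edges \<Phi> \<and> I \<subseteq> g I" by metis
  have meets: "\<exists>I\<in>\<E>. I \<subseteq> J" if J: "J \<in> caustic_edges \<Phi>" for J
  proof -
    have "\<not> J \<subseteq> caustic \<Phi> - \<Union>\<E>" using ne(2)[OF segE[OF J]] cover finite_subset by blast
    then obtain I where "I \<in> \<E>" "I \<inter> J \<noteq> {}" using caustic_segment_subset[OF segE[OF J]] by blast
    then show ?thesis using caustic_edge_absorbs[OF bdd J seg] by blast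
  qed
  have g_eq: "g I = J" if "I \<in> \<E>" "J \<in> caustic_edges \<Phi>" "I \<subseteq> J" for I J
  proof -
    have "g I \<inter> J \<noteq> {}" using g[OF that(1)] that ne(1)[OF seg[OF that(1)]] by blast
    then have "g I \<subseteq> J" "J \<subseteq> g I"
      using caustic_edge_absorbs[OF bdd] g[OF that(1)] that(2) segE by (blast, metis inf_commute)
    then show ?thesis by blast
  qed
  have edges: "caustic_edges \<Phi> = g ` \<E>" using meets g_eq g by blast
  \<comment> \<open>Up to finitely many points, the edge is the disjoint union of the subdivision
    pieces inside it. Integrating indicator functions along the line adds up their lengths without
    ordering them.\<close>
  have len: "tropical_length J = (\<Sum>I\<in>{I \<in> \<E>. g I = J}. tropical_length I)" if J: "J \<in> caustic_edges \<Phi>" for J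
  proof -
    let ?E = "{I \<in> \<E>. g I = J}"
    obtain I0 where I0: "I0 \<in> \<E>" "I0 \<subseteq> J" using meets[OF J] by blast
    obtain a v where v: "primitive_vec v" and I0a: "I0 \<subseteq> range (\<lambda>r. a + r *\<^sub>R v)"
      using rational[OF I0(1)] by blast
    have v0: "v \<noteq> 0" using v primitive_vecD by blast
    let ?f = "\<lambda>r::real. a + r *\<^sub>R v"
    have inj: "inj ?f" using affine_line_inj v0 .
    obtain x0 where x0: "x0 \<in> I0" using ne(1)[OF seg[OF I0(1)]] by blast
    obtain s t where st: "s < t" "J = ?f ` {s<..<t}"
      using caustic_segments_collinear[OF seg[OF I0(1)] I0a segE[OF J] x0 _ v0] x0 I0 by blast
    have JR: "J \<subseteq> range ?f" using st by blast
    have tl: "tropical_length (?f ` {p<..<q}) = q - p" if "p < q" for p q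
      using tropical_length_open_segment[OF v, of "q - p" "?f p"] that open_segment_on_line[OF v0 that, of a]
      by (simp add: algebra_simps)
    have sub: "I \<subseteq> J" if "I \<in> ?E" for I using g that by blast
    have ind: "(indicator (?f -` I) has_integral tropical_length I) {s..t}" if I: "I \<in> ?E" for I
    proof -
      obtain x where "x \<in> I" using ne(1) seg I by blast
      then obtain p q where pq: "p < q" "I = ?f ` {p<..<q}"
        using caustic_segments_collinear[OF segE[OF J] JR seg _ _ v0] I sub by (metis (no_types, lifting) mem_Collect_eq subsetD)
      have vimage: "?f -` I = {p<..<q}" using pq(2) inj by (simp add: inj_vimage_image_eq)
      have "?f ` {p<..<q} \<subseteq> ?f ` {s<..<t}" using sub[OF I] pq st by simp
      then have "{p<..<q} \<subseteq> {s<..<t}" using inj by (simp add: inj_image_subset_iff)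
      then have "{p<..<q} \<subseteq> {s..t}" by (rule order_trans) auto
      then show ?thesis
        using has_integral_indicator_Ioo[of p q s t] pq tl[OF pq(1)] unfolding vimage by simp
    qed
    have sum: "((\<lambda>r. \<Sum>I\<in>?E. indicator (?f -` I) r) has_integral (\<Sum>I\<in>?E. tropical_length I)) {s..t}"
      using fin ind by (intro has_integral_sum) auto
    have "((\<lambda>r. 1::real) has_integral (\<Sum>I\<in>?E. tropical_length I)) {s..t}"
    proof (rule has_integral_spike_finite[OF _ _ sum])
      show "finite (?f -` (caustic \<Phi> - \<Union>\<E>) \<union> {s, t})"
        using finite_vimageI[OF cover inj] by simp
      fix r assume r: "r \<in> {s..t} - (?f -` (caustic \<Phi> - \<Union>\<E>) \<union> {s, t})"
      then have rJ: "?f r \<in> J" using st by auto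
      then have "?f r \<in> \<Union>\<E>" using r caustic_segment_subset[OF segE[OF J]] by blast
      then obtain I where I: "I \<in> \<E>" "?f r \<in> I" by blast
      then have "I \<subseteq> J" using caustic_edge_absorbs[OF bdd J seg] rJ by blast
      then have IE: "I \<in> ?E" using g_eq I J by blast
      have "(\<Sum>I\<in>?E. indicator (?f -` I) r) = (\<Sum>I'\<in>{I}. indicator (?f -` I') r :: real)"
      proof (rule sum.mono_neutral_right)
        show "\<forall>I'\<in>?E - {I}. indicator (?f -` I') r = (0::real)"
          using disj I by (fastforce simp: indicator_def)
      qed (use fin IE in auto)
      then show "1 = (\<Sum>I\<in>?E. indicator (?f -` I) r :: real)" using I by simp
    qed
    moreover have "((\<lambda>r. 1::real) has_integral t - s) {s..t}"
      using has_integral_const_real[of "1::real" s t] st(1) by simp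
    ultimately have "(\<Sum>I\<in>?E. tropical_length I) = t - s" by (rule has_integral_unique)
    then show ?thesis using tl[OF st(1)] st(2) by simp
  qed
  have weight: "edge_weight \<Phi> (g I) = edge_weight \<Phi> I" if I: "I \<in> \<E>" for I
  proof -
    obtain x where "x \<in> I" using ne(1)[OF seg[OF I]] by blast
    then show ?thesis using edge_weight_eq seg[OF I] segE g[OF I] by (metis subsetD)
  qed
  have "polygon_caustic_length \<Phi> = (\<Sum>J\<in>g ` \<E>. \<Sum>I\<in>{I \<in> \<E>. g I = J}. edge_weight \<Phi> J * tropical_length I)"
    unfolding polygon_caustic_length_def edges
    by (rule sum.cong) (use edges len in \<open>auto simp: sum_distrib_left\<close>)
  also have "\<dots> = (\<Sum>J\<in>g ` \<E>. \<Sum>I\<in>{I \<in> \<E>. g I = J}. edge_weight \<Phi> I * tropical_length I)"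
    using weight by (intro sum.cong) auto
  also have "\<dots> = (\<Sum>I\<in>\<E>. edge_weight \<Phi> I * tropical_length I)"
    using fin by (intro sum.group) auto
  finally show ?thesis .
qed

section \<open>Weights of the caustic and its trajectories\<close>

context lattice_polygon
begin

text \<open>A side of positive length leaves \<open>p\<close> along \<open>rot x\<close> or its
  opposite. Feasibility of that direction makes \<open>x\<close> the first or the last active
  normal, so redundant active normals have no such side.\<close>

lemma side_normal_at_corner:
  assumes c: "corner_at L d p l m" and x: "x \<in> side_normals L d" "p \<in> side L d x"
  shows "x = l \<or> x = m"
proof -
  obtain q where q: "q \<in> side L d x" "q \<noteq> p" and xL: "x \<in> L"
    using x unfolding side_normals_def by blast
  obtain r where r: "q = p + r *\<^sub>R rot x" using side_multiple_rot[OF xL x(2) q(1)] .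
  have xa: "x \<in> active L d p" using x(2) xL by (simp add: side_def active_def)
  have cd: "l \<in> active L d p" "m \<in> active L d p" "wedge l x \<ge> 0" "wedge x m \<ge> 0"
    using c xa by (auto simp: corner_at_def)
  have *: "r * wedge x z \<ge> 0" if "z \<in> active L d p" for z
  proof -
    have "z \<bullet> p \<le> z \<bullet> q" using that q by (simp add: side_def cut_def active_def)
    then show ?thesis by (simp add: r inner_add_right wedge_eq_inner_rot)
  qed
  have "r \<noteq> 0" using q r by auto
  then consider "r > 0" | "r < 0" by linarith
  then show ?thesis
  proof cases
    case 1
    then have "wedge x l \<ge> 0" using *[OF cd(1)] by (simp add: zero_le_mult_iff)
    then have "wedge l x = 0" using cd(3) wedge_swap[of x l] by simp
    then show ?thesis using active_parallel_eq[OF cd(1) xa] by simp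
  next
    case 2
    then have "wedge x m \<le> 0" using *[OF cd(2)] by (simp add: zero_le_mult_iff)
    then have "wedge x m = 0" using cd(4) by simp
    then show ?thesis using active_parallel_eq[OF xa cd(2)] by simp
  qed
qed

lemma primitive_dir_side:
  assumes "l \<in> side_normals L d"
  shows "primitive_dir (side L d l) = rot l \<or> primitive_dir (side L d l) = - rot l"
proof -
  obtain p q where pq: "p \<in> side L d l" "q \<in> side L d l" "p \<noteq> q" and l: "l \<in> L"
    using assms by (auto simp: side_normals_def)
  have "parallel_to (side L d l) (rot l)"
    unfolding parallel_to_def
  proof (intro ballI)
    fix x y assume "x \<in> side L d l" "y \<in> side L d l"
    then obtain c where "x = y + c *\<^sub>R rot l" using side_multiple_rot[OF l] by metis
    then show "x - y \<in> span {rot l}" by (simp add: span_base span_scale)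
  qed
  then show ?thesis using parallel_to_primitive_dir[OF primitive_rot[OF primitive_normals[OF l]]] pq by blast
qed

end

locale evolving_polygon = shrinking_polygon +
  fixes \<Phi> :: "(real^2) set"
  assumes evolve_eq_cut: "\<And>t. 0 \<le> t \<Longrightarrow> evolve \<Phi> t = cut L (dt t)"
begin

lemma interior_final: "interior (cut L (dt T)) = {}"
proof (rule ccontr)
  assume "interior (cut L (dt T)) \<noteq> {}"
  then obtain x where "x \<in> interior (cut L (dt T))" by blast
  then obtain e where e: "e > 0" "ball x e \<subseteq> cut L (dt T)" by (auto simp: mem_interior)
  obtain l where l: "l \<in> L" "l \<bullet> x \<le> d l + T" using top_maximal by blast
  have l0: "l \<noteq> 0" using prim[OF l(1)] primitive_vecD by blast
  define r where "r = e / (2 * norm l)"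
  have r: "r > 0" using e l0 by (simp add: r_def)
  have "x - r *\<^sub>R l \<in> ball x e" using e l0 by (simp add: dist_norm r_def)
  then have "x - r *\<^sub>R l \<in> cut L (dt T)" using e(2) by blast
  then have "d l + T \<le> l \<bullet> (x - r *\<^sub>R l)" using l(1) by (simp add: cut_def)
  then have "r * (l \<bullet> l) \<le> 0" using l by (simp add: inner_diff_right)
  moreover have "r * (l \<bullet> l) > 0" using r l0 by simp
  ultimately show False by linarith
qed

lemma final_time_eq: "final_time \<Phi> = T"
  unfolding final_time_def
proof (rule Least_equality)
  show "0 \<le> T \<and> interior (evolve \<Phi> T) = {}"
    using evolve_eq_cut[of T] interior_final T_pos by simp
  fix t assume t: "0 \<le> t \<and> interior (evolve \<Phi> t) = {}"
  show "T \<le> t"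
  proof (rule ccontr)
    assume "\<not> T \<le> t"
    then show False
      using t evolve_eq_cut[of t] lattice_polygon.interior_cut_nonempty[OF polygon_at[of t]] by simp
  qed
qed

lemma final_set_eq: "final_set \<Phi> = cut L (dt T)"
  using evolve_eq_cut[of T] T_pos by (simp add: final_set_def final_time_eq)

lemma caustic_eq:
  "caustic \<Phi> = {p. \<exists>t l m. t \<in> lifetime l m \<and> p = vertex l m t} \<union> cut L (dt T)"
proof -
  have ext: "p extreme_point_of evolve \<Phi> t \<longleftrightarrow> (\<exists>l m. t \<in> lifetime l m \<and> p = vertex l m t)"
    if t: "0 < t" "t < T" for p t
  proof -
    have "p extreme_point_of evolve \<Phi> t \<longleftrightarrow> (\<exists>l m. corner_at L (dt t) p l m)"
      using lattice_polygon.extreme_point_iff_corner[OF polygon_at[of t]] evolve_eq_cut[of t] t by simp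
    also have "\<dots> \<longleftrightarrow> (\<exists>l m. t \<in> lifetime l m \<and> p = vertex l m t)"
      using corner_at_lifetime[OF _ t] lifetime_corner_at by blast
    finally show ?thesis .
  qed
  have "{p. \<exists>t. 0 < t \<and> t < T \<and> p extreme_point_of evolve \<Phi> t} =
      {p. \<exists>t l m. t \<in> lifetime l m \<and> p = vertex l m t}"
  proof (intro Collect_cong iffI)
    fix p assume "\<exists>t. 0 < t \<and> t < T \<and> p extreme_point_of evolve \<Phi> t"
    then obtain t where "0 < t" "t < T" "p extreme_point_of evolve \<Phi> t" by blast
    then show "\<exists>t l m. t \<in> lifetime l m \<and> p = vertex l m t" using ext[of t p] by blast
  next
    fix p assume "\<exists>t l m. t \<in> lifetime l m \<and> p = vertex l m t"
    then obtain t l m where t: "t \<in> lifetime l m" "p = vertex l m t" by blast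
    then have "0 < t" "t < T" by (simp_all add: lifetime_def)
    then show "\<exists>t. 0 < t \<and> t < T \<and> p extreme_point_of evolve \<Phi> t" using ext[of t p] t by blast
  qed
  then show ?thesis by (simp add: caustic_def final_time_eq final_set_eq)
qed

lemma vertex_not_final:
  assumes "t \<in> lifetime l m"
  shows "vertex l m t \<notin> cut L (dt T)"
proof
  assume "vertex l m t \<in> cut L (dt T)"
  then have "d l + T \<le> l \<bullet> vertex l m t" using lifetime_normals[OF assms] by (auto simp: cut_def)
  then show False using vertex_inner(1)[of l m t] lifetime_normals[OF assms] assms by (simp add: lifetime_def)
qed

text \<open>A normal tight at \<open>p\<close> at one of the two times must also be satisfied at the
  other. Applied both ways, this gives equal times, and then the corner at \<open>p\<close> is
  unique.\<close>

lemma vertex_determines_corner: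
  assumes t: "t \<in> lifetime l m" and s: "s \<in> lifetime l' m'" and eq: "vertex l m t = vertex l' m' s"
  shows "s = t \<and> l' = l \<and> m' = m"
proof -
  have c: "corner_at L (dt t) (vertex l m t) l m" "corner_at L (dt s) (vertex l m t) l' m'"
    using lifetime_corner_at[OF t] lifetime_corner_at[OF s] by (simp_all add: eq)
  then have "d l + s \<le> d l + t" "d l' + t \<le> d l' + s"
    by (force simp: corner_at_def active_def cut_def)+
  then have "s = t" by simp
  moreover have "lattice_polygon L (dt t)" using t polygon_at by (simp add: lifetime_def)
  ultimately show ?thesis using lattice_polygon.corner_at_unique c by blast
qed

text \<open>The description by \<open>THE\<close> is settled: the point fixes the time, only two
  sides of positive length meet there, and the quarter turn from normals to directions preserves
  determinants.\<close>

lemma caustic_weight_vertex: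
  assumes t: "t \<in> lifetime l m"
  shows "caustic_weight \<Phi> (vertex l m t) = wedge l m"
proof -
  let ?p = "vertex l m t"
  have tT: "0 < t" "t < T" using t by (auto simp: lifetime_def)
  interpret P: lattice_polygon L "dt t" using polygon_at tT by simp
  have w: "wedge l m > 0" using lifetime_normals[OF t] by simp
  have c: "corner_at L (dt t) ?p l m" using lifetime_corner_at[OF t] .
  have ev: "evolve \<Phi> t = cut L (dt t)" using evolve_eq_cut tT by simp
  have sides: "l \<in> side_normals L (dt t)" "m \<in> side_normals L (dt t)"
    "?p \<in> side L (dt t) l" "?p \<in> side L (dt t) m"
    using P.corner_at_normals[OF c] c by (auto simp: corner_at_def active_def side_def)
  have wedge_dirs: "\<bar>wedge (primitive_dir (side L (dt t) x)) (primitive_dir (side L (dt t) y))\<bar> = \<bar>wedge x y\<bar>"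
    if "x \<in> side_normals L (dt t)" "y \<in> side_normals L (dt t)" for x y
  proof -
    have "wedge (rot x) (rot y) = wedge x y" by (simp add: wedge_def)
    then show ?thesis
      using P.primitive_dir_side[OF that(1)] P.primitive_dir_side[OF that(2)]
      by (auto simp: wedge_minus_left wedge_minus_right)
  qed
  have "(THE w. \<exists>s e f. 0 < s \<and> s < final_time \<Phi> \<and> ?p extreme_point_of evolve \<Phi> s \<and>
      e edge_of evolve \<Phi> s \<and> f edge_of evolve \<Phi> s \<and> e \<noteq> f \<and> ?p \<in> e \<and> ?p \<in> f \<and>
      w = \<bar>wedge (primitive_dir e) (primitive_dir f)\<bar>) = wedge l m"
  proof (rule the_equality)
    have "l \<noteq> m" using w by auto
    then have "side L (dt t) l \<noteq> side L (dt t) m"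
      using P.inj_on_side sides(1,2) by (meson inj_onD)
    moreover have "?p extreme_point_of cut L (dt t)" using P.extreme_point_iff_corner c by blast
    moreover have "side L (dt t) l edge_of cut L (dt t)" "side L (dt t) m edge_of cut L (dt t)"
      using P.edge_of_cut_iff sides by auto
    moreover have "wedge l m = \<bar>wedge (primitive_dir (side L (dt t) l)) (primitive_dir (side L (dt t) m))\<bar>"
      using wedge_dirs[OF sides(1,2)] w by simp
    ultimately show "\<exists>s e f. 0 < s \<and> s < final_time \<Phi> \<and> ?p extreme_point_of evolve \<Phi> s \<and>
      e edge_of evolve \<Phi> s \<and> f edge_of evolve \<Phi> s \<and> e \<noteq> f \<and> ?p \<in> e \<and> ?p \<in> f \<and>
      wedge l m = \<bar>wedge (primitive_dir e) (primitive_dir f)\<bar>"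
      using tT sides unfolding final_time_eq ev[symmetric] by blast
  next
    fix w' assume "\<exists>s e f. 0 < s \<and> s < final_time \<Phi> \<and> ?p extreme_point_of evolve \<Phi> s \<and>
      e edge_of evolve \<Phi> s \<and> f edge_of evolve \<Phi> s \<and> e \<noteq> f \<and> ?p \<in> e \<and> ?p \<in> f \<and>
      w' = \<bar>wedge (primitive_dir e) (primitive_dir f)\<bar>"
    then obtain s e f where s: "0 < s" "s < T" "?p extreme_point_of evolve \<Phi> s"
      and ef: "e edge_of evolve \<Phi> s" "f edge_of evolve \<Phi> s" "e \<noteq> f" "?p \<in> e" "?p \<in> f"
      and w': "w' = \<bar>wedge (primitive_dir e) (primitive_dir f)\<bar>"
      unfolding final_time_eq by blast
    have "?p extreme_point_of cut L (dt s)" using s evolve_eq_cut by simp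
    then obtain l' m' where "corner_at L (dt s) ?p l' m'"
      using lattice_polygon.extreme_point_iff_corner[OF polygon_at] s by fastforce
    then have "s = t" using vertex_determines_corner[OF t] corner_at_lifetime s(1,2) by blast
    then have "e \<in> side L (dt t) ` side_normals L (dt t)" "f \<in> side L (dt t) ` side_normals L (dt t)"
      using ef ev by (simp_all add: P.edge_of_cut_iff)
    then obtain x y where xy: "x \<in> side_normals L (dt t)" "y \<in> side_normals L (dt t)"
      "e = side L (dt t) x" "f = side L (dt t) y"
      by blast
    have "x = l \<or> x = m" "y = l \<or> y = m" "x \<noteq> y"
      using P.side_normal_at_corner[OF c] xy ef by auto
    then have "\<bar>wedge x y\<bar> = wedge l m" using w wedge_swap[of m l] by auto
    then show "w' = wedge l m" using w' wedge_dirs xy by simp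
  qed
  then show ?thesis
    using vertex_not_final[OF t] by (simp add: caustic_weight_def final_set_eq)
qed

text \<open>For the lattice step \<open>e\<close> of the height-one cone the velocity is
  \<open>- rot e\<close>. Consequently the tropical length of a trajectory is its duration.\<close>

lemma primitive_velocity:
  assumes t: "t \<in> lifetime l m"
  shows "primitive_vec (velocity l m)"
proof -
  have c: "(l, m) \<in> corners L (dt t)" "0 < t" "t < T" using t by (auto simp: lifetime_def)
  have w: "wedge l m > 0" "primitive_vec l" "primitive_vec m" using lifetime_normals[OF t] prim by auto
  obtain k e where ke: "k \<ge> (1::nat)" "wedge l m = real k" "e \<in> lattice_vecs" "wedge l e = 1" "m = l + real k *\<^sub>R e"
    by (rule height_one_cone[OF w(2,3,1)]) (rule empty_cones[OF c(2,3,1)])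
  have "rot l - rot m = real k *\<^sub>R (- rot e)" by (simp add: ke(5) vec2_eq_iff)
  then have "velocity l m = - rot e" using ke(1) by (simp add: velocity_def ke(2))
  moreover have "wedge e (- l) = 1" using ke(4) wedge_swap[of e l] by (simp add: wedge_minus_right)
  then have "primitive_vec e"
    using primitive_if_wedge_1 ke(3) w(2) lattice_vecs_minus primitive_vecD(1) by blast
  ultimately show ?thesis using primitive_minus primitive_rot by simp
qed

lemma inner_vertex: "x \<bullet> vertex l m t = x \<bullet> vertex l m 0 + t * (x \<bullet> velocity l m)"
  by (subst vertex_affine) (simp add: inner_add_right)

lemma continuous_on_vertex: "continuous_on S (vertex l m)"
proof -
  have "continuous_on S (\<lambda>t. vertex l m 0 + t *\<^sub>R velocity l m)" by (intro continuous_intros)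
  then show ?thesis by (rule continuous_on_eq) (rule vertex_affine[symmetric])
qed

lemma closure_lifetime_vertex:
  assumes "s \<in> closure (lifetime l m)"
  shows "vertex l m s \<in> cut L (dt s)" "s \<le> T"
proof -
  define S where "S = {0..T} \<inter> (\<Inter>x\<in>L. {s. d x + s \<le> x \<bullet> vertex l m 0 + s * (x \<bullet> velocity l m)})"
  have "closed S"
    unfolding S_def by (intro closed_Int closed_INT ballI closed_Collect_le continuous_intros)
  moreover have "lifetime l m \<subseteq> S"
    using lifetime_corner_at unfolding S_def inner_vertex[symmetric]
    by (auto simp: lifetime_def corner_at_def cut_def)
  ultimately have "s \<in> S" using assms closure_minimal by blast
  then show "vertex l m s \<in> cut L (dt s)" "s \<le> T"
    unfolding S_def inner_vertex[symmetric] by (auto simp: cut_def)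
qed

text \<open>At a common point \<open>l'\<close> and \<open>m'\<close> would be tight at an interior
  time of the trajectory of \<open>l\<close> and \<open>m\<close>. An affine slack that is
  nonnegative on an interval and vanishes inside it is zero, so both trajectories move identically
  and share a time at which both pairs are corners.\<close>

lemma vertex_separated:
  assumes t: "t \<in> {birth l m<..<death l m}" and s: "s \<in> closure (lifetime l' m')"
    and eq: "vertex l m t = vertex l' m' s"
  shows "l' = l \<and> m' = m"
proof -
  have tl: "t \<in> lifetime l m" using t lifetime_bounds by blast
  have "lifetime l' m' \<noteq> {}" using s by auto
  then have w: "l' \<in> L" "m' \<in> L" "wedge l' m' > 0" using lifetime_normals by blast+
  have w': "l \<in> L" "m \<in> L" "wedge l m > 0" using lifetime_normals[OF tl] .
  have "vertex l m t \<in> cut L (dt t)" using lifetime_corner_at[OF tl] by (simp add: corner_at_def)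
  then have "d l' + t \<le> l' \<bullet> vertex l' m' s" using w eq by (auto simp: cut_def)
  moreover have "d l + s \<le> l \<bullet> vertex l m t"
    using closure_lifetime_vertex(1)[OF s] w' eq by (auto simp: cut_def)
  ultimately have st: "s = t" using vertex_inner(1)[of l' m' s] vertex_inner(1)[of l m t] w w' by simp
  have on: "x \<bullet> vertex l m r = d x + r" if x: "x \<in> L" "x \<bullet> vertex l m t = d x + t" for x r
  proof -
    define g where "g = x \<bullet> velocity l m - 1"
    have slack: "x \<bullet> vertex l m r - (d x + r) = (r - t) * g" for r
      using x(2) inner_vertex[of x l m r] inner_vertex[of x l m t] by (simp add: g_def algebra_simps)
    have nonneg: "(r - t) * g \<ge> 0" if "r \<in> {birth l m<..<death l m}" for r
    proof -
      have "r \<in> lifetime l m" using that lifetime_bounds by blast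
      then have "d x + r \<le> x \<bullet> vertex l m r"
        using lifetime_corner_at x(1) by (auto simp: corner_at_def cut_def)
      then show ?thesis using slack[of r] by simp
    qed
    have "(t + birth l m) / 2 \<in> {birth l m<..<death l m}" "(t + death l m) / 2 \<in> {birth l m<..<death l m}"
      using t by auto
    then have "((t + birth l m) / 2 - t) * g \<ge> 0" "((t + death l m) / 2 - t) * g \<ge> 0"
      using nonneg by blast+
    moreover have "(t + birth l m) / 2 - t < 0" "(t + death l m) / 2 - t > 0" using t by auto
    ultimately have "g = 0" by (simp add: zero_le_mult_iff)
    then show ?thesis using slack[of r] by simp
  qed
  have same: "vertex l m r = vertex l' m' r" for r
  proof (rule inner_determines_point[of l' m'])
    show "l' \<bullet> vertex l m r = l' \<bullet> vertex l' m' r"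
      using on[of l' r] vertex_inner[of l' m'] w st eq by simp
    show "m' \<bullet> vertex l m r = m' \<bullet> vertex l' m' r"
      using on[of m' r] vertex_inner[of l' m'] w st eq by simp
  qed (use w in simp)
  have "t \<in> {birth l m<..<death l m} \<inter> closure (lifetime l' m')" using s st t by simp
  then have "{birth l m<..<death l m} \<inter> lifetime l' m' \<noteq> {}"
    using open_Int_closure_eq_empty[OF open_greaterThanLessThan, of "birth l m" "death l m" "lifetime l' m'"]
    by (metis empty_iff)
  then obtain r where "r \<in> {birth l m<..<death l m}" "r \<in> lifetime l' m'" by blast
  moreover from this have "r \<in> lifetime l m" using lifetime_bounds(2) by blast
  ultimately show ?thesis using vertex_determines_corner[of r l m r l' m'] same by blast
qed

definition piece :: "real^2 \<Rightarrow> real^2 \<Rightarrow> (real^2) set" where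
  "piece l m = vertex l m ` {birth l m<..<death l m}"

lemma piece_eq_open_segment:
  assumes "birth l m < death l m"
  shows "primitive_vec (velocity l m)"
    "piece l m = (\<lambda>r. vertex l m 0 + r *\<^sub>R velocity l m) ` {birth l m<..<death l m}"
    "piece l m = open_segment (vertex l m (birth l m)) (vertex l m (death l m))"
    "tropical_length (piece l m) = death l m - birth l m"
proof -
  have "(birth l m + death l m) / 2 \<in> lifetime l m"
    using lifetime_bounds(2)[of l m] assms by auto
  then show prim: "primitive_vec (velocity l m)" by (rule primitive_velocity)
  show line: "piece l m = (\<lambda>r. vertex l m 0 + r *\<^sub>R velocity l m) ` {birth l m<..<death l m}"
    unfolding piece_def by (rule image_cong[OF refl vertex_affine])
  show seg: "piece l m = open_segment (vertex l m (birth l m)) (vertex l m (death l m))"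
    unfolding line using open_segment_on_line[OF primitive_vecD(2)[OF prim] assms]
      vertex_affine[of l m "birth l m"] vertex_affine[of l m "death l m"] by simp
  have "vertex l m (death l m) = vertex l m (birth l m) + (death l m - birth l m) *\<^sub>R velocity l m"
    using vertex_affine[of l m "birth l m"] vertex_affine[of l m "death l m"] by (simp add: algebra_simps)
  then show "tropical_length (piece l m) = death l m - birth l m"
    unfolding seg using tropical_length_open_segment[OF prim] assms by simp
qed

lemma compact_vertex_closure: "compact (vertex l m ` closure (lifetime l m))"
proof -
  have "bounded (lifetime l m)" by (rule bounded_subset[of "{0..T}"]) (auto simp: lifetime_def)
  then show ?thesis by (intro compact_continuous_image continuous_on_vertex) (simp add: compact_closure)
qed

text \<open>The rest of the caustic lies in a closed set that misses the piece: the closures of the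
  finitely many other trajectories, the final set, and the two ends of the piece.\<close>

lemma caustic_segment_piece:
  assumes "birth l m < death l m"
  shows "caustic_segment \<Phi> (piece l m)"
proof -
  have sub: "{birth l m<..<death l m} \<subseteq> lifetime l m" using lifetime_bounds by blast
  moreover have "(birth l m + death l m) / 2 \<in> {birth l m<..<death l m}" using assms by auto
  ultimately have "(birth l m + death l m) / 2 \<in> lifetime l m" by blast
  note w = lifetime_normals[OF this]
  have inj: "r = s" if "vertex l m r = vertex l m s" for r s
  proof -
    have ne: "wedge l m \<noteq> 0" using w(3) by simp
    have "l \<bullet> vertex l m r = l \<bullet> vertex l m s" using that by simp
    then show "r = s" unfolding vertex_inner(1)[OF ne] by simp
  qed
  define C where "C = (\<Union>x\<in>L \<times> L - {(l, m)}. vertex (fst x) (snd x) ` closure (lifetime (fst x) (snd x))) \<union>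
    cut L (dt T) \<union> {vertex l m (birth l m), vertex l m (death l m)}"
  have "closed (\<Union>x\<in>L \<times> L - {(l, m)}. vertex (fst x) (snd x) ` closure (lifetime (fst x) (snd x)))"
    using fin by (intro closed_UN ballI compact_imp_closed compact_vertex_closure) simp
  then have "closed C" unfolding C_def using closed_cut by (intro closed_Un) auto
  have "piece l m = caustic \<Phi> \<inter> - C"
  proof (intro equalityI subsetI)
    fix p assume "p \<in> piece l m"
    then obtain t where t: "t \<in> {birth l m<..<death l m}" "p = vertex l m t" by (auto simp: piece_def)
    have tl: "t \<in> lifetime l m" using sub t by blast
    have "p \<in> caustic \<Phi>" unfolding caustic_eq using tl t(2) by blast
    moreover have "p \<notin> (\<Union>x\<in>L \<times> L - {(l, m)}. vertex (fst x) (snd x) ` closure (lifetime (fst x) (snd x)))"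
    proof
      assume "p \<in> (\<Union>x\<in>L \<times> L - {(l, m)}. vertex (fst x) (snd x) ` closure (lifetime (fst x) (snd x)))"
      then obtain x where x: "x \<in> L \<times> L - {(l, m)}"
        and px: "p \<in> vertex (fst x) (snd x) ` closure (lifetime (fst x) (snd x))" by (rule UN_E)
      obtain s where s: "s \<in> closure (lifetime (fst x) (snd x))" "p = vertex (fst x) (snd x) s"
        using px by (rule imageE)
      have "fst x = l \<and> snd x = m" using vertex_separated[OF t(1) s(1)] s(2) t(2) by simp
      then have "x = (l, m)" by (simp add: prod_eq_iff)
      then show False using x by simp
    qed
    moreover have "p \<notin> cut L (dt T)" using vertex_not_final[OF tl] t(2) by simp
    moreover have "p \<noteq> vertex l m (birth l m)" "p \<noteq> vertex l m (death l m)"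
      using inj[of t "birth l m"] inj[of t "death l m"] t by auto
    ultimately show "p \<in> caustic \<Phi> \<inter> - C" unfolding C_def by simp
  next
    fix p assume p: "p \<in> caustic \<Phi> \<inter> - C"
    then obtain x y t where xy: "t \<in> lifetime x y" "p = vertex x y t"
      unfolding caustic_eq C_def by blast
    then have L: "x \<in> L" "y \<in> L" using lifetime_normals by blast+
    have "(x, y) = (l, m)"
    proof (rule ccontr)
      assume "(x, y) \<noteq> (l, m)"
      then have "(x, y) \<in> L \<times> L - {(l, m)}" using L by blast
      moreover have "p \<in> vertex (fst (x, y)) (snd (x, y)) ` closure (lifetime (fst (x, y)) (snd (x, y)))"
        using xy closure_subset by auto
      ultimately have "p \<in> C" unfolding C_def by blast
      then show False using p by blast
    qed
    then have "t \<in> {birth l m..death l m}" "p = vertex l m t" using xy lifetime_bounds(3) by blast+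
    moreover have "t \<noteq> birth l m" "t \<noteq> death l m" using p calculation(2) by (auto simp: C_def)
    ultimately show "p \<in> piece l m" unfolding piece_def by force
  qed
  then have "openin (top_of_set (caustic \<Phi>)) (piece l m)"
    using \<open>closed C\<close> unfolding openin_open by (metis open_Compl)
  moreover have "caustic_weight \<Phi> constant_on piece l m"
    unfolding constant_on_def piece_def using caustic_weight_vertex sub by blast
  moreover have "vertex l m (birth l m) \<noteq> vertex l m (death l m)" using inj assms by force
  ultimately show ?thesis
    unfolding caustic_segment_def using piece_eq_open_segment(3)[OF assms] by blast
qed

lemma edge_weight_piece:
  assumes "birth l m < death l m"
  shows "edge_weight \<Phi> (piece l m) = wedge l m"
proof -
  define c where "c = (birth l m + death l m) / 2"
  have "c \<in> {birth l m<..<death l m}" using assms by (auto simp: c_def)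
  then have "vertex l m c \<in> piece l m" "c \<in> lifetime l m"
    using lifetime_bounds(2) unfolding piece_def by blast+
  then show ?thesis
    using edge_weight_eq[OF caustic_segment_piece[OF assms]] caustic_weight_vertex by simp
qed

lemma piece_disjoint:
  assumes "(l', m') \<noteq> (l, m)"
  shows "piece l m \<inter> piece l' m' = {}"
proof -
  have False if p: "p \<in> piece l m" "p \<in> piece l' m'" for p
  proof -
    obtain t s where "t \<in> {birth l m<..<death l m}" "p = vertex l m t"
      "s \<in> {birth l' m'<..<death l' m'}" "p = vertex l' m' s"
      using p by (auto simp: piece_def)
    moreover from this have "s \<in> closure (lifetime l' m')" using lifetime_bounds closure_subset by blast
    ultimately show False using vertex_separated assms by blast
  qed
  then show ?thesis by blast
qed

lemma piece_disjoint_final: "piece l m \<inter> cut L (dt T) = {}"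
  using vertex_not_final lifetime_bounds(2) by (force simp: piece_def)

text \<open>The subdivision \<open>\<F>\<close> of the final set is left open, so that a final point
  (no pieces) and a final segment (one open piece) are treated alike. Besides the finite rest of the
  final set, only birth and death positions remain uncovered.\<close>

lemma caustic_length_via_final_part:
  assumes fin_part: "finite \<F>" and sub: "\<And>I. I \<in> \<F> \<Longrightarrow> I \<subseteq> cut L (dt T)"
    and seg: "\<And>I. I \<in> \<F> \<Longrightarrow> caustic_segment \<Phi> I"
    and rational: "\<And>I. I \<in> \<F> \<Longrightarrow> \<exists>a v. primitive_vec v \<and> I \<subseteq> range (\<lambda>r. a + r *\<^sub>R v)"
    and disj: "\<And>I J. I \<in> \<F> \<Longrightarrow> J \<in> \<F> \<Longrightarrow> I \<noteq> J \<Longrightarrow> I \<inter> J = {}"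
    and cover: "finite (cut L (dt T) - \<Union>\<F>)"
  shows "polygon_caustic_length \<Phi> = (\<Sum>(l, m)\<in>L \<times> L. max 0 (wedge l m) * (death l m - birth l m)) +
    (\<Sum>I\<in>\<F>. edge_weight \<Phi> I * tropical_length I)"
proof -
  define P where "P = {x \<in> L \<times> L. birth (fst x) (snd x) < death (fst x) (snd x)}"
  let ?piece = "\<lambda>x. piece (fst x) (snd x)"
  have finP: "finite P" using fin by (simp add: P_def)
  have ne: "?piece x \<noteq> {}" if "x \<in> P" for x
  proof -
    have "(birth (fst x) (snd x) + death (fst x) (snd x)) / 2 \<in> {birth (fst x) (snd x)<..<death (fst x) (snd x)}"
      using that by (auto simp: P_def)
    then show ?thesis unfolding piece_def by blast
  qed
  have pdisj: "?piece x \<inter> ?piece y = {}" if "x \<noteq> y" for x y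
  proof -
    have "(fst y, snd y) \<noteq> (fst x, snd x)" using that by simp
    then show ?thesis by (rule piece_disjoint)
  qed
  have inj: "inj_on ?piece P"
    using ne pdisj by (intro inj_onI) (metis inf.idem)
  have fdisj: "I \<inter> ?piece x = {}" if "I \<in> \<F>" for I x
    using sub[OF that] piece_disjoint_final by blast
  have "polygon_caustic_length \<Phi> = (\<Sum>I\<in>?piece ` P \<union> \<F>. edge_weight \<Phi> I * tropical_length I)"
  proof (rule polygon_caustic_length_subdivision)
    show "finite (?piece ` P \<union> \<F>)" using finP fin_part by simp
    show "caustic_segment \<Phi> I" if "I \<in> ?piece ` P \<union> \<F>" for I
      using that seg caustic_segment_piece by (auto simp: P_def)
    show "\<exists>a v. primitive_vec v \<and> I \<subseteq> range (\<lambda>r. a + r *\<^sub>R v)" if "I \<in> ?piece ` P \<union> \<F>" for I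
      using that
    proof
      assume "I \<in> ?piece ` P"
      then obtain x where x: "x \<in> P" "I = ?piece x" by blast
      have "birth (fst x) (snd x) < death (fst x) (snd x)" using x by (simp add: P_def)
      from piece_eq_open_segment(1,2)[OF this] show ?thesis unfolding x(2) by blast
    qed (rule rational)
    show "I \<inter> J = {}" if IJ: "I \<in> ?piece ` P \<union> \<F>" "J \<in> ?piece ` P \<union> \<F>" "I \<noteq> J" for I J
      using IJ disj fdisj pdisj by (smt (verit) UnE imageE inf_commute)
    have "caustic \<Phi> - \<Union>(?piece ` P \<union> \<F>) \<subseteq> (\<lambda>x. vertex (fst x) (snd x) (birth (fst x) (snd x))) ` (L \<times> L) \<union>
      (\<lambda>x. vertex (fst x) (snd x) (death (fst x) (snd x))) ` (L \<times> L) \<union> (cut L (dt T) - \<Union>\<F>)" (is "_ \<subseteq> ?R")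
    proof
      fix p assume p: "p \<in> caustic \<Phi> - \<Union>(?piece ` P \<union> \<F>)"
      show "p \<in> ?R"
      proof (cases "p \<in> cut L (dt T)")
        case True
        then show ?thesis using p by blast
      next
        case False
        then obtain l m t where t: "t \<in> lifetime l m" "p = vertex l m t"
          using p unfolding caustic_eq by blast
        then have lm: "l \<in> L" "m \<in> L" "t \<in> lifetime l m" "p = vertex l m t"
          using lifetime_normals by blast+
        have "t \<notin> {birth l m<..<death l m}"
        proof
          assume t: "t \<in> {birth l m<..<death l m}"
          then have "(l, m) \<in> P" using lm by (simp add: P_def)
          moreover have "p \<in> piece l m" using t lm by (simp add: piece_def)
          ultimately show False using p by fastforce
        qed
        then have "t = birth l m \<or> t = death l m" using lifetime_bounds(3)[of l m] lm(3) by fastforce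
        then show ?thesis
        proof
          assume "t = birth l m"
          then have "p = (\<lambda>x. vertex (fst x) (snd x) (birth (fst x) (snd x))) (l, m)" using lm by simp
          then show ?thesis using lm(1,2) by blast
        next
          assume "t = death l m"
          then have "p = (\<lambda>x. vertex (fst x) (snd x) (death (fst x) (snd x))) (l, m)" using lm by simp
          then show ?thesis using lm(1,2) by blast
        qed
      qed
    qed
    then show "finite (caustic \<Phi> - \<Union>(?piece ` P \<union> \<F>))"
      by (rule finite_subset) (use fin cover in auto)
  qed
  also have "\<dots> = (\<Sum>I\<in>?piece ` P. edge_weight \<Phi> I * tropical_length I) + (\<Sum>I\<in>\<F>. edge_weight \<Phi> I * tropical_length I)"
    using finP fin_part fdisj ne by (intro sum.union_disjoint) (auto, metis inf.idem)
  also have "(\<Sum>I\<in>?piece ` P. edge_weight \<Phi> I * tropical_length I) =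
      (\<Sum>x\<in>P. edge_weight \<Phi> (?piece x) * tropical_length (?piece x))"
    using inj by (simp add: sum.reindex)
  also have "\<dots> = (\<Sum>x\<in>P. max 0 (wedge (fst x) (snd x)) * (death (fst x) (snd x) - birth (fst x) (snd x)))"
  proof (rule sum.cong[OF refl])
    fix x assume "x \<in> P"
    then have less: "birth (fst x) (snd x) < death (fst x) (snd x)" by (simp add: P_def)
    then have "(birth (fst x) (snd x) + death (fst x) (snd x)) / 2 \<in> {birth (fst x) (snd x)<..<death (fst x) (snd x)}"
      by auto
    then have "(birth (fst x) (snd x) + death (fst x) (snd x)) / 2 \<in> lifetime (fst x) (snd x)"
      using lifetime_bounds(2) by blast
    then have "wedge (fst x) (snd x) > 0" by (rule lifetime_normals(3))
    then show "edge_weight \<Phi> (?piece x) * tropical_length (?piece x) =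
      max 0 (wedge (fst x) (snd x)) * (death (fst x) (snd x) - birth (fst x) (snd x))"
      using edge_weight_piece[OF less] piece_eq_open_segment(4)[OF less] by simp
  qed
  also have "\<dots> = (\<Sum>x\<in>L \<times> L. max 0 (wedge (fst x) (snd x)) * (death (fst x) (snd x) - birth (fst x) (snd x)))"
  proof (rule sum.mono_neutral_left)
    show "\<forall>x\<in>L \<times> L - P. max 0 (wedge (fst x) (snd x)) * (death (fst x) (snd x) - birth (fst x) (snd x)) = 0"
    proof
      fix x assume "x \<in> L \<times> L - P"
      then have "death (fst x) (snd x) = birth (fst x) (snd x)"
        using lifetime_bounds(1)[of "fst x" "snd x"] unfolding P_def by force
      then show "max 0 (wedge (fst x) (snd x)) * (death (fst x) (snd x) - birth (fst x) (snd x)) = 0" by simp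
    qed
  qed (use fin in \<open>auto simp: P_def\<close>)
  finally show ?thesis by (simp add: case_prod_beta)
qed

lemma polygon_caustic_length_eq:
  "polygon_caustic_length \<Phi> = (\<Sum>(l, m)\<in>L \<times> L. max 0 (wedge l m) * (death l m - birth l m)) +
    2 * tropical_length (cut L (dt T))"
proof (rule final_cases)
  fix p assume p: "cut L (dt T) = {p}"
  have "tropical_length (cut L (dt T)) = 0" using p by (intro tropical_length_degenerate) auto
  then show ?thesis using caustic_length_via_final_part[of "{}"] p by simp
next
  fix l a c assume l: "l \<in> L" "c > 0" and S: "cut L (dt T) = closed_segment a (a + c *\<^sub>R rot l)"
  define b where "b = a + c *\<^sub>R rot l"
  have pl: "primitive_vec l" "primitive_vec (rot l)" using prim l primitive_rot by auto
  have l0: "rot l \<noteq> 0" using pl primitive_vecD by blast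
  have ab: "a \<noteq> b" using l0 l(2) by (simp add: b_def)
  let ?I = "open_segment a b"
  define C where "C = (\<Union>x\<in>L \<times> L. vertex (fst x) (snd x) ` closure (lifetime (fst x) (snd x))) \<union> {a, b}"
  have "closed (\<Union>x\<in>L \<times> L. vertex (fst x) (snd x) ` closure (lifetime (fst x) (snd x)))"
    using fin by (intro closed_UN ballI compact_imp_closed compact_vertex_closure) simp
  then have "closed C" unfolding C_def by (intro closed_Un) auto
  have IS: "?I \<subseteq> cut L (dt T)" unfolding S b_def by (rule segment_open_subset_closed)
  have "?I = caustic \<Phi> \<inter> - C"
  proof (intro equalityI subsetI)
    fix q assume q: "q \<in> ?I"
    have "q \<notin> vertex x y ` closure (lifetime x y)" for x y
    proof
      assume "q \<in> vertex x y ` closure (lifetime x y)"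
      then obtain s where s: "s \<in> closure (lifetime x y)" "q = vertex x y s" by blast
      have "lifetime x y \<noteq> {}" using s(1) by auto
      then have w: "x \<in> L" "y \<in> L" "wedge x y > 0" using lifetime_normals by blast+
      have "d x + T \<le> x \<bullet> q" using q IS w by (auto simp: cut_def)
      then have sT: "s = T"
        using closure_lifetime_vertex(2)[OF s(1)] vertex_inner(1)[of x y s] s(2) w by simp
      \<comment> \<open>A constraint tight inside the final segment is tight at both ends, so its
        normal is parallel to \<open>l\<close>. The two independent normals of a trajectory
        therefore cannot lead to an inner point of the segment.\<close>
      have par: "wedge l z = 0" if z: "z \<in> L" "z \<bullet> q = d z + T" for z
      proof -
        have "a \<in> cut L (dt T)" "b \<in> cut L (dt T)" unfolding S b_def by simp_all
        then have "d z + T \<le> z \<bullet> a" "d z + T \<le> z \<bullet> b" using z(1) by (auto simp: cut_def)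
        from inner_minimal_in_open_segment[OF q z(2) this] have "z \<bullet> a = z \<bullet> b" by simp
        then show ?thesis using l(2) by (simp add: b_def inner_add_right wedge_eq_inner_rot)
      qed
      have "wedge l x = 0" "wedge l y = 0"
        using par vertex_inner[of x y s] w s(2) sT by simp_all
      then have "x = l \<or> x = - l" "y = l \<or> y = - l" using primitive_parallel pl(1) prim w by blast+
      then show False using w(3) by (auto simp: wedge_minus_left wedge_minus_right)
    qed
    moreover have "q \<noteq> a" "q \<noteq> b" using q by (auto simp: open_segment_def)
    moreover have "q \<in> caustic \<Phi>" using IS q unfolding caustic_eq by blast
    ultimately show "q \<in> caustic \<Phi> \<inter> - C" unfolding C_def by auto
  next
    fix q assume q: "q \<in> caustic \<Phi> \<inter> - C"
    have "q \<in> cut L (dt T)"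
    proof (rule ccontr)
      assume "q \<notin> cut L (dt T)"
      then obtain x y t where xy: "t \<in> lifetime x y" "q = vertex x y t"
        using q unfolding caustic_eq by blast
      then have "(x, y) \<in> L \<times> L" using lifetime_normals by blast
      moreover have "q \<in> vertex (fst (x, y)) (snd (x, y)) ` closure (lifetime (fst (x, y)) (snd (x, y)))"
        using xy closure_subset by auto
      ultimately have "q \<in> C" unfolding C_def by blast
      then show False using q by blast
    qed
    then show "q \<in> ?I" using q unfolding S b_def[symmetric] open_segment_def C_def by blast
  qed
  then have "openin (top_of_set (caustic \<Phi>)) ?I"
    using \<open>closed C\<close> unfolding openin_open by (metis open_Compl)
  moreover have weight: "caustic_weight \<Phi> q = 2" if "q \<in> ?I" for q
    using that IS by (auto simp: caustic_weight_def final_set_eq)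
  then have "caustic_weight \<Phi> constant_on ?I" unfolding constant_on_def by blast
  ultimately have seg: "caustic_segment \<Phi> ?I" unfolding caustic_segment_def using ab by blast
  have "infinite ?I" using ab by simp
  then obtain q where "q \<in> ?I" by (metis ex_in_conv finite.emptyI)
  then have "edge_weight \<Phi> ?I = 2" using edge_weight_eq[OF seg] weight by simp
  moreover have "tropical_length ?I = tropical_length (cut L (dt T))"
    unfolding S b_def using tropical_length_open_segment[OF pl(2) l(2)]
      tropical_length_closed_segment[OF pl(2), of c] l(2) by simp
  moreover have "?I \<subseteq> range (\<lambda>r. a + r *\<^sub>R rot l)"
    using open_segment_on_line[OF l0 l(2), of a] by (auto simp: b_def)
  moreover have "finite (cut L (dt T) - \<Union>{?I})"
    by (rule finite_subset[of _ "{a, b}"]) (auto simp: S b_def[symmetric] open_segment_def)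
  ultimately show ?thesis
    using caustic_length_via_final_part[of "{?I}"] IS seg pl(2) by auto
qed

theorem caustic_plus_boundary_length:
  "polygon_caustic_length \<Phi> + polygon_boundary_length (cut L d) =
    12 * final_time \<Phi> + 4 * tropical_length (final_set \<Phi>)"
  using weighted_lifetimes_and_perimeter polygon_caustic_length_eq perimeter_eq_boundary_length[of 0] T_pos
  by (simp add: final_time_eq final_set_eq)

end

section \<open>Compact convex domains\<close>

text \<open>The support function with the sign convention of inner normals: an infimum, since
  half-planes are written as lower bounds.\<close>

definition support :: "(real^2) set \<Rightarrow> real^2 \<Rightarrow> real" where
  "support \<Phi> l = Inf ((\<lambda>x. l \<bullet> x) ` \<Phi>)"

lemma support_attained:
  assumes "compact \<Phi>" "\<Phi> \<noteq> {}"
  obtains p where "p \<in> \<Phi>" "l \<bullet> p = support \<Phi> l" "\<And>x. x \<in> \<Phi> \<Longrightarrow> support \<Phi> l \<le> l \<bullet> x"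
proof -
  have "continuous_on \<Phi> (\<lambda>x. l \<bullet> x)" by (intro continuous_intros)
  then obtain p where p: "p \<in> \<Phi>" "\<And>x. x \<in> \<Phi> \<Longrightarrow> l \<bullet> p \<le> l \<bullet> x"
    using continuous_attains_inf[OF assms] by blast
  then have "support \<Phi> l = l \<bullet> p"
    unfolding support_def by (intro cInf_eq_minimum) auto
  then show ?thesis using that p by simp
qed

lemma support_le:
  assumes "compact \<Phi>" "x \<in> \<Phi>"
  shows "support \<Phi> l \<le> l \<bullet> x"
  using support_attained[OF assms(1), of l] assms(2) by blast

lemma support_greatest:
  assumes "compact \<Phi>" "\<Phi> \<noteq> {}" "\<And>x. x \<in> \<Phi> \<Longrightarrow> c \<le> l \<bullet> x"
  shows "c \<le> support \<Phi> l"
  using support_attained[OF assms(1,2), of l] assms(3) by metis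

lemma support_less_interior:
  assumes "compact \<Phi>" "x \<in> interior \<Phi>" "l \<noteq> 0"
  shows "support \<Phi> l < l \<bullet> x"
proof -
  obtain e where e: "e > 0" "ball x e \<subseteq> \<Phi>" using assms(2) by (auto simp: mem_interior)
  define r where "r = e / (2 * norm l)"
  have r: "r > 0" using e assms by (simp add: r_def)
  have "x - r *\<^sub>R l \<in> ball x e" using e assms by (simp add: dist_norm r_def)
  then have "support \<Phi> l \<le> l \<bullet> (x - r *\<^sub>R l)" using support_le assms(1) e(2) by blast
  moreover have "r * (l \<bullet> l) > 0" using r assms(3) by simp
  ultimately show ?thesis by (simp add: inner_diff_right)
qed

text \<open>For each primitive normal exactly one offset touches: the minimum over the set, attained
  at a boundary point, as the value at an interior point is larger.\<close>

lemma mem_supporting_half_planes: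
  assumes "compact \<Phi>" "\<Phi> \<noteq> {}"
  shows "(l, c) \<in> supporting_half_planes \<Phi> \<longleftrightarrow> primitive_vec l \<and> c = support \<Phi> l"
proof (cases "primitive_vec l")
  case True
  then have l0: "l \<noteq> 0" using primitive_vecD by blast
  have fr: "frontier (half_plane l c) = {x. l \<bullet> x = c}"
    unfolding half_plane_def using frontier_halfspace_ge l0 by blast
  have fr\<Phi>: "frontier \<Phi> = \<Phi> - interior \<Phi>" using compact_imp_closed[OF assms(1)] by (simp add: frontier_def)
  show ?thesis
  proof
    assume "(l, c) \<in> supporting_half_planes \<Phi>"
    then have "\<Phi> \<subseteq> half_plane l c" "{x. l \<bullet> x = c} \<inter> (\<Phi> - interior \<Phi>) \<noteq> {}"
      by (simp_all add: supporting_half_planes_def fr flip: fr\<Phi>)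
    then obtain x where x: "\<Phi> \<subseteq> half_plane l c" "l \<bullet> x = c" "x \<in> \<Phi>"
      by blast
    have "c \<le> support \<Phi> l" using x(1) by (intro support_greatest assms) (auto simp: half_plane_def)
    moreover have "support \<Phi> l \<le> c" using support_le[OF assms(1) x(3)] x(2) by metis
    ultimately show "primitive_vec l \<and> c = support \<Phi> l" using True by simp
  next
    assume c: "primitive_vec l \<and> c = support \<Phi> l"
    obtain p where p: "p \<in> \<Phi>" "l \<bullet> p = support \<Phi> l" "\<And>x. x \<in> \<Phi> \<Longrightarrow> support \<Phi> l \<le> l \<bullet> x"
      using support_attained[OF assms] by blast
    have "p \<notin> interior \<Phi>" using support_less_interior[OF assms(1) _ l0] p(2) by fastforce
    then have "p \<in> frontier (half_plane l c) \<inter> frontier \<Phi>" unfolding fr fr\<Phi> using p c by simp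
    moreover have "\<Phi> \<subseteq> half_plane l c" using p(3) c by (auto simp: half_plane_def)
    ultimately show "(l, c) \<in> supporting_half_planes \<Phi>" using True unfolding supporting_half_planes_def by blast
  qed
qed (auto simp: supporting_half_planes_def)

lemma evolve_iff:
  assumes "compact \<Phi>" "\<Phi> \<noteq> {}"
  shows "p \<in> evolve \<Phi> t \<longleftrightarrow> (\<forall>l. primitive_vec l \<longrightarrow> support \<Phi> l + t \<le> l \<bullet> p)"
proof -
  have "p \<in> evolve \<Phi> t \<longleftrightarrow> (\<forall>l c. (l, c) \<in> supporting_half_planes \<Phi> \<longrightarrow> c + t \<le> l \<bullet> p)"
    unfolding evolve_def half_plane_def by auto
  then show ?thesis by (simp add: mem_supporting_half_planes[OF assms])
qed

lemma evolve_antimono: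
  assumes "compact \<Phi>" "\<Phi> \<noteq> {}" "s \<le> t"
  shows "evolve \<Phi> t \<subseteq> evolve \<Phi> s"
proof
  fix p assume "p \<in> evolve \<Phi> t"
  then have *: "primitive_vec l \<Longrightarrow> support \<Phi> l + t \<le> l \<bullet> p" for l using evolve_iff assms by blast
  show "p \<in> evolve \<Phi> s"
    unfolding evolve_iff[OF assms(1,2)]
  proof (intro allI impI)
    fix l assume "primitive_vec l"
    then show "support \<Phi> l + s \<le> l \<bullet> p" using *[of l] assms(3) by simp
  qed
qed

text \<open>Dirichlet approximation of the slope. The error is absolute although the covector may be
  long, which is stronger than density of rational directions.\<close>

lemma lattice_direction_approx:
  fixes a :: "real^2"
  assumes "a \<noteq> 0" "e > 0"
  obtains l c where "l \<in> lattice_vecs" "l \<noteq> 0" "c > 0" "norm (l - c *\<^sub>R a) < e"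
proof -
  obtain N :: nat where N: "N > 0" "1 / real N < e"
    using reals_Archimedean[OF assms(2)] by (metis inverse_eq_divide of_nat_Suc zero_less_Suc)
  have norm2: "norm x \<le> \<bar>x$1\<bar> + \<bar>x$2\<bar>" for x :: "real^2"
    using norm_le_l1_cart[of x] by (simp add: sum_2)
  have sgn_int: "sgn x \<in> \<int>" for x :: real by (simp add: sgn_if)
  consider "a$1 \<noteq> 0" | "a$2 \<noteq> 0" using assms(1) by (auto simp: vec2_eq_iff)
  then show ?thesis
  proof cases
    case 1
    obtain h k where hk: "0 < k" "\<bar>of_int k * (a$2 / \<bar>a$1\<bar>) - of_int h\<bar> < 1 / real N"
      using Dirichlet_approx[OF N(1), of "a$2 / \<bar>a$1\<bar>"] by metis
    \<comment> \<open>The sign of the first coordinate keeps the multiplier of \<open>a\<close>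
      positive.\<close>
    define l :: "real^2" where "l = vector [of_int k * sgn (a$1), of_int h]"
    have "norm (l - (of_int k / \<bar>a$1\<bar>) *\<^sub>R a) \<le> \<bar>of_int k * (a$2 / \<bar>a$1\<bar>) - of_int h\<bar>"
      by (rule order_trans[OF norm2]) (simp add: l_def sgn_if abs_if)
    then show ?thesis
      using that[of l "of_int k / \<bar>a$1\<bar>"] 1 hk N sgn_int by (auto simp: l_def lattice_vecs_iff vec2_eq_iff sgn_zero_iff)
  next
    case 2
    obtain h k where hk: "0 < k" "\<bar>of_int k * (a$1 / \<bar>a$2\<bar>) - of_int h\<bar> < 1 / real N"
      using Dirichlet_approx[OF N(1), of "a$1 / \<bar>a$2\<bar>"] by metis
    define l :: "real^2" where "l = vector [of_int h, of_int k * sgn (a$2)]"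
    have "norm (l - (of_int k / \<bar>a$2\<bar>) *\<^sub>R a) \<le> \<bar>of_int k * (a$1 / \<bar>a$2\<bar>) - of_int h\<bar>"
      by (rule order_trans[OF norm2]) (simp add: l_def sgn_if abs_if)
    then show ?thesis
      using that[of l "of_int k / \<bar>a$2\<bar>"] 2 hk N sgn_int by (auto simp: l_def lattice_vecs_iff vec2_eq_iff sgn_zero_iff)
  qed
qed

text \<open>A boundary point would be separated by a real covector, which a lattice covector approximates
  up to an arbitrarily small absolute error.\<close>

lemma evolve_subset_interior:
  assumes "compact \<Phi>" "convex \<Phi>" "interior \<Phi> \<noteq> {}" "s > 0"
  shows "evolve \<Phi> s \<subseteq> interior \<Phi>"
proof
  fix p assume p: "p \<in> evolve \<Phi> s"
  have ne: "\<Phi> \<noteq> {}" using assms(3) by auto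
  show "p \<in> interior \<Phi>"
  proof (rule ccontr)
    assume "p \<notin> interior \<Phi>"
    then obtain a b where ab: "a \<noteq> 0" "a \<bullet> p \<le> b" "\<And>x. x \<in> interior \<Phi> \<Longrightarrow> b \<le> a \<bullet> x"
      using separating_hyperplane_sets[of "{p}" "interior \<Phi>"] assms(2,3) convex_interior by auto
    have "closure (interior \<Phi>) \<subseteq> {x. b \<le> a \<bullet> x}"
      using ab(3) by (intro closure_minimal closed_halfspace_ge) auto
    moreover have "closure (interior \<Phi>) = \<Phi>"
      using convex_closure_interior assms compact_imp_closed by (metis closure_closed)
    ultimately have a: "a \<bullet> p \<le> a \<bullet> x" if "x \<in> \<Phi>" for x using that ab(2) by force
    obtain R where R: "\<And>x. x \<in> \<Phi> \<Longrightarrow> norm (x - p) \<le> R"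
    proof -
      obtain B where "\<And>x. x \<in> \<Phi> \<Longrightarrow> norm x \<le> B" using compact_imp_bounded[OF assms(1)] bounded_iff by blast
      then have "norm (x - p) \<le> B + norm p" if "x \<in> \<Phi>" for x
        using norm_triangle_ineq4[of x p] that by force
      then show ?thesis using that by blast
    qed
    have R0: "R \<ge> 0" using R ne norm_ge_zero order_trans by blast
    \<comment> \<open>With this tolerance, replacing a multiple of \<open>a\<close> by
      \<open>l\<close> changes values on differences \<open>x - p\<close>, of norm at most
      \<open>R\<close>, by less than \<open>s\<close>.\<close>
    obtain l c where lc: "l \<in> lattice_vecs" "l \<noteq> 0" "c > 0" "norm (l - c *\<^sub>R a) < s / (R + 1)"
      using lattice_direction_approx[OF ab(1), of "s / (R + 1)"] assms(4) R0 by auto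
    obtain k w where kw: "k \<ge> (1::nat)" "primitive_vec w" "l = real k *\<^sub>R w"
      using lattice_multiple_primitive lc by blast
    obtain x where x: "x \<in> \<Phi>" "w \<bullet> x = support \<Phi> w"
      using support_attained[OF assms(1) ne] by metis
    have "\<bar>(l - c *\<^sub>R a) \<bullet> (x - p)\<bar> \<le> norm (l - c *\<^sub>R a) * norm (x - p)" by (rule Cauchy_Schwarz_ineq2)
    also have "\<dots> \<le> s / (R + 1) * R" using lc(4) R[OF x(1)] assms(4) R0 by (intro mult_mono) auto
    also have "\<dots> < s" using assms(4) R0 by (simp add: field_simps)
    finally have "(l - c *\<^sub>R a) \<bullet> (x - p) > - s" by simp
    moreover have "c * (a \<bullet> (x - p)) \<ge> 0" using a[OF x(1)] lc(3) by (simp add: inner_diff_right)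
    ultimately have "l \<bullet> (x - p) > - s" by (simp add: inner_diff_left)
    then have *: "real k * (w \<bullet> (x - p)) > - s" using kw by simp
    \<comment> \<open>Passing from \<open>l\<close> to its primitive part only brings a negative
      value closer to 0.\<close>
    have "w \<bullet> (x - p) > - s"
    proof (cases "w \<bullet> (x - p) \<ge> 0")
      case False
      then have "real k * (w \<bullet> (x - p)) \<le> 1 * (w \<bullet> (x - p))"
        using kw(1) by (intro mult_right_mono_neg) auto
      then show ?thesis using * by simp
    qed (use assms in simp)
    then have "support \<Phi> w + s > w \<bullet> p" using x by (simp add: inner_diff_right)
    then show False using p evolve_iff[OF assms(1) ne] kw(2) by force
  qed
qed

text \<open>The evolved set keeps a positive distance from the boundary, so near it the constraints
  of long normals hold automatically. It is therefore open as well as closed in the polygon cut out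
  by the short normals, and that polygon is connected.\<close>

lemma evolve_eq_cut_finite:
  assumes "compact \<Phi>" "convex \<Phi>" "interior \<Phi> \<noteq> {}" "s > 0" "evolve \<Phi> s \<noteq> {}"
  obtains L where "finite L" "\<And>l. l \<in> L \<Longrightarrow> primitive_vec l" "evolve \<Phi> s = cut L (\<lambda>l. support \<Phi> l + s)"
proof -
  have ne: "\<Phi> \<noteq> {}" using assms(3) by auto
  have all: "evolve \<Phi> s = cut {l. primitive_vec l} (\<lambda>l. support \<Phi> l + s)"
    unfolding cut_def using evolve_iff[OF assms(1) ne] by auto
  have sub: "evolve \<Phi> s \<subseteq> interior \<Phi>" using evolve_subset_interior assms by blast
  have closed: "closed (evolve \<Phi> s)" unfolding all by (rule closed_cut)
  have "bounded (evolve \<Phi> s)"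
    using sub interior_subset compact_imp_bounded[OF assms(1)] bounded_subset by (metis order_trans)
  then have "compact (evolve \<Phi> s)" using closed compact_eq_bounded_closed by blast
  then obtain \<delta> where \<delta>: "\<delta> > 0" "(\<Union>x\<in>evolve \<Phi> s. ball x \<delta>) \<subseteq> interior \<Phi>"
    using compact_subset_open_imp_ball_epsilon_subset[OF _ open_interior sub] by blast
  \<comment> \<open>In the evolved set a normal \<open>l\<close> has slack at least
    \<open>norm l * \<delta> / 2\<close> over the support. Moving by less than
    \<open>\<delta> / 4\<close> leaves \<open>norm l * \<delta> / 4\<close>, which exceeds
    \<open>s\<close> for normals beyond this bound.\<close>
  define L where "L = {l. primitive_vec l \<and> norm l \<le> 4 * s / \<delta>}"
  let ?C = "cut L (\<lambda>l. support \<Phi> l + s)"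
  have near: "y \<in> evolve \<Phi> s" if x: "x \<in> evolve \<Phi> s" and y: "y \<in> ?C" "dist x y < \<delta> / 4" for x y
    unfolding evolve_iff[OF assms(1) ne]
  proof (intro allI impI)
    fix l assume l: "primitive_vec l"
    show "support \<Phi> l + s \<le> l \<bullet> y"
    proof (cases "l \<in> L")
      case True
      then show ?thesis using y(1) by (simp add: cut_def)
    next
      case False
      then have big: "norm l * \<delta> > 4 * s" using l \<delta>(1) by (simp add: L_def field_simps)
      have l0: "norm l > 0" using l primitive_vecD by simp
      define z where "z = x - (\<delta> / (2 * norm l)) *\<^sub>R l"
      have "z \<in> ball x \<delta>" using \<delta>(1) l0 by (simp add: z_def dist_norm)
      then have "z \<in> \<Phi>" using \<delta>(2) x interior_subset by blast
      then have "support \<Phi> l \<le> l \<bullet> z" by (rule support_le[OF assms(1)])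
      also have "l \<bullet> z = l \<bullet> x - norm l * \<delta> / 2"
        using l0 by (simp add: z_def inner_diff_right power2_norm_eq_inner[symmetric] power2_eq_square)
      finally have "support \<Phi> l + norm l * \<delta> / 2 \<le> l \<bullet> x" by simp
      moreover have "\<bar>l \<bullet> (x - y)\<bar> \<le> norm l * norm (x - y)" by (rule Cauchy_Schwarz_ineq2)
      then have "l \<bullet> x - l \<bullet> y \<le> norm l * norm (x - y)" by (simp add: inner_diff_right)
      moreover have "norm l * norm (x - y) \<le> norm l * (\<delta> / 4)"
        using y(2) l0 by (intro mult_left_mono) (auto simp: dist_norm)
      ultimately show ?thesis using big by simp
    qed
  qed
  have subC: "evolve \<Phi> s \<subseteq> ?C" unfolding all by (auto simp: cut_def L_def)
  have "openin (top_of_set ?C) (evolve \<Phi> s)"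
    unfolding openin_contains_ball
  proof (intro conjI ballI)
    fix x assume "x \<in> evolve \<Phi> s"
    then have "ball x (\<delta> / 4) \<inter> ?C \<subseteq> evolve \<Phi> s" using near by auto
    then show "\<exists>e>0. ball x e \<inter> ?C \<subseteq> evolve \<Phi> s" using \<delta>(1) by (intro exI[of _ "\<delta> / 4"]) simp
  qed (rule subC)
  moreover have "closedin (top_of_set ?C) (evolve \<Phi> s)"
    using closed subC closed_subset by blast
  moreover have "connected ?C" using convex_cut convex_connected by blast
  ultimately have "evolve \<Phi> s = ?C" using assms(5) unfolding connected_clopen by blast
  moreover have "finite L"
    by (rule finite_subset[OF _ finite_lattice_vecs_ball[of "4 * s / \<delta>"]]) (auto simp: L_def primitive_vecD)
  moreover have "primitive_vec l" if "l \<in> L" for l using that by (simp add: L_def)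
  ultimately show ?thesis using that by blast
qed

section \<open>Evolution governed by finitely many normals\<close>

context lattice_polygon
begin

lemma normals_nonempty: "L \<noteq> {}"
  using exists_normal_inner_neg[of "vector [1, 0]"] by (auto simp: vec2_eq_iff)

text \<open>\<open>T\<close> is the maximum of the least slack over the polygon; outside the polygon
  some slack is even negative.\<close>

lemma final_level:
  obtains T where "T > 0" "\<exists>x. \<forall>l\<in>L. d l + T \<le> l \<bullet> x" "\<And>x. \<exists>l\<in>L. l \<bullet> x \<le> d l + T"
proof -
  define f where "f x = Min ((\<lambda>l. l \<bullet> x - d l) ` L)" for x
  have f_le: "f x \<le> l \<bullet> x - d l" if "l \<in> L" for l x
    unfolding f_def using finite_normals that by (intro Min_le) auto
  have f_eq: "\<exists>l\<in>L. f x = l \<bullet> x - d l" for x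
  proof -
    have "f x \<in> (\<lambda>l. l \<bullet> x - d l) ` L"
      unfolding f_def using finite_normals normals_nonempty by (intro Min_in) auto
    then show ?thesis by blast
  qed
  have "continuous_on (cut L d) f"
    unfolding f_def using finite_normals normals_nonempty
    by (intro continuous_on_Min_image continuous_intros)
  then obtain p where p: "p \<in> cut L d" "\<And>x. x \<in> cut L d \<Longrightarrow> f x \<le> f p"
    using continuous_attains_sup[OF compact_cut cut_nonempty] by blast
  obtain x0 where x0: "\<forall>l\<in>L. d l < l \<bullet> x0" using strict_point by blast
  then have x0c: "x0 \<in> cut L d" by (auto simp: cut_def intro: less_imp_le)
  obtain l0 where "l0 \<in> L" "f x0 = l0 \<bullet> x0 - d l0" using f_eq by blast
  then have "f x0 > 0" using x0 by simp
  then have pos: "f p > 0" using p(2)[OF x0c] by simp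
  show ?thesis
  proof (rule that[OF pos])
    have "d l + f p \<le> l \<bullet> p" if "l \<in> L" for l using f_le[OF that, of p] by simp
    then show "\<exists>x. \<forall>l\<in>L. d l + f p \<le> l \<bullet> x" by blast
    fix x
    show "\<exists>l\<in>L. l \<bullet> x \<le> d l + f p"
    proof (cases "x \<in> cut L d")
      case True
      obtain l where "l \<in> L" "f x = l \<bullet> x - d l" using f_eq by blast
      then show ?thesis using p(2)[OF True] by (intro bexI[of _ l]) simp_all
    next
      case False
      then obtain l where "l \<in> L" "l \<bullet> x < d l" by (auto simp: cut_def not_le)
      then show ?thesis using pos by (intro bexI[of _ l]) simp_all
    qed
  qed
qed

end

text \<open>The constraint of a lattice covector inside the cone at a vertex moves no slower than the
  vertex, so the cone has no primitive covector below the side \<open>[l, m]\<close>.\<close>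

lemma corner_cone_empty:
  assumes \<Phi>: "compact \<Phi>" "\<Phi> \<noteq> {}" and d: "\<And>l x. l \<in> L \<Longrightarrow> x \<in> \<Phi> \<Longrightarrow> d l \<le> l \<bullet> x"
    and t: "t > 0" and c: "corner_at L (\<lambda>l. d l + t) p l m" and p: "p \<in> evolve \<Phi> t"
    and x: "primitive_vec x" "\<alpha> \<ge> 0" "\<beta> \<ge> 0" "x = \<alpha> *\<^sub>R l + \<beta> *\<^sub>R m"
  shows "\<alpha> + \<beta> \<ge> 1"
proof -
  have lm: "l \<in> L" "m \<in> L" "l \<bullet> p = d l + t" "m \<bullet> p = d m + t"
    using c by (auto simp: corner_at_def active_def)
  have "\<alpha> * d l + \<beta> * d m \<le> support \<Phi> x"
  proof (rule support_greatest[OF \<Phi>])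
    fix y assume "y \<in> \<Phi>"
    then have "\<alpha> * d l \<le> \<alpha> * (l \<bullet> y)" "\<beta> * d m \<le> \<beta> * (m \<bullet> y)"
      using d lm x by (auto intro: mult_left_mono)
    then show "\<alpha> * d l + \<beta> * d m \<le> x \<bullet> y" by (simp add: x(4) inner_add_left)
  qed
  moreover have "support \<Phi> x + t \<le> x \<bullet> p" using p evolve_iff[OF \<Phi>] x(1) by blast
  moreover have "x \<bullet> p = \<alpha> * (d l + t) + \<beta> * (d m + t)" by (simp add: x(4) inner_add_left lm)
  ultimately have "1 * t \<le> (\<alpha> + \<beta>) * t" by (simp add: algebra_simps)
  then show ?thesis using t mult_le_cancel_right_pos by blast
qed

text \<open>Once finitely many normals describe the whole evolution, emptiness of the cones is
  automatic: each corner at a positive time belongs to the evolved set and so satisfies the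
  constraints of all primitive covectors.\<close>

lemma evolving_polygonI:
  assumes poly: "lattice_polygon L d" and \<Phi>: "\<Phi> \<noteq> {}" "compact \<Phi>" "\<Phi> \<subseteq> cut L d"
    and evolve: "\<And>t. 0 \<le> t \<Longrightarrow> evolve \<Phi> t = cut L (\<lambda>l. d l + t)"
  obtains T where "evolving_polygon L d T \<Phi>"
proof -
  interpret lattice_polygon L d by fact
  obtain T where T: "T > 0" "\<exists>x. \<forall>l\<in>L. d l + T \<le> l \<bullet> x" "\<And>x. \<exists>l\<in>L. l \<bullet> x \<le> d l + T"
    using final_level by blast
  have "evolving_polygon L d T \<Phi>"
  proof
    fix t l m x \<alpha> \<beta>
    assume t: "0 < t" "t < T" and lm: "(l, m) \<in> corners L (\<lambda>l. d l + t)"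
      and x: "primitive_vec x" "0 \<le> \<alpha>" "0 \<le> \<beta>" "x = \<alpha> *\<^sub>R l + \<beta> *\<^sub>R m"
    obtain p where p: "corner_at L (\<lambda>l. d l + t) p l m" using lm by (auto simp: corners_def)
    then have "p \<in> evolve \<Phi> t" using evolve t by (simp add: corner_at_def)
    moreover have "d l \<le> l \<bullet> y" if "l \<in> L" "y \<in> \<Phi>" for l y using \<Phi>(3) that by (auto simp: cut_def)
    ultimately show "1 \<le> \<alpha> + \<beta>" using corner_cone_empty[OF \<Phi>(2,1) _ t(1) p _ x] by blast
  qed (use finite_normals primitive_normals bounded_cut T evolve in auto)
  then show ?thesis using that by blast
qed

text \<open>A point of the later set at time \<open>s'\<close> satisfies the constraints at time
  \<open>s\<close> strictly.\<close>

lemma lattice_polygon_evolve: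
  assumes "compact \<Phi>" "convex \<Phi>" "interior \<Phi> \<noteq> {}" "0 < s" "s < s'" "evolve \<Phi> s' \<noteq> {}"
  obtains L where "lattice_polygon L (\<lambda>l. support \<Phi> l + s)" "evolve \<Phi> s = cut L (\<lambda>l. support \<Phi> l + s)"
proof -
  have ne: "\<Phi> \<noteq> {}" using assms(3) by auto
  have "evolve \<Phi> s \<noteq> {}" using evolve_antimono[OF assms(1) ne, of s s'] assms by auto
  then obtain L where L: "finite L" "\<And>l. l \<in> L \<Longrightarrow> primitive_vec l" "evolve \<Phi> s = cut L (\<lambda>l. support \<Phi> l + s)"
    using evolve_eq_cut_finite[OF assms(1-4)] by metis
  have "lattice_polygon L (\<lambda>l. support \<Phi> l + s)"
  proof
    have "evolve \<Phi> s \<subseteq> \<Phi>" using evolve_subset_interior[OF assms(1-4)] interior_subset by blast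
    then show "bounded (cut L (\<lambda>l. support \<Phi> l + s))"
      using compact_imp_bounded[OF assms(1)] bounded_subset unfolding L(3) by blast
    obtain x where "x \<in> evolve \<Phi> s'" using assms(6) by blast
    then have "\<forall>l\<in>L. support \<Phi> l + s' \<le> l \<bullet> x" using evolve_iff[OF assms(1) ne] L(2) by blast
    then have "\<forall>l\<in>L. support \<Phi> l + s < l \<bullet> x" using assms(5) by force
    then show "\<exists>x. \<forall>l\<in>L. support \<Phi> l + s < l \<bullet> x" by blast
  qed (use L in auto)
  then show ?thesis using that L(3) by blast
qed

text \<open>Semigroup property of the evolution, by linear programming duality at the vertices of
  \<open>evolve \<Phi> s\<close>.\<close>

lemma evolving_polygon_evolve:
  assumes \<Phi>: "compact \<Phi>" "convex \<Phi>" "interior \<Phi> \<noteq> {}" and s: "0 < s" "s < s'" "evolve \<Phi> s' \<noteq> {}"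
  obtains L T where "evolving_polygon L (\<lambda>l. support \<Phi> l + s) T (evolve \<Phi> s)"
    "evolve \<Phi> s = cut L (\<lambda>l. support \<Phi> l + s)" "\<And>t. t \<ge> 0 \<Longrightarrow> evolve (evolve \<Phi> s) t = evolve \<Phi> (s + t)"
proof -
  have ne: "\<Phi> \<noteq> {}" using \<Phi>(3) by auto
  let ?d = "\<lambda>l. support \<Phi> l + s"
  obtain L where poly: "lattice_polygon L ?d" and eq: "evolve \<Phi> s = cut L ?d"
    using lattice_polygon_evolve[OF assms] by metis
  interpret lattice_polygon L ?d by fact
  let ?S = "evolve \<Phi> s"
  have S: "compact ?S" "?S \<noteq> {}" unfolding eq using compact_cut cut_nonempty by blast+
  have support_S: "support \<Phi> l + s \<le> support ?S l" if "primitive_vec l" for l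
    using evolve_iff[OF \<Phi>(1) ne] that by (intro support_greatest S) blast
  \<comment> \<open>The inclusions close up to a cycle through the three descriptions of the set.
    The third one needs the vertices.\<close>
  have step1: "evolve ?S t \<subseteq> evolve \<Phi> (s + t)" for t
  proof
    fix q assume q: "q \<in> evolve ?S t"
    show "q \<in> evolve \<Phi> (s + t)"
      unfolding evolve_iff[OF \<Phi>(1) ne]
    proof (intro allI impI)
      fix l assume l: "primitive_vec l"
      then have "support ?S l + t \<le> l \<bullet> q" using q evolve_iff[OF S] by blast
      then show "support \<Phi> l + (s + t) \<le> l \<bullet> q" using support_S[OF l] by simp
    qed
  qed
  have step2: "evolve \<Phi> (s + t) \<subseteq> cut L (\<lambda>l. ?d l + t)" for t
  proof
    fix q assume q: "q \<in> evolve \<Phi> (s + t)"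
    have "support \<Phi> l + s + t \<le> l \<bullet> q" if "l \<in> L" for l
    proof -
      have "support \<Phi> l + (s + t) \<le> l \<bullet> q"
        using q evolve_iff[OF \<Phi>(1) ne] primitive_normals[OF that] by blast
      then show ?thesis by simp
    qed
    then show "q \<in> cut L (\<lambda>l. ?d l + t)" by (simp add: cut_def)
  qed
  have step3: "cut L (\<lambda>l. ?d l + t) \<subseteq> evolve ?S t" if t: "t \<ge> 0" for t
  proof
    fix q assume q: "q \<in> cut L (\<lambda>l. ?d l + t)"
    show "q \<in> evolve ?S t"
      unfolding evolve_iff[OF S]
    proof (intro allI impI)
      fix z assume z: "primitive_vec z"
      obtain p l m \<alpha> \<beta> where c: "corner_at L ?d p l m"
        and ab: "\<alpha> \<ge> 0" "\<beta> \<ge> 0" and zeq: "z = \<alpha> *\<^sub>R l + \<beta> *\<^sub>R m"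
        using vertex_cone_decomposition by metis
      have lm: "l \<in> L" "m \<in> L" "l \<bullet> p = ?d l" "m \<bullet> p = ?d m" "p \<in> ?S"
        using c eq by (auto simp: corner_at_def active_def)
      \<comment> \<open>The corner belongs to the evolution of \<open>\<Phi>\<close> at the positive
        time \<open>s\<close>, so its cone is empty. The two constraints then advance
        \<open>z\<close> by at least \<open>t\<close>.\<close>
      have "\<alpha> + \<beta> \<ge> 1"
        by (rule corner_cone_empty[OF \<Phi>(1) ne _ s(1) c lm(5) z ab zeq]) (rule support_le[OF \<Phi>(1)])
      then have "1 * t \<le> (\<alpha> + \<beta>) * t" using t by (rule mult_right_mono)
      moreover have "?d l + t \<le> l \<bullet> q" "?d m + t \<le> m \<bullet> q" using q lm by (auto simp: cut_def)
      then have "\<alpha> * (?d l + t) \<le> \<alpha> * (l \<bullet> q)" "\<beta> * (?d m + t) \<le> \<beta> * (m \<bullet> q)"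
        using ab by (auto intro: mult_left_mono)
      moreover have "z \<bullet> q = \<alpha> * (l \<bullet> q) + \<beta> * (m \<bullet> q)" "z \<bullet> p = \<alpha> * ?d l + \<beta> * ?d m"
        by (simp_all add: zeq inner_add_left lm)
      ultimately have "z \<bullet> p + t \<le> z \<bullet> q" by (simp add: algebra_simps)
      then show "support ?S z + t \<le> z \<bullet> q" using support_le[OF S(1) lm(5), of z] by simp
    qed
  qed
  have all: "evolve ?S t = cut L (\<lambda>l. ?d l + t)" "evolve ?S t = evolve \<Phi> (s + t)" if "t \<ge> 0" for t
    using step1[of t] step2[of t] step3[OF that] by blast+
  obtain T where "evolving_polygon L ?d T ?S"
    using evolving_polygonI[OF poly S(2,1) _ all(1)] eq by blast
  then show ?thesis using that eq all(2) by blast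
qed

section \<open>Polygons with rational slopes\<close>

text \<open>The facet is exposed by a real covector \<open>a\<close>. As \<open>a\<close>
  annihilates the primitive direction \<open>v\<close> of the facet, it is a multiple of
  \<open>rot v\<close>, whose sign is chosen to give an inner normal.\<close>

lemma rational_facet_normal:
  assumes \<Phi>: "rational_polygon \<Phi>" and F: "F facet_of \<Phi>"
  obtains l where "primitive_vec l" "F \<subseteq> {x. l \<bullet> x = support \<Phi> l}"
proof -
  have poly: "polytope \<Phi>" "interior \<Phi> \<noteq> {}" using \<Phi> by (auto simp: rational_polygon_def)
  have comp: "compact \<Phi>" using polytope_imp_compact poly(1) by blast
  have "aff_dim \<Phi> = 2" using aff_dim_nonempty_interior[OF poly(2)] by simp
  then have F': "F face_of \<Phi>" "F \<noteq> {}" "aff_dim F = 1" using F by (auto simp: facet_of_def)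
  then have "F edge_of \<Phi>" by (simp add: edge_of_def)
  then obtain v where v: "primitive_vec v" "parallel_to F v" using \<Phi> by (auto simp: rational_polygon_def)
  have "F exposed_face_of \<Phi>"
    using exposed_face_of_polyhedron polytope_imp_polyhedron poly(1) F'(1) by blast
  then obtain a b where ab: "\<Phi> \<subseteq> {x. a \<bullet> x \<le> b}" "F = \<Phi> \<inter> {x. a \<bullet> x = b}"
    unfolding exposed_face_of_def by blast
  have ex: "\<exists>x\<in>F. \<exists>y\<in>F. x \<noteq> y"
  proof (rule ccontr)
    assume "\<not> ?thesis"
    then obtain p where "F \<subseteq> {p}" using F'(2) by blast
    then show False using aff_dim_subset[of F "{p}"] F'(3) by simp
  qed
  then obtain x y where xy: "x \<in> F" "y \<in> F" "x \<noteq> y" by blast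
  obtain r where r: "x - y = r *\<^sub>R v" using v(2) xy unfolding parallel_to_def span_singleton by blast
  have "a \<bullet> (x - y) = 0" using xy ab(2) by (simp add: inner_diff_right)
  then have "v \<bullet> a = 0" using r xy(3) by (auto simp: inner_commute)
  then obtain k where k: "a = k *\<^sub>R rot v"
    using orthogonal_imp_multiple_rot primitive_vecD(2)[OF v(1)] by blast
  have "k \<noteq> 0"
  proof
    assume "k = 0"
    then have "F = \<Phi>" using k ab xy(1) by auto
    then show False using F'(3) \<open>aff_dim \<Phi> = 2\<close> by simp
  qed
  define l where "l = - sgn k *\<^sub>R rot v"
  have l: "primitive_vec l"
    using \<open>k \<noteq> 0\<close> primitive_rot[OF v(1)] primitive_minus by (auto simp: l_def sgn_if)
  have la: "a = - \<bar>k\<bar> *\<^sub>R l" using k by (simp add: l_def abs_sgn mult.commute)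
  have min: "l \<bullet> z \<le> l \<bullet> w" if "z \<in> F" "w \<in> \<Phi>" for z w
  proof -
    have "a \<bullet> w \<le> a \<bullet> z" using ab that by auto
    then show ?thesis using \<open>k \<noteq> 0\<close> by (simp add: la)
  qed
  have ne: "\<Phi> \<noteq> {}" using poly(2) by auto
  have "l \<bullet> z = support \<Phi> l" if z: "z \<in> F" for z
  proof (rule antisym)
    show "l \<bullet> z \<le> support \<Phi> l" using min[OF z] by (intro support_greatest comp ne)
    show "support \<Phi> l \<le> l \<bullet> z" using z ab(2) by (intro support_le comp) auto
  qed
  then show ?thesis using that l by blast
qed

text \<open>A segment from an interior point to an outer point crosses the boundary in a facet. The
  facet constraint is strict at the start and tight at the crossing, so it fails at the outer
  point.\<close>

lemma rational_polygon_eq_cut: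
  assumes \<Phi>: "rational_polygon \<Phi>"
  obtains L where "finite L" "\<And>l. l \<in> L \<Longrightarrow> primitive_vec l" "\<Phi> = cut L (support \<Phi>)"
proof -
  have poly: "polytope \<Phi>" "interior \<Phi> \<noteq> {}" using \<Phi> by (auto simp: rational_polygon_def)
  have comp: "compact \<Phi>" using polytope_imp_compact poly(1) by blast
  have "\<forall>F\<in>{F. F facet_of \<Phi>}. \<exists>l. primitive_vec l \<and> F \<subseteq> {x. l \<bullet> x = support \<Phi> l}"
    using rational_facet_normal[OF \<Phi>] by (metis mem_Collect_eq)
  from bchoice[OF this] obtain n where
    n: "\<forall>F\<in>{F. F facet_of \<Phi>}. primitive_vec (n F) \<and> F \<subseteq> {x. n F \<bullet> x = support \<Phi> (n F)}" ..
  define L where "L = n ` {F. F facet_of \<Phi>}"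
  have "cut L (support \<Phi>) \<subseteq> \<Phi>"
  proof
    fix q assume q: "q \<in> cut L (support \<Phi>)"
    show "q \<in> \<Phi>"
    proof (rule ccontr)
      assume "q \<notin> \<Phi>"
      obtain q0 where q0: "q0 \<in> interior \<Phi>" using poly(2) by blast
      then have "q0 \<in> \<Phi>" using interior_subset by blast
      then have "closed_segment q0 q \<inter> frontier \<Phi> \<noteq> {}"
        using \<open>q \<notin> \<Phi>\<close> by (intro connected_Int_frontier) auto
      then obtain x where x: "x \<in> closed_segment q0 q" "x \<in> frontier \<Phi>" by blast
      then have "x \<in> \<Phi> - rel_interior \<Phi>"
        using compact_imp_closed[OF comp] rel_interior_nonempty_interior[OF poly(2)] by (simp add: frontier_def)
      then obtain F where F: "F facet_of \<Phi>" "x \<in> F"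
        using rel_boundary_of_polyhedron polytope_imp_polyhedron[OF poly(1)] by blast
      define l where "l = n F"
      have l: "primitive_vec l" "l \<bullet> x = support \<Phi> l" "l \<in> L" using n F unfolding l_def L_def by blast+
      have "x \<noteq> q0" using x(2) q0 by (auto simp: frontier_def)
      moreover have "x \<noteq> q" using x(2) \<open>q \<notin> \<Phi>\<close> compact_imp_closed[OF comp] by (auto simp: frontier_def)
      ultimately have "x \<in> open_segment q0 q" using x(1) by (simp add: open_segment_def)
      moreover have lt: "support \<Phi> l < l \<bullet> q0" using support_less_interior[OF comp q0] l primitive_vecD by blast
      moreover have "support \<Phi> l \<le> l \<bullet> q" using q l(3) by (simp add: cut_def)
      ultimately show False using inner_minimal_in_open_segment(1)[of x q0 q l] l(2) by simp
    qed
  qed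
  moreover have "\<Phi> \<subseteq> cut L (support \<Phi>)" using support_le[OF comp] by (auto simp: cut_def)
  moreover have "finite L" unfolding L_def using finite_polyhedron_facets polytope_imp_polyhedron[OF poly(1)] by blast
  moreover have "primitive_vec l" if "l \<in> L" for l using that n unfolding L_def by blast
  ultimately show ?thesis using that by blast
qed

text \<open>Every lattice covector of a vertex cone is a sum of the two normals and a covector of the
  fundamental parallelogram, so finitely many normals govern the evolution from time \<open>0\<close> on.\<close>

lemma evolving_polygon_rational:
  assumes \<Phi>: "rational_polygon \<Phi>"
  obtains L T where "evolving_polygon L (support \<Phi>) T \<Phi>" "\<Phi> = cut L (support \<Phi>)"
proof -
  have poly: "polytope \<Phi>" "interior \<Phi> \<noteq> {}" using \<Phi> by (auto simp: rational_polygon_def)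
  have comp: "compact \<Phi>" using polytope_imp_compact poly(1) by blast
  have ne: "\<Phi> \<noteq> {}" using poly(2) by auto
  obtain L0 where L0: "finite L0" "\<And>l. l \<in> L0 \<Longrightarrow> primitive_vec l" "\<Phi> = cut L0 (support \<Phi>)"
    using rational_polygon_eq_cut[OF \<Phi>] by metis
  define R where "R = (\<Sum>l\<in>L0. norm l)"
  \<comment> \<open>A combination of two normals in \<open>L0\<close> with coefficients in [0, 1)
    has norm at most \<open>2 * R\<close>, so its primitive part lies in \<open>L\<close>.\<close>
  define L where "L = {l. primitive_vec l \<and> norm l \<le> 2 * R}"
  have R: "norm l \<le> R" if "l \<in> L0" for l
    using member_le_sum[OF that, of norm] L0(1) by (simp add: R_def)
  have "R \<ge> 0" by (simp add: R_def sum_nonneg)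
  have finL: "finite L"
    by (rule finite_subset[OF _ finite_lattice_vecs_ball[of "2 * R"]]) (auto simp: L_def primitive_vecD)
  have "L0 \<subseteq> L" using R L0(2) \<open>R \<ge> 0\<close> by (force simp: L_def)
  then have "cut L (support \<Phi>) \<subseteq> \<Phi>" by (subst L0(3)) (auto simp: cut_def)
  moreover have "\<Phi> \<subseteq> cut L (support \<Phi>)" using support_le[OF comp] by (auto simp: cut_def)
  ultimately have eq: "\<Phi> = cut L (support \<Phi>)" by blast
  obtain x0 where x0: "x0 \<in> interior \<Phi>" using poly(2) by blast
  have strict: "support \<Phi> l < l \<bullet> x0" if "primitive_vec l" for l
    using support_less_interior[OF comp x0] primitive_vecD(2)[OF that] by blast
  have bdd: "bounded \<Phi>" using compact_imp_bounded comp by blast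
  interpret P: lattice_polygon L0 "support \<Phi>"
    using L0 strict bdd by unfold_locales auto
  have polyL: "lattice_polygon L (support \<Phi>)"
    using finL strict bdd eq by unfold_locales (auto simp: L_def)
  have "evolve \<Phi> t = cut L (\<lambda>l. support \<Phi> l + t)" if t: "t \<ge> 0" for t
  proof (intro equalityI subsetI)
    fix q assume "q \<in> evolve \<Phi> t"
    then show "q \<in> cut L (\<lambda>l. support \<Phi> l + t)"
      using evolve_iff[OF comp ne] by (auto simp: cut_def L_def)
  next
    fix q assume "q \<in> cut L (\<lambda>l. support \<Phi> l + t)"
    then have q: "support \<Phi> l + t \<le> l \<bullet> q" if "l \<in> L" for l using that by (simp add: cut_def)
    show "q \<in> evolve \<Phi> t"
      unfolding evolve_iff[OF comp ne]
    proof (intro allI impI)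
      fix z assume z: "primitive_vec z"
      obtain p l m \<alpha> \<beta> where c: "corner_at L0 (support \<Phi>) p l m"
        and ab: "\<alpha> \<ge> 0" "\<beta> \<ge> 0" and zeq: "z = \<alpha> *\<^sub>R l + \<beta> *\<^sub>R m"
        using P.vertex_cone_decomposition by metis
      have lm: "l \<in> L0" "m \<in> L0" "l \<bullet> p = support \<Phi> l" "m \<bullet> p = support \<Phi> m"
        using c by (auto simp: corner_at_def active_def)
      have "p \<in> cut L0 (support \<Phi>)" using c by (simp add: corner_at_def)
      then have p: "p \<in> \<Phi>" using L0(3) by simp
      define i j where "i = \<lfloor>\<alpha>\<rfloor>" and "j = \<lfloor>\<beta>\<rfloor>"
      have ij: "i \<ge> 0" "j \<ge> 0" using ab by (simp_all add: i_def j_def)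
      define r where "r = frac \<alpha> *\<^sub>R l + frac \<beta> *\<^sub>R m"
      have zr: "z = of_int i *\<^sub>R l + of_int j *\<^sub>R m + r"
        by (simp add: zeq r_def i_def j_def frac_def algebra_simps)
      then have "r = z - of_int i *\<^sub>R l - of_int j *\<^sub>R m" by simp
      then have lat: "r \<in> lattice_vecs"
        using primitive_vecD(1) z L0(2) lm by (auto intro!: lattice_vecs_diff lattice_vecs_scale)
      have rem: "r \<bullet> p + t \<le> r \<bullet> q" if "r \<noteq> 0"
      proof -
        obtain k w where kw: "k \<ge> (1::nat)" "primitive_vec w" "r = real k *\<^sub>R w"
          using lattice_multiple_primitive[OF lat \<open>r \<noteq> 0\<close>] .
        have "norm r \<le> frac \<alpha> * norm l + frac \<beta> * norm m"
          unfolding r_def by (rule order_trans[OF norm_triangle_ineq]) simp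
        also have "\<dots> \<le> 1 * R + 1 * R"
          using R[OF lm(1)] R[OF lm(2)] frac_lt_1[of \<alpha>] frac_lt_1[of \<beta>]
          by (intro add_mono mult_mono) auto
        finally have "norm r \<le> 2 * R" by simp
        moreover have "1 * norm w \<le> real k * norm w" using kw(1) by (intro mult_right_mono) auto
        then have "norm w \<le> norm r" using kw by simp
        ultimately have "w \<in> L" using kw(2) by (simp add: L_def)
        have "w \<bullet> p \<le> support \<Phi> w"
        proof (rule support_greatest[OF comp ne])
          fix y assume y: "y \<in> \<Phi>"
          have "l \<bullet> p \<le> l \<bullet> y" "m \<bullet> p \<le> m \<bullet> y" using support_le[OF comp y] lm by metis+
          then have "frac \<alpha> * (l \<bullet> p) \<le> frac \<alpha> * (l \<bullet> y)" "frac \<beta> * (m \<bullet> p) \<le> frac \<beta> * (m \<bullet> y)"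
            by (auto intro: mult_left_mono)
          then have "r \<bullet> p \<le> r \<bullet> y" by (simp add: r_def inner_add_left)
          then show "w \<bullet> p \<le> w \<bullet> y" using kw by simp
        qed
        then have wt: "w \<bullet> p + t \<le> w \<bullet> q" using q[OF \<open>w \<in> L\<close>] by simp
        then have "real k * (w \<bullet> p + t) \<le> real k * (w \<bullet> q)" by (intro mult_left_mono) auto
        moreover have "1 * t \<le> real k * t" using kw(1) t by (intro mult_right_mono) auto
        ultimately show ?thesis using kw by (simp add: algebra_simps)
      qed
      have lq: "l \<bullet> p + t \<le> l \<bullet> q" "m \<bullet> p + t \<le> m \<bullet> q"
        using q lm \<open>L0 \<subseteq> L\<close> by auto
      have "of_int i * (l \<bullet> p + t) \<le> of_int i * (l \<bullet> q)" "of_int j * (m \<bullet> p + t) \<le> of_int j * (m \<bullet> q)"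
        using lq ij by (auto intro!: mult_left_mono)
      then have main: "z \<bullet> p + (of_int i + of_int j) * t + (r \<bullet> q - r \<bullet> p) \<le> z \<bullet> q"
        by (simp add: zr inner_add_left algebra_simps)
      have "z \<bullet> p + t \<le> z \<bullet> q"
      proof (cases "r = 0")
        case True
        \<comment> \<open>One full unit of \<open>t\<close> has to come from some summand: without a
          remainder it comes from the integer parts, otherwise from the remainder.\<close>
        then have "i \<noteq> 0 \<or> j \<noteq> 0" using zr primitive_vecD(2)[OF z] by auto
        then have "i + j \<ge> 1" using ij by linarith
        then have "(1::real) \<le> of_int i + of_int j" by (metis of_int_1_le_iff of_int_add)
        then have "1 * t \<le> (of_int i + of_int j) * t" using t by (rule mult_right_mono)
        then show ?thesis using main True by simp
      next
        case False
        have "(of_int i + of_int j) * t \<ge> 0" using ij t by simp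
        then show ?thesis using main rem[OF False] by linarith
      qed
      then show "support \<Phi> z + t \<le> z \<bullet> q" using support_le[OF comp p, of z] by simp
    qed
  qed
  then obtain T where "evolving_polygon L (support \<Phi>) T \<Phi>"
    using evolving_polygonI[OF polyL ne comp] eq by blast
  then show ?thesis using that eq by blast
qed

section \<open>The limit of the lengths\<close>

text \<open>Primitive normals have norm at least 1, so at the center of a ball of radius
  \<open>e\<close> inside the set every constraint has slack at least \<open>e / 2\<close>.\<close>

lemma evolve_nonempty:
  assumes "compact \<Phi>" "interior \<Phi> \<noteq> {}"
  obtains r where "r > 0" "evolve \<Phi> r \<noteq> {}"
proof -
  have ne: "\<Phi> \<noteq> {}" using assms(2) by auto
  obtain x e where e: "e > 0" "ball x e \<subseteq> \<Phi>" using assms(2) by (metis ex_in_conv mem_interior)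
  have "x \<in> evolve \<Phi> (e / 2)"
    unfolding evolve_iff[OF assms(1) ne]
  proof (intro allI impI)
    fix l assume l: "primitive_vec l"
    have n: "norm l \<ge> 1" using primitive_norm_ge_1[OF l] .
    define z where "z = x - (e / (2 * norm l)) *\<^sub>R l"
    have "z \<in> ball x e" using e n by (auto simp: z_def dist_norm)
    then have "support \<Phi> l \<le> l \<bullet> z" using support_le assms(1) e(2) by blast
    also have "l \<bullet> z = l \<bullet> x - e / 2 * norm l"
      using n by (auto simp: z_def inner_diff_right power2_norm_eq_inner[symmetric] power2_eq_square)
    finally have "support \<Phi> l + e / 2 * norm l \<le> l \<bullet> x" by simp
    moreover have "e / 2 * 1 \<le> e / 2 * norm l" using n e by (intro mult_left_mono) auto
    ultimately show "support \<Phi> l + e / 2 \<le> l \<bullet> x" by simp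
  qed
  then show ?thesis using that[of "e / 2"] e by auto
qed

lemma (in evolving_polygon) perimeter_nonneg: "perimeter t \<ge> 0"
  unfolding perimeter_def start.chord_def by (intro sum_nonneg) auto

lemma (in evolving_polygon) nonempty_imp_le_final:
  assumes "cut L (dt t) \<noteq> {}"
  shows "t \<le> T"
proof -
  obtain x where x: "x \<in> cut L (dt t)" using assms by blast
  obtain l where "l \<in> L" "l \<bullet> x \<le> d l + T" using top_maximal by blast
  then show ?thesis using x by (force simp: cut_def)
qed

text \<open>The formula for the polygon at time \<open>s\<close> is carried back to
  \<open>\<Phi>\<close>: the final set is the same and the final time differs by \<open>s\<close>. A
  time \<open>s0\<close> with nonempty set bounds the final time from below, so that
  \<open>L\<close> for time \<open>s\<close> covers all \<open>t\<close> up to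
  \<open>s0\<close>.\<close>

lemma evolution_lengths:
  assumes \<Phi>: "compact \<Phi>" "convex \<Phi>" "interior \<Phi> \<noteq> {}"
  obtains s0 where "s0 > 0"
    "\<And>s. 0 < s \<Longrightarrow> s < s0 \<Longrightarrow>
      polygon_caustic_length (evolve \<Phi> s) + polygon_boundary_length (evolve \<Phi> s) =
        12 * (final_time \<Phi> - s) + 4 * tropical_length (final_set \<Phi>) \<and>
      polygon_boundary_length (evolve \<Phi> s) \<ge> 0 \<and>
      (\<forall>t. s \<le> t \<and> t < s0 \<longrightarrow> polygon_boundary_length (evolve \<Phi> s) + 12 * s \<le>
        polygon_boundary_length (evolve \<Phi> t) + 12 * t)"
proof -
  have ne: "\<Phi> \<noteq> {}" using \<Phi>(3) by auto
  obtain s0 where s0: "s0 > 0" "evolve \<Phi> s0 \<noteq> {}" using evolve_nonempty[OF \<Phi>(1,3)] .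
  show ?thesis
  proof (rule that[OF s0(1)])
    fix s assume s: "0 < s" "s < s0"
    obtain L T where E: "evolving_polygon L (\<lambda>l. support \<Phi> l + s) T (evolve \<Phi> s)"
      and eq: "evolve \<Phi> s = cut L (\<lambda>l. support \<Phi> l + s)"
      and shift: "\<And>t. t \<ge> 0 \<Longrightarrow> evolve (evolve \<Phi> s) t = evolve \<Phi> (s + t)"
      using evolving_polygon_evolve[OF \<Phi> s s0(2)] by metis
    interpret evolving_polygon L "\<lambda>l. support \<Phi> l + s" T "evolve \<Phi> s" by fact
    have cut: "evolve \<Phi> (s + t) = cut L (dt t)" if "t \<ge> 0" for t
      using shift[OF that] evolve_eq_cut[OF that] by simp
    have T: "final_time \<Phi> = s + T"
      unfolding final_time_def
    proof (rule Least_equality)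
      show "0 \<le> s + T \<and> interior (evolve \<Phi> (s + T)) = {}"
        using cut[of T] interior_final T_pos s by simp
      fix t assume t: "0 \<le> t \<and> interior (evolve \<Phi> t) = {}"
      show "s + T \<le> t"
      proof (rule ccontr)
        assume "\<not> s + T \<le> t"
        \<comment> \<open>The normals in \<open>L\<close> describe the evolution only from time
          \<open>s\<close> on; an earlier \<open>t\<close> is compared with the smaller set at time
          \<open>s\<close>.\<close>
        define t' where "t' = max 0 (t - s)"
        have t': "0 \<le> t'" "t' < T" "t \<le> s + t'"
          using \<open>\<not> s + T \<le> t\<close> T_pos by (auto simp: t'_def)
        have "interior (cut L (dt t')) \<noteq> {}"
          using lattice_polygon.interior_cut_nonempty[OF polygon_at[OF t'(1,2)]] .
        moreover have "interior (cut L (dt t')) \<subseteq> interior (evolve \<Phi> t)"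
          using evolve_antimono[OF \<Phi>(1) ne t'(3)] cut[OF t'(1)] by (intro interior_mono) simp
        ultimately show False using t by blast
      qed
    qed
    have final: "final_set \<Phi> = final_set (evolve \<Phi> s)"
      using cut[of T] final_set_eq T_pos by (simp add: final_set_def[of \<Phi>] T)
    have sum: "polygon_caustic_length (evolve \<Phi> s) + polygon_boundary_length (evolve \<Phi> s) =
      12 * (final_time \<Phi> - s) + 4 * tropical_length (final_set \<Phi>)"
      using caustic_plus_boundary_length unfolding final_time_eq final eq[symmetric] by (simp add: T)
    have B0: "polygon_boundary_length (evolve \<Phi> s) = perimeter 0"
      using perimeter_eq_boundary_length[of 0] T_pos eq by simp
    have mono: "polygon_boundary_length (evolve \<Phi> s) + 12 * s \<le> polygon_boundary_length (evolve \<Phi> t) + 12 * t"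
      if t: "s \<le> t" "t < s0" for t
    proof -
      have "cut L (dt (s0 - s)) \<noteq> {}" using cut[of "s0 - s"] s s0(2) by simp
      then have "s0 - s \<le> T" by (rule nonempty_imp_le_final)
      then have r: "0 \<le> t - s" "t - s < T" using t by auto
      have "polygon_boundary_length (evolve \<Phi> t) = perimeter (t - s)"
        using perimeter_eq_boundary_length[OF r] cut[OF r(1)] by simp
      then show ?thesis using perimeter_mono[of 0 "t - s"] r B0 by simp
    qed
    show "polygon_caustic_length (evolve \<Phi> s) + polygon_boundary_length (evolve \<Phi> s) =
        12 * (final_time \<Phi> - s) + 4 * tropical_length (final_set \<Phi>) \<and>
      polygon_boundary_length (evolve \<Phi> s) \<ge> 0 \<and>
      (\<forall>t. s \<le> t \<and> t < s0 \<longrightarrow> polygon_boundary_length (evolve \<Phi> s) + 12 * s \<le>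
        polygon_boundary_length (evolve \<Phi> t) + 12 * t)"
      using sum mono perimeter_nonneg[of 0] B0 by simp
  qed
qed

text \<open>For rational polygons the lengths are defined by finite sums, so their agreement with
  the limits is a statement: continuity of the perimeter at time 0.\<close>

lemma tendsto_boundary_length_rational:
  assumes "rational_polygon \<Phi>"
  shows "((\<lambda>t. polygon_boundary_length (evolve \<Phi> t)) \<longlongrightarrow> polygon_boundary_length \<Phi>) (at_right 0)"
    "polygon_caustic_length \<Phi> + polygon_boundary_length \<Phi> = 12 * final_time \<Phi> + 4 * tropical_length (final_set \<Phi>)"
proof -
  obtain L T where E: "evolving_polygon L (support \<Phi>) T \<Phi>" and eq: "\<Phi> = cut L (support \<Phi>)"
    using evolving_polygon_rational[OF assms] .
  interpret evolving_polygon L "support \<Phi>" T \<Phi> by fact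
  have "(perimeter \<longlongrightarrow> perimeter 0) (at_right 0)"
    using continuous_on_perimeter[of UNIV] by (auto simp: continuous_on_def intro: tendsto_within_subset)
  moreover have "perimeter 0 = polygon_boundary_length \<Phi>"
    using perimeter_eq_boundary_length[of 0] T_pos eq by simp
  moreover have "\<forall>\<^sub>F t in at_right 0. perimeter t = polygon_boundary_length (evolve \<Phi> t)"
  proof -
    have "\<forall>\<^sub>F t in at_right (0::real). t < T" by (rule order_tendstoD(2)[OF tendsto_ident_at T_pos])
    moreover have "\<forall>\<^sub>F t in at_right (0::real). 0 < t" by (rule eventually_at_right_less)
    ultimately show ?thesis
      by eventually_elim (simp add: evolve_eq_cut perimeter_eq_boundary_length)
  qed
  ultimately show "((\<lambda>t. polygon_boundary_length (evolve \<Phi> t)) \<longlongrightarrow> polygon_boundary_length \<Phi>) (at_right 0)"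
    using tendsto_cong by fastforce
  show "polygon_caustic_length \<Phi> + polygon_boundary_length \<Phi> = 12 * final_time \<Phi> + 4 * tropical_length (final_set \<Phi>)"
    using caustic_plus_boundary_length eq by simp
qed

theorem theorem56:
  fixes \<Phi> :: "(real^2) set"
  assumes "compact \<Phi>" and "convex \<Phi>" and "interior \<Phi> \<noteq> {}"
  shows "((\<lambda>t. polygon_caustic_length (evolve \<Phi> t)) \<longlongrightarrow> caustic_length \<Phi>) (at_right 0) \<and>
         ((\<lambda>t. polygon_boundary_length (evolve \<Phi> t)) \<longlongrightarrow> boundary_length \<Phi>) (at_right 0) \<and>
         caustic_length \<Phi> + boundary_length \<Phi> =
           12 * final_time \<Phi> + 4 * tropical_length (final_set \<Phi>)"
proof -
  let ?K = "\<lambda>t. polygon_caustic_length (evolve \<Phi> t)" and ?B = "\<lambda>t. polygon_boundary_length (evolve \<Phi> t)"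
  define C where "C = 12 * final_time \<Phi> + 4 * tropical_length (final_set \<Phi>)"
  obtain s0 where s0: "s0 > 0"
    and lengths: "\<And>s. 0 < s \<Longrightarrow> s < s0 \<Longrightarrow> ?K s + ?B s = 12 * (final_time \<Phi> - s) + 4 * tropical_length (final_set \<Phi>) \<and>
      ?B s \<ge> 0 \<and> (\<forall>t. s \<le> t \<and> t < s0 \<longrightarrow> ?B s + 12 * s \<le> ?B t + 12 * t)"
    using evolution_lengths[OF assms] by metis
  have "\<forall>\<^sub>F t in at_right (0::real). t < s0" by (rule order_tendstoD(2)[OF tendsto_ident_at s0])
  then have small: "\<forall>\<^sub>F t in at_right (0::real). 0 < t \<and> t < s0"
    using eventually_at_right_less[of "0::real"] by eventually_elim simp
  define c where "c = Inf ((\<lambda>t. ?B t + 12 * t) ` ({0<..} \<inter> {..<s0}))"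
  have "((\<lambda>t. ?B t + 12 * t) \<longlongrightarrow> c) (at 0 within ({0<..} \<inter> {..<s0}))"
    unfolding c_def
  proof (rule Lim_right_bound[where K = 0])
    fix a b :: real assume "a \<in> {..<s0}" "b \<in> {..<s0}" "0 < a" "a \<le> b"
    then show "?B a + 12 * a \<le> ?B b + 12 * b" using lengths[of a] by simp
  next
    fix a :: real assume "a \<in> {..<s0}" "0 < a"
    then show "0 \<le> ?B a + 12 * a" using lengths[of a] by simp
  qed
  moreover have "at 0 within ({0<..} \<inter> {..<s0}) = at_right (0::real)"
    using s0 by (intro at_within_nhd[of _ "{..<s0}"]) auto
  ultimately have "((\<lambda>t. ?B t + 12 * t) \<longlongrightarrow> c) (at_right 0)" by simp
  then have "((\<lambda>t. ?B t + 12 * t - 12 * t) \<longlongrightarrow> c - 12 * 0) (at_right 0)"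
    by (intro tendsto_intros)
  then have B: "(?B \<longlongrightarrow> c) (at_right 0)" by simp
  \<comment> \<open>The limit of the caustic lengths is obtained from the identity at each small
    time and the limit of the boundary lengths.\<close>
  have K: "(?K \<longlongrightarrow> C - c) (at_right 0)"
  proof (rule Lim_transform_eventually)
    have "((\<lambda>t. C - 12 * t - ?B t) \<longlongrightarrow> C - 12 * 0 - c) (at_right 0)"
      by (intro tendsto_intros B)
    then show "((\<lambda>t. C - 12 * t - ?B t) \<longlongrightarrow> C - c) (at_right 0)" by simp
    show "\<forall>\<^sub>F t in at_right 0. C - 12 * t - ?B t = ?K t"
      using small
    proof eventually_elim
      case (elim t)
      then show ?case using lengths[of t] by (simp add: C_def)
    qed
  qed
  have nontriv: "at_right (0::real) \<noteq> bot" by (rule trivial_limit_at_right_real)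
  have "caustic_length \<Phi> = C - c \<and> boundary_length \<Phi> = c"
  proof (cases "rational_polygon \<Phi>")
    case True
    have "c = polygon_boundary_length \<Phi>"
      using tendsto_unique[OF nontriv B tendsto_boundary_length_rational(1)[OF True]] .
    then show ?thesis
      using tendsto_boundary_length_rational(2)[OF True] True
      by (simp add: caustic_length_def boundary_length_def C_def)
  next
    case False
    then show ?thesis
      using tendsto_Lim[OF nontriv B] tendsto_Lim[OF nontriv K]
      by (simp add: caustic_length_def boundary_length_def)
  qed
  then show ?thesis using B K by (simp add: C_def)
qed

end
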